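(* Let $\sigma>0$, $\lambda>0$, $\Delta>0$, $p>1$, $Q_0>0$, $R_0^B>0$ and $k\in\mathbb{R}$ be fixed, and consider the two-chain arbitrage model (see context) with drift parameter $\mu$ ranging over all $\mu<0$ with $\lambda+(1-k)(\tfrac12 k\sigma^2-\mu)>0$. If $1/\lambda>\Delta p$, then there is a threshold $\hat\mu$ with $-\lambda\le\hat\mu\le 0$ such that, for all such $\mu$: if $\mu>\hat\mu$ (low expected depreciation of the value of token $B$), the arbitrageur chooses to hold inventory; and if $\mu<\hat\mu$ (high expected depreciation of the value of token $B$), the arbitrageur bridges.
   Context: Model. Value is measured in token $A$. The token $A$/token $B$ exchange rate $Q_t$ on a second, perfectly liquid market is a geometric Brownian motion, $dQ_t=\mu Q_t\,dt+\sigma Q_t\,dW_t$, with $Q_0>0$ deterministic and $W$ a standard Brownian motion. The first market is a constant product market maker with token-$B$ reserves $$R_t^B=\left(\frac{Q_0}{Q_t}\right)^k R_0^B$$ and token-$A$ reserves $R_t^A=Q_tR_t^B$ (outside arbitrage opportunities the two markets have the same exchange rate; $R^A_\tau$, $R^B_\tau$ below are the values at $t=\tau$ given by these formulas). Arbitrage opportunities arrive according to a Poisson process with rate $\lambda$, independent of $W$; the first opportunity arrives at time $\tau$, which is exponentially distributed with rate $\lambda$ and independent of $W$. At an opportunity, the second market's rate exceeds the first market's rate by the constant factor $p>1$. Bridging tokens from the first to the second market takes time $\Delta>0$. There are no fees or transaction costs. $E_0$ denotes expectation at time $0$. Bridging strategy. The arbitrageur holds no inventory on the second market and, at time $\tau$,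 trades $(\sqrt p\,e^{\mu\Delta/2}-1)R_\tau^A$ of token $A$ on the first market and bridges the purchased token $B$. Its expected profit given the information at time $\tau$ is $(\sqrt p\,e^{\mu\Delta/2}-1)^2R_\tau^A$, so its expected net payoff is $$\Pi^{\mathrm{br}}:=E_0\!\left[(\sqrt p\,e^{\mu\Delta/2}-1)^2R_\tau^A\right].$$ Inventory strategy. The arbitrageur maintains $I_t:=(1-\sqrt{1/p})R_t^B$ units of token $B$ on the second market for $0\le t\le\tau$, and at time $\tau$ completes the arbitrage instantaneously with profit $(\sqrt p-1)^2R_\tau^A$. The expected cost of inventory is $C(I):=-E_0\!\left[\int_0^\tau I_t\,dQ_t\right]$ (Itô integral), so the expected net payoff is $$\Pi^{\mathrm{inv}}:=E_0\!\left[(\sqrt p-1)^2R_\tau^A\right]-C(I).$$ The profit-maximizing arbitrageur holds inventory if $\Pi^{\mathrm{inv}}>\Pi^{\mathrm{br}}$ and bridges otherwise. *)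

theory Defs
  imports "HOL-Probability.Probability"
begin

section \<open>Brownian motion and the It\^o integral\<close>

text \<open>Processes have type \<open>real \<Rightarrow> 'a \<Rightarrow> real\<close>; only times \<open>t \<ge> 0\<close> matter.  A filtration is indexed
  by all of \<open>real\<close> because the library locale is stated for a whole index type; the part below \<open>0\<close>
  plays no role.  No usual conditions are assumed.\<close>

definition adapted_continuous ::
    "'a measure \<Rightarrow> (real \<Rightarrow> 'a measure) \<Rightarrow> (real \<Rightarrow> 'a \<Rightarrow> real) \<Rightarrow> bool" where
  "adapted_continuous M F X \<longleftrightarrow>
     (\<forall>t\<ge>0. X t \<in> borel_measurable (F t)) \<and>
     (\<forall>\<omega>\<in>space M. continuous_on {0..} (\<lambda>t. X t \<omega>))"

definition standard_brownian_motion ::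
    "'a measure \<Rightarrow> (real \<Rightarrow> 'a measure) \<Rightarrow> (real \<Rightarrow> 'a \<Rightarrow> real) \<Rightarrow> bool" where
  "standard_brownian_motion M F W \<longleftrightarrow>
     prob_space M \<and> filtration (space M) F \<and> (\<forall>t. subalgebra M (F t)) \<and>
     adapted_continuous M F W \<and> (\<forall>\<omega>\<in>space M. W 0 \<omega> = 0) \<and>
     (\<forall>s t. 0 \<le> s \<and> s < t \<longrightarrow>
        distributed M lborel (\<lambda>\<omega>. W t \<omega> - W s \<omega>) (normal_density 0 (sqrt (t - s))) \<and>
        prob_space.indep_set M (sets (F s))
          (sets (vimage_algebra (space M) (\<lambda>\<omega>. W t \<omega> - W s \<omega>) borel)))"

definition progressively_measurable ::
    "(real \<Rightarrow> 'a measure) \<Rightarrow> (real \<Rightarrow> 'a \<Rightarrow> real) \<Rightarrow> bool" where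
  "progressively_measurable F H \<longleftrightarrow>
     (\<forall>t\<ge>0. (\<lambda>(s, \<omega>). H s \<omega>) \<in> borel_measurable (restrict_space borel {0..t} \<Otimes>\<^sub>M F t))"

text \<open>The simple integrand \<open>\<Sum>i<n. \<xi> i * 1_(p i, p (i+1)]\<close> and its integral against \<open>W\<close> over \<open>[0, t]\<close>.\<close>

definition simple_integrand ::
    "'a measure \<Rightarrow> (real \<Rightarrow> 'a measure) \<Rightarrow> nat \<Rightarrow> (nat \<Rightarrow> real) \<Rightarrow> (nat \<Rightarrow> 'a \<Rightarrow> real) \<Rightarrow> bool" where
  "simple_integrand M F n p \<xi> \<longleftrightarrow>
     0 \<le> p 0 \<and> (\<forall>i<n. p i \<le> p (Suc i)) \<and>
     (\<forall>i<n. \<xi> i \<in> borel_measurable (F (p i))) \<and>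
     (\<exists>B. \<forall>i<n. \<forall>\<omega>\<in>space M. \<bar>\<xi> i \<omega>\<bar> \<le> B)"

definition simple_process ::
    "nat \<Rightarrow> (nat \<Rightarrow> real) \<Rightarrow> (nat \<Rightarrow> 'a \<Rightarrow> real) \<Rightarrow> real \<Rightarrow> 'a \<Rightarrow> real" where
  "simple_process n p \<xi> s \<omega> = (\<Sum>i<n. \<xi> i \<omega> * indicator {p i<..p (Suc i)} s)"

definition simple_integral ::
    "(real \<Rightarrow> 'a \<Rightarrow> real) \<Rightarrow> nat \<Rightarrow> (nat \<Rightarrow> real) \<Rightarrow> (nat \<Rightarrow> 'a \<Rightarrow> real) \<Rightarrow> real \<Rightarrow> 'a \<Rightarrow> real" where
  "simple_integral W n p \<xi> t \<omega> =
     (\<Sum>i<n. \<xi> i \<omega> * (W (min t (p (Suc i))) \<omega> - W (min t (p i)) \<omega>))"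

text \<open>Convergence to \<open>0\<close> in probability, for \<open>[0, \<infinity>]\<close>-valued variables so that it also covers error
  integrals that may be infinite.  Measurability is demanded explicitly, since \<open>measure\<close> returns \<open>0\<close>
  on non-measurable sets.\<close>

definition null_in_probability :: "'a measure \<Rightarrow> (nat \<Rightarrow> 'a \<Rightarrow> ennreal) \<Rightarrow> bool" where
  "null_in_probability M X \<longleftrightarrow>
     (\<forall>n. X n \<in> borel_measurable M) \<and>
     (\<forall>\<epsilon>>0. (\<lambda>n. measure M {\<omega> \<in> space M. ennreal \<epsilon> \<le> X n \<omega>}) \<longlonglongrightarrow> 0)"

text \<open>\<open>Y\<close> is (a version of) \<open>\<integral>\<^sub>0\<^sup>t H dW\<close> in the sense of It\^o: the limit in probability of the integrals of
  simple integrands approximating \<open>H\<close> in \<open>L\<^sup>2[0, t]\<close>, in probability.  The approximation condition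
  forces \<open>\<integral>\<^sub>0\<^sup>t H\<^sup>2 ds < \<infinity>\<close> almost surely.\<close>

definition has_ito_integral ::
    "'a measure \<Rightarrow> (real \<Rightarrow> 'a measure) \<Rightarrow> (real \<Rightarrow> 'a \<Rightarrow> real) \<Rightarrow> (real \<Rightarrow> 'a \<Rightarrow> real) \<Rightarrow> real \<Rightarrow>
      ('a \<Rightarrow> real) \<Rightarrow> bool" where
  "has_ito_integral M F W H t Y \<longleftrightarrow>
     progressively_measurable F H \<and> Y \<in> borel_measurable M \<and>
     (\<exists>N p \<xi>. (\<forall>n. simple_integrand M F (N n) (p n) (\<xi> n)) \<and>
        null_in_probability M
          (\<lambda>n \<omega>. \<integral>\<^sup>+ s. ennreal ((simple_process (N n) (p n) (\<xi> n) s \<omega> - H s \<omega>)\<^sup>2)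
                         * indicator {0..t} s \<partial>lborel) \<and>
        null_in_probability M
          (\<lambda>n \<omega>. ennreal \<bar>simple_integral W (N n) (p n) (\<xi> n) t \<omega> - Y \<omega>\<bar>))"

text \<open>\<open>dX = a dt + b dW\<close>\<close>

definition ito_process ::
    "'a measure \<Rightarrow> (real \<Rightarrow> 'a measure) \<Rightarrow> (real \<Rightarrow> 'a \<Rightarrow> real) \<Rightarrow> (real \<Rightarrow> 'a \<Rightarrow> real) \<Rightarrow>
      (real \<Rightarrow> 'a \<Rightarrow> real) \<Rightarrow> (real \<Rightarrow> 'a \<Rightarrow> real) \<Rightarrow> bool" where
  "ito_process M F W a b X \<longleftrightarrow>
     adapted_continuous M F X \<and> progressively_measurable F a \<and>
     (\<forall>t\<ge>0. (AE \<omega> in M. set_integrable lborel {0..t} (\<lambda>s. a s \<omega>)) \<and>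
        has_ito_integral M F W b t (\<lambda>\<omega>. X t \<omega> - X 0 \<omega> - (LBINT s:{0..t}. a s \<omega>)))"

text \<open>For \<open>dX = a dt + b dW\<close>, the continuous process \<open>t \<mapsto> \<integral>\<^sub>0\<^sup>t H dX = \<integral>\<^sub>0\<^sup>t H a ds + \<integral>\<^sub>0\<^sup>t H b dW\<close>.
  It is unique up to indistinguishability, so the choice operator is harmless whenever the
  integral exists.\<close>

definition ito_integral ::
    "'a measure \<Rightarrow> (real \<Rightarrow> 'a measure) \<Rightarrow> (real \<Rightarrow> 'a \<Rightarrow> real) \<Rightarrow> (real \<Rightarrow> 'a \<Rightarrow> real) \<Rightarrow>
      (real \<Rightarrow> 'a \<Rightarrow> real) \<Rightarrow> (real \<Rightarrow> 'a \<Rightarrow> real) \<Rightarrow> real \<Rightarrow> 'a \<Rightarrow> real" where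
  "ito_integral M F W a b H =
     (SOME Y. ito_process M F W (\<lambda>s \<omega>. H s \<omega> * a s \<omega>) (\<lambda>s \<omega>. H s \<omega> * b s \<omega>) Y \<and>
        (\<forall>\<omega>\<in>space M. Y 0 \<omega> = 0))"

definition geometric_brownian_motion ::
    "'a measure \<Rightarrow> (real \<Rightarrow> 'a measure) \<Rightarrow> (real \<Rightarrow> 'a \<Rightarrow> real) \<Rightarrow> real \<Rightarrow> real \<Rightarrow> real \<Rightarrow>
      (real \<Rightarrow> 'a \<Rightarrow> real) \<Rightarrow> bool" where
  "geometric_brownian_motion M F W \<mu> \<sigma> Q0 Q \<longleftrightarrow>
     ito_process M F W (\<lambda>t \<omega>. \<mu> * Q t \<omega>) (\<lambda>t \<omega>. \<sigma> * Q t \<omega>) Q \<and>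
     (\<forall>\<omega>\<in>space M. Q 0 \<omega> = Q0)"

section \<open>The two-chain arbitrage model\<close>

text \<open>\<open>Q\<close> is the exchange rate on the second market and \<open>\<tau>\<close> the first arrival time of the Poisson
  process of opportunities; nothing else of that process enters the payoffs.  Independence of \<open>\<tau>\<close>
  from \<open>W\<close> refers to the whole path of \<open>W\<close>.\<close>

definition two_chain_model ::
    "'a measure \<Rightarrow> (real \<Rightarrow> 'a measure) \<Rightarrow> (real \<Rightarrow> 'a \<Rightarrow> real) \<Rightarrow> (real \<Rightarrow> 'a \<Rightarrow> real) \<Rightarrow> ('a \<Rightarrow> real) \<Rightarrow>
      real \<Rightarrow> real \<Rightarrow> real \<Rightarrow> real \<Rightarrow> bool" where
  "two_chain_model M F W Q \<tau> \<mu> \<sigma> lam Q0 \<longleftrightarrow>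
     standard_brownian_motion M F W \<and>
     geometric_brownian_motion M F W \<mu> \<sigma> Q0 Q \<and>
     (\<forall>\<omega>\<in>space M. 0 \<le> \<tau> \<omega>) \<and>
     distributed M lborel \<tau> (exponential_density lam) \<and>
     prob_space.indep_set M
       (sets (vimage_algebra (space M) \<tau> borel))
       (sets (vimage_algebra (space M) (\<lambda>\<omega>. \<lambda>t\<in>{0..}. W t \<omega>) (\<Pi>\<^sub>M t\<in>{0..}. borel)))"

definition reserve_B :: "(real \<Rightarrow> 'a \<Rightarrow> real) \<Rightarrow> real \<Rightarrow> real \<Rightarrow> real \<Rightarrow> real \<Rightarrow> 'a \<Rightarrow> real" where
  "reserve_B Q Q0 RB0 k t \<omega> = (Q0 / Q t \<omega>) powr k * RB0"

definition reserve_A :: "(real \<Rightarrow> 'a \<Rightarrow> real) \<Rightarrow> real \<Rightarrow> real \<Rightarrow> real \<Rightarrow> real \<Rightarrow> 'a \<Rightarrow> real" where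
  "reserve_A Q Q0 RB0 k t \<omega> = Q t \<omega> * reserve_B Q Q0 RB0 k t \<omega>"

definition payoff_bridging ::
    "'a measure \<Rightarrow> (real \<Rightarrow> 'a \<Rightarrow> real) \<Rightarrow> ('a \<Rightarrow> real) \<Rightarrow> real \<Rightarrow> real \<Rightarrow> real \<Rightarrow> real \<Rightarrow> real \<Rightarrow> real \<Rightarrow>
      real" where
  "payoff_bridging M Q \<tau> \<mu> \<Delta> p Q0 RB0 k =
     (\<integral>\<omega>. (sqrt p * exp (\<mu> * \<Delta> / 2) - 1)\<^sup>2 * reserve_A Q Q0 RB0 k (\<tau> \<omega>) \<omega> \<partial>M)"

definition inventory ::
    "(real \<Rightarrow> 'a \<Rightarrow> real) \<Rightarrow> real \<Rightarrow> real \<Rightarrow> real \<Rightarrow> real \<Rightarrow> real \<Rightarrow> 'a \<Rightarrow> real" where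
  "inventory Q p Q0 RB0 k t \<omega> = (1 - sqrt (1 / p)) * reserve_B Q Q0 RB0 k t \<omega>"

definition inventory_cost ::
    "'a measure \<Rightarrow> (real \<Rightarrow> 'a measure) \<Rightarrow> (real \<Rightarrow> 'a \<Rightarrow> real) \<Rightarrow> (real \<Rightarrow> 'a \<Rightarrow> real) \<Rightarrow> ('a \<Rightarrow> real) \<Rightarrow>
      real \<Rightarrow> real \<Rightarrow> (real \<Rightarrow> 'a \<Rightarrow> real) \<Rightarrow> real" where
  "inventory_cost M F W Q \<tau> \<mu> \<sigma> I =
     - (\<integral>\<omega>. ito_integral M F W (\<lambda>t \<omega>. \<mu> * Q t \<omega>) (\<lambda>t \<omega>. \<sigma> * Q t \<omega>) I (\<tau> \<omega>) \<omega> \<partial>M)"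

definition payoff_inventory ::
    "'a measure \<Rightarrow> (real \<Rightarrow> 'a measure) \<Rightarrow> (real \<Rightarrow> 'a \<Rightarrow> real) \<Rightarrow> (real \<Rightarrow> 'a \<Rightarrow> real) \<Rightarrow> ('a \<Rightarrow> real) \<Rightarrow>
      real \<Rightarrow> real \<Rightarrow> real \<Rightarrow> real \<Rightarrow> real \<Rightarrow> real \<Rightarrow> real" where
  "payoff_inventory M F W Q \<tau> \<mu> \<sigma> p Q0 RB0 k =
     (\<integral>\<omega>. (sqrt p - 1)\<^sup>2 * reserve_A Q Q0 RB0 k (\<tau> \<omega>) \<omega> \<partial>M)
       - inventory_cost M F W Q \<tau> \<mu> \<sigma> (inventory Q p Q0 RB0 k)"

definition holds_inventory ::
    "'a measure \<Rightarrow> (real \<Rightarrow> 'a measure) \<Rightarrow> (real \<Rightarrow> 'a \<Rightarrow> real) \<Rightarrow> (real \<Rightarrow> 'a \<Rightarrow> real) \<Rightarrow> ('a \<Rightarrow> real) \<Rightarrow>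
      real \<Rightarrow> real \<Rightarrow> real \<Rightarrow> real \<Rightarrow> real \<Rightarrow> real \<Rightarrow> real \<Rightarrow> bool" where
  "holds_inventory M F W Q \<tau> \<mu> \<sigma> \<Delta> p Q0 RB0 k \<longleftrightarrow>
     payoff_inventory M F W Q \<tau> \<mu> \<sigma> p Q0 RB0 k > payoff_bridging M Q \<tau> \<mu> \<Delta> p Q0 RB0 k"

definition bridges ::
    "'a measure \<Rightarrow> (real \<Rightarrow> 'a measure) \<Rightarrow> (real \<Rightarrow> 'a \<Rightarrow> real) \<Rightarrow> (real \<Rightarrow> 'a \<Rightarrow> real) \<Rightarrow> ('a \<Rightarrow> real) \<Rightarrow>
      real \<Rightarrow> real \<Rightarrow> real \<Rightarrow> real \<Rightarrow> real \<Rightarrow> real \<Rightarrow> real \<Rightarrow> bool" where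
  "bridges M F W Q \<tau> \<mu> \<sigma> \<Delta> p Q0 RB0 k \<longleftrightarrow> \<not> holds_inventory M F W Q \<tau> \<mu> \<sigma> \<Delta> p Q0 RB0 k"

end

theory Submission
  imports Defs
begin

text \<open>
  Write \<open>c = (1 - k) (\<mu> - k \<sigma>^2 / 2)\<close>, so that the hypothesis on the drift reads \<open>c < \<lambda>\<close>.  The equation for
  \<open>Q\<close> has the unique solution \<open>Q0 exp (\<sigma> W + (\<mu> - \<sigma>^2 / 2) t)\<close>, hence \<open>R^A\<close> is again the exponential of a
  Brownian motion with drift, of mean \<open>R^A_0 exp (c t)\<close>.  Since \<open>\<tau>\<close> is independent of \<open>W\<close>, the mean of \<open>R^A\<close> at \<open>\<tau>\<close>
  is \<open>R^A_0 \<lambda> / (\<lambda> - c)\<close>, that of its integral over \<open>[0, \<tau>]\<close> is \<open>R^A_0 / (\<lambda> - c)\<close>, and the martingale part of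
  the gain from inventory has mean \<open>0\<close>.  So inventory is better than bridging iff
  \<open>\<lambda> (sqrt p - 1)^2 + (1 - 1 / sqrt p) \<mu> > \<lambda> (sqrt p exp (\<mu> \<Delta> / 2) - 1)^2\<close>.  If \<open>1 / \<lambda> > \<Delta> p\<close>, this fails for every
  \<open>\<mu> < 0\<close>, and the threshold is \<open>0\<close>.

  It\^o integrals of continuous integrands are handled through their left-point sums on uniform grids: a
  variable is the integral iff these sums converge to it in probability.
\<close>

section \<open>Convergence in probability\<close>

text \<open>Independence of \<open>\<tau>\<close> concerns the path of \<open>W\<close> only, while
  \<open>Q\<close> is adapted to \<open>F\<close>, which may carry more. So \<open>Q\<close> has to
  be identified as a function of \<open>W\<close> before Fubini applies at \<open>\<tau>\<close>;
  and as \<open>\<tau>\<close> is random, the identification must hold at all times off one null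
  set, hence the continuous versions. The gain from inventory is moreover a choice among versions of
  an integral: a version must be exhibited before the choice says anything, and uniqueness then
  transfers its value. Exhibiting needs sums to yield the integral, uniqueness needs the integral to
  yield sums, so both directions are proved. As the inventory times \<open>Q\<close> is a constant
  multiple of \<open>R^A\<close>, one instance of Ito's formula, for \<open>exp (a W + b t)\<close>,
  serves both the equation of \<open>Q\<close> and the gain. The bound \<open>c < \<lambda>\<close>
  makes first moments at \<open>\<tau>\<close> finite but need not make second ones finite, so the
  martingale part is treated there in \<open>L^1\<close> through its explicit formula; the isometry
  is used on bounded time intervals only.\<close>

lemma measurable_continuous_process:
  fixes X :: "real \<Rightarrow> 'a \<Rightarrow> real"
  assumes meas: "\<And>t. X t \<in> borel_measurable N"
    and cont: "\<And>\<omega>. \<omega> \<in> space N \<Longrightarrow> continuous_on UNIV (\<lambda>t. X t \<omega>)"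
  shows "(\<lambda>(t, \<omega>). X t \<omega>) \<in> borel_measurable (borel \<Otimes>\<^sub>M N)"
proof (rule borel_measurable_LIMSEQ_real)
  fix z :: "real \<times> 'a" assume z: "z \<in> space (borel \<Otimes>\<^sub>M N)"
  obtain t \<omega> where zt: "z = (t, \<omega>)" by (cases z)
  have w: "\<omega> \<in> space N" using z zt by (simp add: space_pair_measure)
  \<comment> \<open>Rounding time down to a multiple of \<open>1 / Suc n\<close> leaves countably
    many sampling times, for which joint measurability is immediate; continuity of the paths
    recovers \<open>X\<close> in the limit.\<close>
  have "(\<lambda>n. real_of_int \<lfloor>t * real (Suc n)\<rfloor> / real (Suc n)) \<longlonglongrightarrow> t"
  proof (rule LIMSEQ_I)
    fix r :: real assume "r > 0"
    then obtain n0 where n0: "inverse (real (Suc n0)) < r" using reals_Archimedean by blast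
    have "norm (real_of_int \<lfloor>t * real (Suc n)\<rfloor> / real (Suc n) - t) < r" if "n \<ge> n0" for n
    proof -
      have "\<bar>real_of_int \<lfloor>t * real (Suc n)\<rfloor> - t * real (Suc n)\<bar> \<le> 1" by linarith
      moreover have "real_of_int \<lfloor>t * real (Suc n)\<rfloor> / real (Suc n) - t =
        (real_of_int \<lfloor>t * real (Suc n)\<rfloor> - t * real (Suc n)) / real (Suc n)"
        by (simp add: field_simps)
      ultimately have "\<bar>real_of_int \<lfloor>t * real (Suc n)\<rfloor> / real (Suc n) - t\<bar> \<le> inverse (real (Suc n))"
        by (simp add: abs_divide inverse_eq_divide divide_right_mono)
      also have "\<dots> \<le> inverse (real (Suc n0))" using that by (simp add: le_imp_inverse_le)
      finally show ?thesis using n0 by simp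
    qed
    then show "\<exists>no. \<forall>n\<ge>no. norm (real_of_int \<lfloor>t * real (Suc n)\<rfloor> / real (Suc n) - t) < r" by blast
  qed
  then have "(\<lambda>n. X (real_of_int \<lfloor>t * real (Suc n)\<rfloor> / real (Suc n)) \<omega>) \<longlonglongrightarrow> X t \<omega>"
    by (rule continuous_on_tendsto_compose[OF cont[OF w]]) auto
  then show "(\<lambda>n. X (real_of_int \<lfloor>fst z * real (Suc n)\<rfloor> / real (Suc n)) (snd z)) \<longlonglongrightarrow> (case z of (t, \<omega>) \<Rightarrow> X t \<omega>)"
    by (simp add: zt)
next
  fix n
  show "(\<lambda>z. X (real_of_int \<lfloor>fst z * real (Suc n)\<rfloor> / real (Suc n)) (snd z)) \<in> borel_measurable (borel \<Otimes>\<^sub>M N)"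
    by (rule measurable_compose_countable[where f="\<lambda>i z. X (real_of_int i / real (Suc n)) (snd z)"
          and g="\<lambda>z. \<lfloor>fst z * real (Suc n)\<rfloor>"])
       (use meas in \<open>auto intro: measurable_compose[OF measurable_snd]\<close>)
qed

context prob_space
begin

text \<open>The truncated \<open>L^1\<close> distance metrizes convergence in probability. In this
  form dominated convergence and the almost sure subsequence of an \<open>L^1\<close> limit apply at
  once; \<open>conv_prob_iff\<close> is the bridge to probabilities of deviations.\<close>

definition conv_prob :: "(nat \<Rightarrow> 'a \<Rightarrow> real) \<Rightarrow> ('a \<Rightarrow> real) \<Rightarrow> bool" where
  "conv_prob X Y \<longleftrightarrow> (\<forall>n. X n \<in> borel_measurable M) \<and> Y \<in> borel_measurable M \<and>
     (\<lambda>n. \<integral>\<omega>. min 1 \<bar>X n \<omega> - Y \<omega>\<bar> \<partial>M) \<longlonglongrightarrow> 0"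

lemma integrable_min_abs:
  "X \<in> borel_measurable M \<Longrightarrow> integrable M (\<lambda>\<omega>. min 1 \<bar>X \<omega>\<bar> :: real)"
  by (rule integrable_const_bound[where B=1]) auto

lemma conv_prob_measurable:
  assumes "conv_prob X Y" shows "X n \<in> borel_measurable M" "Y \<in> borel_measurable M"
  using assms by (auto simp: conv_prob_def)

lemma conv_prob_AE_tendsto:
  assumes [measurable]: "\<And>n. X n \<in> borel_measurable M" "Y \<in> borel_measurable M"
    and lim: "AE \<omega> in M. (\<lambda>n. X n \<omega>) \<longlonglongrightarrow> Y \<omega>"
  shows "conv_prob X Y"
proof -
  have "(\<lambda>n. \<integral>\<omega>. min 1 \<bar>X n \<omega> - Y \<omega>\<bar> \<partial>M) \<longlonglongrightarrow> (\<integral>\<omega>. 0 \<partial>M)"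
  proof (rule integral_dominated_convergence[where w="\<lambda>_. 1"])
    show "AE \<omega> in M. (\<lambda>n. min 1 \<bar>X n \<omega> - Y \<omega>\<bar>) \<longlonglongrightarrow> 0"
      using lim
    proof eventually_elim
      case (elim \<omega>)
      then have "(\<lambda>n. min 1 \<bar>X n \<omega> - Y \<omega>\<bar>) \<longlonglongrightarrow> min 1 \<bar>Y \<omega> - Y \<omega>\<bar>"
        by (intro tendsto_intros)
      then show ?case by simp
    qed
  qed auto
  then show ?thesis by (simp add: conv_prob_def)
qed

lemma conv_prob_lincomb:
  assumes X: "conv_prob X Y" and X': "conv_prob X' Y'"
  shows "conv_prob (\<lambda>n \<omega>. a * X n \<omega> + b * X' n \<omega>) (\<lambda>\<omega>. a * Y \<omega> + b * Y' \<omega>)"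
proof -
  note [measurable] = conv_prob_measurable[OF X] conv_prob_measurable[OF X']
  \<comment> \<open>The factor is \<open>1 + \<bar>c\<bar>\<close> and not
    \<open>\<bar>c\<bar>\<close>: for \<open>\<bar>x\<bar> > 1\<close> the right side has to reach 1
    even when \<open>c\<close> is small.\<close>
  have scale: "min 1 \<bar>c * x\<bar> \<le> (1 + \<bar>c\<bar>) * min 1 \<bar>x\<bar>" for c x :: real
  proof (cases "\<bar>x\<bar> \<le> 1")
    case True
    have "min 1 \<bar>c * x\<bar> \<le> \<bar>c\<bar> * \<bar>x\<bar>" by (simp add: abs_mult)
    also have "\<dots> \<le> (1 + \<bar>c\<bar>) * \<bar>x\<bar>" by (simp add: algebra_simps)
    finally show ?thesis using True by (simp add: min_def)
  qed (auto simp: min_def)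
  have bound: "min 1 \<bar>(a * x + b * x') - (a * y + b * y')\<bar>
      \<le> (1 + \<bar>a\<bar>) * min 1 \<bar>x - y\<bar> + (1 + \<bar>b\<bar>) * min 1 \<bar>x' - y'\<bar>" for x x' y y' :: real
  proof -
    have "(a * x + b * x') - (a * y + b * y') = a * (x - y) + b * (x' - y')" by (simp add: algebra_simps)
    then have "min 1 \<bar>(a * x + b * x') - (a * y + b * y')\<bar> \<le> min 1 \<bar>a * (x - y)\<bar> + min 1 \<bar>b * (x' - y')\<bar>"
      by (simp add: min_def) linarith
    then show ?thesis using scale[of a "x - y"] scale[of b "x' - y'"] by linarith
  qed
  have "(\<lambda>n. \<integral>\<omega>. min 1 \<bar>(a * X n \<omega> + b * X' n \<omega>) - (a * Y \<omega> + b * Y' \<omega>)\<bar> \<partial>M) \<longlonglongrightarrow> 0"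
  proof (rule tendsto_sandwich[where f="\<lambda>_. 0" and
        h="\<lambda>n. (1 + \<bar>a\<bar>) * (\<integral>\<omega>. min 1 \<bar>X n \<omega> - Y \<omega>\<bar> \<partial>M) + (1 + \<bar>b\<bar>) * (\<integral>\<omega>. min 1 \<bar>X' n \<omega> - Y' \<omega>\<bar> \<partial>M)"])
    show "\<forall>\<^sub>F n in sequentially. 0 \<le> (\<integral>\<omega>. min 1 \<bar>(a * X n \<omega> + b * X' n \<omega>) - (a * Y \<omega> + b * Y' \<omega>)\<bar> \<partial>M)"
      by (intro always_eventually allI integral_nonneg_AE) auto
    have "(\<integral>\<omega>. min 1 \<bar>(a * X n \<omega> + b * X' n \<omega>) - (a * Y \<omega> + b * Y' \<omega>)\<bar> \<partial>M) \<le>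
      (\<integral>\<omega>. (1 + \<bar>a\<bar>) * min 1 \<bar>X n \<omega> - Y \<omega>\<bar> + (1 + \<bar>b\<bar>) * min 1 \<bar>X' n \<omega> - Y' \<omega>\<bar> \<partial>M)" for n
      by (intro integral_mono integrable_min_abs Bochner_Integration.integrable_add integrable_mult_right bound) measurable
    also have "\<dots> n = (1 + \<bar>a\<bar>) * (\<integral>\<omega>. min 1 \<bar>X n \<omega> - Y \<omega>\<bar> \<partial>M) + (1 + \<bar>b\<bar>) * (\<integral>\<omega>. min 1 \<bar>X' n \<omega> - Y' \<omega>\<bar> \<partial>M)" for n
      by (subst Bochner_Integration.integral_add) (auto intro!: integrable_min_abs)
    finally show "\<forall>\<^sub>F n in sequentially. (\<integral>\<omega>. min 1 \<bar>(a * X n \<omega> + b * X' n \<omega>) - (a * Y \<omega> + b * Y' \<omega>)\<bar> \<partial>M)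
      \<le> (1 + \<bar>a\<bar>) * (\<integral>\<omega>. min 1 \<bar>X n \<omega> - Y \<omega>\<bar> \<partial>M) + (1 + \<bar>b\<bar>) * (\<integral>\<omega>. min 1 \<bar>X' n \<omega> - Y' \<omega>\<bar> \<partial>M)"
      by (intro always_eventually allI)
    show "(\<lambda>n. (1 + \<bar>a\<bar>) * (\<integral>\<omega>. min 1 \<bar>X n \<omega> - Y \<omega>\<bar> \<partial>M) + (1 + \<bar>b\<bar>) * (\<integral>\<omega>. min 1 \<bar>X' n \<omega> - Y' \<omega>\<bar> \<partial>M)) \<longlonglongrightarrow> 0"
      using X X' by (auto simp: conv_prob_def intro!: tendsto_eq_intros)
  qed auto
  then show ?thesis by (simp add: conv_prob_def)
qed

lemma conv_prob_cong:
  assumes "conv_prob X Y" "\<And>n. X' n \<in> borel_measurable M" "Y' \<in> borel_measurable M"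
    and "\<And>n. AE \<omega> in M. X n \<omega> = X' n \<omega>" "AE \<omega> in M. Y \<omega> = Y' \<omega>"
  shows "conv_prob X' Y'"
proof -
  note [measurable] = conv_prob_measurable[OF assms(1)] assms(2,3)
  have "(\<integral>\<omega>. min 1 \<bar>X' n \<omega> - Y' \<omega>\<bar> \<partial>M) = (\<integral>\<omega>. min 1 \<bar>X n \<omega> - Y \<omega>\<bar> \<partial>M)" for n
    by (rule integral_cong_AE) (use assms(4)[of n] assms(5) in auto)
  then show ?thesis using assms by (simp add: conv_prob_def)
qed

lemma conv_prob_AE_subseq:
  assumes "conv_prob X Y"
  obtains r :: "nat \<Rightarrow> nat" where "strict_mono r" "AE \<omega> in M. (\<lambda>n. X (r n) \<omega>) \<longlonglongrightarrow> Y \<omega>"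
proof -
  note [measurable] = conv_prob_measurable[OF assms(1)]
  have "\<exists>r. strict_mono r \<and> (AE \<omega> in M. (\<lambda>n. min 1 \<bar>X (r n) \<omega> - Y \<omega>\<bar>) \<longlonglongrightarrow> 0)"
    by (rule tendsto_L1_AE_subseq) (use assms in \<open>auto simp: conv_prob_def intro!: integrable_min_abs\<close>)
  then obtain r where r: "strict_mono r" "AE \<omega> in M. (\<lambda>n. min 1 \<bar>X (r n) \<omega> - Y \<omega>\<bar>) \<longlonglongrightarrow> 0" by blast
  have "(\<lambda>n. x n) \<longlonglongrightarrow> y" if "(\<lambda>n. min 1 \<bar>x n - y\<bar>) \<longlonglongrightarrow> 0" for x :: "nat \<Rightarrow> real" and y
  proof -
    \<comment> \<open>Once the truncated distance is below 1 it is the distance itself, so nothing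
      is lost by the truncation.\<close>
    have "eventually (\<lambda>n. min 1 \<bar>x n - y\<bar> < 1) sequentially"
      using order_tendstoD(2)[OF that] by simp
    then have "eventually (\<lambda>n. min 1 \<bar>x n - y\<bar> = \<bar>x n - y\<bar>) sequentially"
      by eventually_elim simp
    then have "(\<lambda>n. \<bar>x n - y\<bar>) \<longlonglongrightarrow> 0" using that by (rule Lim_transform_eventually[rotated])
    then show ?thesis using LIM_zero_cancel tendsto_rabs_zero_iff by blast
  qed
  with r(2) have "AE \<omega> in M. (\<lambda>n. X (r n) \<omega>) \<longlonglongrightarrow> Y \<omega>" by auto
  then show ?thesis using that r(1) by blast
qed

lemma conv_prob_unique:
  assumes "conv_prob X Y" "conv_prob X Y'"
  shows "AE \<omega> in M. Y \<omega> = Y' \<omega>"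
proof -
  \<comment> \<open>The zero sequence, written as a linear combination, converges to
    \<open>Y - Y'\<close>; along an almost surely convergent subsequence the limit must be
    0.\<close>
  have "conv_prob (\<lambda>n \<omega>. 1 * X n \<omega> + (-1) * X n \<omega>) (\<lambda>\<omega>. 1 * Y \<omega> + (-1) * Y' \<omega>)"
    by (rule conv_prob_lincomb assms)+
  from conv_prob_AE_subseq[OF this] obtain r :: "nat \<Rightarrow> nat"
    where "AE \<omega> in M. (\<lambda>n. 1 * X (r n) \<omega> + (-1) * X (r n) \<omega>) \<longlonglongrightarrow> 1 * Y \<omega> + (-1) * Y' \<omega>" by blast
  then show ?thesis
  proof eventually_elim
    case (elim \<omega>)
    then have "(\<lambda>n::nat. 0) \<longlonglongrightarrow> Y \<omega> - Y' \<omega>" by simp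
    then show ?case by (simp add: LIMSEQ_const_iff)
  qed
qed

lemma prob_le_min_abs:
  assumes [measurable]: "X \<in> borel_measurable M" and e: "0 < e" "e \<le> 1"
  shows "prob {\<omega>\<in>space M. e \<le> \<bar>X \<omega>\<bar>} \<le> (\<integral>\<omega>. min 1 \<bar>X \<omega>\<bar> \<partial>M) / e"
proof -
  have "{\<omega>\<in>space M. e \<le> \<bar>X \<omega>\<bar>} = {\<omega>\<in>space M. e \<le> min 1 \<bar>X \<omega>\<bar>}" using e by auto
  then show ?thesis
    using integral_Markov_inequality_measure[where u="\<lambda>\<omega>. min 1 \<bar>X \<omega>\<bar>" and c=e and A="{}"] e
    by (simp add: integrable_min_abs)
qed

lemma conv_prob_iff:
  "conv_prob X Y \<longleftrightarrow> (\<forall>n. X n \<in> borel_measurable M) \<and> Y \<in> borel_measurable M \<and>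
     (\<forall>e>0. (\<lambda>n. prob {\<omega>\<in>space M. e \<le> \<bar>X n \<omega> - Y \<omega>\<bar>}) \<longlonglongrightarrow> 0)"
proof (intro iffI conjI)
  assume c: "conv_prob X Y"
  note [measurable] = conv_prob_measurable[OF c]
  show "\<forall>n. X n \<in> borel_measurable M" "Y \<in> borel_measurable M" by auto
  show "\<forall>e>0. (\<lambda>n. prob {\<omega>\<in>space M. e \<le> \<bar>X n \<omega> - Y \<omega>\<bar>}) \<longlonglongrightarrow> 0"
  proof (intro allI impI)
    fix e :: real assume e: "e > 0"
    show "(\<lambda>n. prob {\<omega>\<in>space M. e \<le> \<bar>X n \<omega> - Y \<omega>\<bar>}) \<longlonglongrightarrow> 0"
    \<comment> \<open>Deviations larger than 1 are invisible after truncation, so Markov's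
      inequality is applied at the level \<open>min 1 e\<close>.\<close>
    proof (rule tendsto_sandwich[where f="\<lambda>_. 0" and h="\<lambda>n. (\<integral>\<omega>. min 1 \<bar>X n \<omega> - Y \<omega>\<bar> \<partial>M) / min 1 e"])
      have "prob {\<omega>\<in>space M. e \<le> \<bar>X n \<omega> - Y \<omega>\<bar>} \<le> prob {\<omega>\<in>space M. min 1 e \<le> \<bar>X n \<omega> - Y \<omega>\<bar>}" for n
        by (rule finite_measure_mono) auto
      also have "\<dots> n \<le> (\<integral>\<omega>. min 1 \<bar>X n \<omega> - Y \<omega>\<bar> \<partial>M) / min 1 e" for n
        using e by (intro prob_le_min_abs) auto
      finally show "\<forall>\<^sub>F n in sequentially. prob {\<omega>\<in>space M. e \<le> \<bar>X n \<omega> - Y \<omega>\<bar>} \<le> (\<integral>\<omega>. min 1 \<bar>X n \<omega> - Y \<omega>\<bar> \<partial>M) / min 1 e"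
        by (intro always_eventually allI)
      show "(\<lambda>n. (\<integral>\<omega>. min 1 \<bar>X n \<omega> - Y \<omega>\<bar> \<partial>M) / min 1 e) \<longlonglongrightarrow> 0"
        using tendsto_divide[OF _ tendsto_const, of _ 0 sequentially "min 1 e"] c e by (auto simp: conv_prob_def)
    qed auto
  qed
next
  assume a: "(\<forall>n. X n \<in> borel_measurable M) \<and> Y \<in> borel_measurable M \<and>
     (\<forall>e>0. (\<lambda>n. prob {\<omega>\<in>space M. e \<le> \<bar>X n \<omega> - Y \<omega>\<bar>}) \<longlonglongrightarrow> 0)"
  then have [measurable]: "\<And>n. X n \<in> borel_measurable M" "Y \<in> borel_measurable M" by auto
  have "(\<lambda>n. \<integral>\<omega>. min 1 \<bar>X n \<omega> - Y \<omega>\<bar> \<partial>M) \<longlonglongrightarrow> 0"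
  proof (rule LIMSEQ_I)
    fix r :: real assume r: "r > 0"
    have "(\<lambda>n. prob {\<omega>\<in>space M. r/2 \<le> \<bar>X n \<omega> - Y \<omega>\<bar>}) \<longlonglongrightarrow> 0"
      using a half_gt_zero[OF r] by blast
    then have "eventually (\<lambda>n. prob {\<omega>\<in>space M. r/2 \<le> \<bar>X n \<omega> - Y \<omega>\<bar>} < r/2) sequentially"
      using order_tendstoD(2) half_gt_zero[OF r] by blast
    then have "eventually (\<lambda>n. norm ((\<integral>\<omega>. min 1 \<bar>X n \<omega> - Y \<omega>\<bar> \<partial>M) - 0) < r) sequentially"
    proof eventually_elim
      case (elim n)
      \<comment> \<open>The truncated distance is at most \<open>r/2\<close> off the set of large
        deviations and at most 1 on it.\<close>
      have "(\<integral>\<omega>. min 1 \<bar>X n \<omega> - Y \<omega>\<bar> \<partial>M) \<le> (\<integral>\<omega>. r/2 + indicator {\<omega>\<in>space M. r/2 \<le> \<bar>X n \<omega> - Y \<omega>\<bar>} \<omega> \<partial>M)"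
        using r by (intro integral_mono integrable_min_abs Bochner_Integration.integrable_add integrable_real_indicator)
          (auto simp: indicator_def emeasure_eq_measure min_def)
      also have "\<dots> = r/2 + prob {\<omega>\<in>space M. r/2 \<le> \<bar>X n \<omega> - Y \<omega>\<bar>}"
        by (subst Bochner_Integration.integral_add)
           (auto simp: prob_space emeasure_eq_measure intro!: integrable_real_indicator)
      finally have "(\<integral>\<omega>. min 1 \<bar>X n \<omega> - Y \<omega>\<bar> \<partial>M) < r" using elim by simp
      moreover have "(\<integral>\<omega>. min 1 \<bar>X n \<omega> - Y \<omega>\<bar> \<partial>M) \<ge> 0" by (intro integral_nonneg_AE) auto
      ultimately show ?case by simp
    qed
    then show "\<exists>no. \<forall>n\<ge>no. norm ((\<integral>\<omega>. min 1 \<bar>X n \<omega> - Y \<omega>\<bar> \<partial>M) - 0) < r" by (simp add: eventually_sequentially)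
  qed
  with a show "conv_prob X Y" by (simp add: conv_prob_def)
qed

lemma conv_prob_L2:
  assumes [measurable]: "\<And>n. X n \<in> borel_measurable M" "Y \<in> borel_measurable M"
    and int: "\<And>n. integrable M (\<lambda>\<omega>. (X n \<omega> - Y \<omega>)\<^sup>2)"
    and lim: "(\<lambda>n. \<integral>\<omega>. (X n \<omega> - Y \<omega>)\<^sup>2 \<partial>M) \<longlonglongrightarrow> 0"
  shows "conv_prob X Y"
  unfolding conv_prob_iff
proof (intro conjI allI impI)
  fix e :: real assume e: "e > 0"
  show "(\<lambda>n. prob {\<omega>\<in>space M. e \<le> \<bar>X n \<omega> - Y \<omega>\<bar>}) \<longlonglongrightarrow> 0"
  proof (rule tendsto_sandwich[where f="\<lambda>_. 0" and h="\<lambda>n. (\<integral>\<omega>. (X n \<omega> - Y \<omega>)\<^sup>2 \<partial>M) / e\<^sup>2"])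
    have "{\<omega>\<in>space M. e \<le> \<bar>X n \<omega> - Y \<omega>\<bar>} = {\<omega>\<in>space M. e\<^sup>2 \<le> (X n \<omega> - Y \<omega>)\<^sup>2}" for n
      using e by (auto simp: abs_le_square_iff[symmetric])
    then have "prob {\<omega>\<in>space M. e \<le> \<bar>X n \<omega> - Y \<omega>\<bar>} \<le> (\<integral>\<omega>. (X n \<omega> - Y \<omega>)\<^sup>2 \<partial>M) / e\<^sup>2" for n
      using integral_Markov_inequality_measure[where u="\<lambda>\<omega>. (X n \<omega> - Y \<omega>)\<^sup>2" and c="e\<^sup>2" and A="{}"] e int[of n]
      by simp
    then show "\<forall>\<^sub>F n in sequentially. prob {\<omega>\<in>space M. e \<le> \<bar>X n \<omega> - Y \<omega>\<bar>} \<le> (\<integral>\<omega>. (X n \<omega> - Y \<omega>)\<^sup>2 \<partial>M) / e\<^sup>2"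
      by (intro always_eventually allI)
    show "(\<lambda>n. (\<integral>\<omega>. (X n \<omega> - Y \<omega>)\<^sup>2 \<partial>M) / e\<^sup>2) \<longlonglongrightarrow> 0"
      using tendsto_divide[OF lim tendsto_const, of "e\<^sup>2"] e by simp
  qed auto
qed auto

end

section \<open>Brownian increments and left-point sums\<close>

text \<open>At \<open>n = 0\<close> division by zero makes the step 0 and every sum over the grid is
  empty. Facts about single cells therefore assume \<open>n > 0\<close>, and several limits are
  taken along \<open>Suc n\<close>.\<close>

abbreviation grid :: "real \<Rightarrow> nat \<Rightarrow> nat \<Rightarrow> real" where
  "grid t n i \<equiv> real i * (t / real n)"

locale brownian = prob_space M for M :: "'a measure" +
  fixes F :: "real \<Rightarrow> 'a measure" and W :: "real \<Rightarrow> 'a \<Rightarrow> real"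
  assumes bm: "standard_brownian_motion M F W"
begin

lemma space_F [simp]: "space (F t) = space M"
  using bm unfolding standard_brownian_motion_def subalgebra_def by blast

lemma sets_F_mono: "s \<le> t \<Longrightarrow> sets (F s) \<subseteq> sets (F t)"
  using bm filtration.sets_F_mono unfolding standard_brownian_motion_def by blast

lemma sets_F_subset: "sets (F t) \<subseteq> sets M"
  using bm unfolding standard_brownian_motion_def subalgebra_def by blast

lemma measurable_F_mono: "X \<in> measurable (F s) N \<Longrightarrow> s \<le> t \<Longrightarrow> X \<in> measurable (F t) N"
  by (rule measurable_mono[THEN subsetD, OF order_refl refl]) (simp_all add: sets_F_mono)

lemma measurable_F_imp_M: "X \<in> measurable (F s) N \<Longrightarrow> X \<in> measurable M N"
  by (rule measurable_mono[THEN subsetD, OF order_refl refl sets_F_subset]) simp_all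

lemma W_measurable_F: "0 \<le> s \<Longrightarrow> s \<le> t \<Longrightarrow> W s \<in> borel_measurable (F t)"
  using bm measurable_F_mono unfolding standard_brownian_motion_def adapted_continuous_def by blast

lemma W_measurable: "0 \<le> s \<Longrightarrow> W s \<in> borel_measurable M"
  using W_measurable_F measurable_F_imp_M by blast

lemma W_continuous: "\<omega> \<in> space M \<Longrightarrow> continuous_on {0..} (\<lambda>t. W t \<omega>)"
  using bm unfolding standard_brownian_motion_def adapted_continuous_def by blast

lemma W_0: "\<omega> \<in> space M \<Longrightarrow> W 0 \<omega> = 0"
  using bm unfolding standard_brownian_motion_def by blast

text \<open>Both generated sigma-algebras lie inside the two that are independent by the definition
  of Brownian motion. A general \<open>f\<close> is allowed because Ito's formula below uses a
  nonlinear function of the increment.\<close>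

lemma indep_increment:
  assumes st: "0 \<le> s" "s < t" and U: "U \<in> borel_measurable (F s)" and f: "f \<in> borel_measurable borel"
  shows "indep_var borel (U :: 'a \<Rightarrow> real) borel (\<lambda>\<omega>. f (W t \<omega> - W s \<omega>) :: real)"
proof -
  let ?D = "\<lambda>\<omega>. W t \<omega> - W s \<omega>"
  have ind: "indep_set (sets (F s)) (sets (vimage_algebra (space M) ?D borel))"
    using bm st unfolding standard_brownian_motion_def by blast
  have [measurable]: "W t \<in> borel_measurable M" "W s \<in> borel_measurable M" using st W_measurable by auto
  have fD: "(\<lambda>\<omega>. f (?D \<omega>)) \<in> borel_measurable (vimage_algebra (space M) ?D borel)"
    by (rule measurable_compose[OF measurable_vimage_algebra1 f]) auto
  have 1: "sigma_sets (space M) {U -` A \<inter> space M |A. A \<in> sets borel} \<subseteq> sets (F s)"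
    using sets.sigma_sets_subset[of "{U -` A \<inter> space M |A. A \<in> sets borel}" "F s"] measurable_sets[OF U] by auto
  have 2: "sigma_sets (space M) {(\<lambda>\<omega>. f (?D \<omega>)) -` A \<inter> space M |A. A \<in> sets borel}
      \<subseteq> sets (vimage_algebra (space M) ?D borel)"
    using sets.sigma_sets_subset[of "{(\<lambda>\<omega>. f (?D \<omega>)) -` A \<inter> space M |A. A \<in> sets borel}"
        "vimage_algebra (space M) ?D borel"] measurable_sets[OF fD] by auto
  have U': "U \<in> borel_measurable M" using U by (rule measurable_F_imp_M)
  have f': "(\<lambda>\<omega>. f (?D \<omega>)) \<in> borel_measurable M" using f by measurable
  show ?thesis
    unfolding indep_var_eq using ind 1 2 U' f' unfolding indep_sets2_eq by blast
qed

section \<open>Gaussian moments of the increments\<close>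

lemma normal_density_times_exp:
  assumes "0 < s"
  shows "normal_density 0 s x * exp (u * x) = exp (u\<^sup>2 * s\<^sup>2 / 2) * normal_density (u * s\<^sup>2) s x"
proof -
  \<comment> \<open>Completing the square, that is, exponential tilting: the weight
    \<open>exp (u * x)\<close> moves the mean from 0 to \<open>u * s^2\<close>, so exponentially
    weighted moments become plain moments of a shifted normal law.\<close>
  have "-(x - 0)\<^sup>2 / (2 * s\<^sup>2) + u * x = u\<^sup>2 * s\<^sup>2 / 2 + - (x - u * s\<^sup>2)\<^sup>2 / (2 * s\<^sup>2)"
    using assms by (simp add: field_simps power2_eq_square)
  then show ?thesis unfolding normal_density_def
    by (metis (no_types, lifting) exp_add mult.assoc mult.left_commute)
qed

lemma increment_expectation:
  assumes st: "0 \<le> s" "s < t" and g: "g \<in> borel_measurable borel"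
    and i: "has_bochner_integral lborel (\<lambda>x. normal_density 0 (sqrt (t - s)) x * g x) (r :: real)"
  shows "has_bochner_integral M (\<lambda>\<omega>. g (W t \<omega> - W s \<omega>)) r"
proof -
  have d: "distributed M lborel (\<lambda>\<omega>. W t \<omega> - W s \<omega>) (normal_density 0 (sqrt (t - s)))"
    using bm st unfolding standard_brownian_motion_def by blast
  show ?thesis
    using distributed_integrable[OF d, of g] distributed_integral[OF d, of g] g i
    by (simp add: has_bochner_integral_iff normal_density_nonneg)
qed

lemma increment_exp:
  assumes st: "0 \<le> s" "s < t"
  shows "has_bochner_integral M (\<lambda>\<omega>. exp (u * (W t \<omega> - W s \<omega>))) (exp (u\<^sup>2 * (t - s) / 2))"
proof (rule increment_expectation[OF st])
  have s: "0 < sqrt (t - s)" using st by simp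
  show "has_bochner_integral lborel (\<lambda>x. normal_density 0 (sqrt (t - s)) x * exp (u * x)) (exp (u\<^sup>2 * (t - s) / 2))"
    unfolding normal_density_times_exp[OF s]
    using st s by (auto simp: has_bochner_integral_iff)
qed simp

lemma increment_times_exp:
  assumes st: "0 \<le> s" "s < t"
  shows "has_bochner_integral M (\<lambda>\<omega>. (W t \<omega> - W s \<omega>) * exp (u * (W t \<omega> - W s \<omega>))) (u * (t - s) * exp (u\<^sup>2 * (t - s) / 2))"
proof (rule increment_expectation[OF st])
  have s: "0 < sqrt (t - s)" using st by simp
  have eq: "normal_density 0 (sqrt (t - s)) x * (x * exp (u * x)) =
      exp (u\<^sup>2 * (t - s) / 2) * (normal_density (u * (t - s)) (sqrt (t - s)) x * x)" for x
    using normal_density_times_exp[OF s, of x u] st by (simp add: mult.assoc mult.left_commute)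
  show "has_bochner_integral lborel (\<lambda>x. normal_density 0 (sqrt (t - s)) x * (x * exp (u * x))) (u * (t - s) * exp (u\<^sup>2 * (t - s) / 2))"
    unfolding eq
    using has_bochner_integral_mult_right[OF normal_moment_nz_1[OF s, of "u * (t - s)"], of "exp (u\<^sup>2 * (t - s) / 2)"]
    by (simp add: mult_ac)
qed simp

lemma increment_mean:
  assumes st: "0 \<le> s" "s < t"
  shows "has_bochner_integral M (\<lambda>\<omega>. W t \<omega> - W s \<omega>) 0"
  using increment_times_exp[OF st, of 0] by simp

lemma increment_square:
  assumes st: "0 \<le> s" "s < t"
  shows "has_bochner_integral M (\<lambda>\<omega>. (W t \<omega> - W s \<omega>)\<^sup>2) (t - s)"
proof (rule increment_expectation[OF st])
  have s: "0 < sqrt (t - s)" using st by simp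
  show "has_bochner_integral lborel (\<lambda>x. normal_density 0 (sqrt (t - s)) x * x\<^sup>2) (t - s)"
    using normal_moment_even[OF s, of 0 1] st by (simp add: diff_divide_distrib)
qed simp

section \<open>Orthogonal sums and the isometry for left-point sums\<close>

lemma integrable_mult_of_squares:
  fixes X Y :: "'a \<Rightarrow> real"
  assumes [measurable]: "X \<in> borel_measurable M" "Y \<in> borel_measurable M"
    and "integrable M (\<lambda>\<omega>. (X \<omega>)\<^sup>2)" "integrable M (\<lambda>\<omega>. (Y \<omega>)\<^sup>2)"
  shows "integrable M (\<lambda>\<omega>. X \<omega> * Y \<omega>)"
proof (rule Bochner_Integration.integrable_bound[OF Bochner_Integration.integrable_add[OF assms(3,4)]])
  have "\<bar>x * y\<bar> \<le> x\<^sup>2 + y\<^sup>2" for x y :: real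
    using sum_squares_bound[of "\<bar>x\<bar>" "\<bar>y\<bar>"] by (simp add: abs_mult) (use abs_ge_zero[of "x*y"] abs_mult[of x y] in linarith)
  then show "AE \<omega> in M. norm (X \<omega> * Y \<omega>) \<le> norm ((X \<omega>)\<^sup>2 + (Y \<omega>)\<^sup>2)" by simp
qed measurable

lemma has_bochner_integral_indep_times:
  fixes X Y :: "'a \<Rightarrow> real"
  assumes "indep_var borel X borel Y" "integrable M X" "integrable M Y"
  shows "has_bochner_integral M (\<lambda>\<omega>. X \<omega> * Y \<omega>) ((\<integral>\<omega>. X \<omega> \<partial>M) * (\<integral>\<omega>. Y \<omega> \<partial>M))"
  using indep_var_integrable[OF assms] indep_var_lebesgue_integral[OF assms]
  by (simp add: has_bochner_integral_iff)

text \<open>The isometry in discrete time. The partial sum times \<open>\<xi> n\<close> is known at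
  time \<open>t n\<close>, hence independent of the centred \<open>Z n\<close>, and the cross term
  has mean 0; the squares factor by the same independence. Measurability of the sum is carried along
  because the induction needs it. The \<open>Z i\<close> are not just increments: the residuals in
  Ito's formula are inserted later.\<close>

lemma orthogonal_sum:
  fixes \<xi> Z :: "nat \<Rightarrow> 'a \<Rightarrow> real" and t :: "nat \<Rightarrow> real"
  assumes mono: "\<And>i. i < n \<Longrightarrow> t i \<le> t (Suc i)"
    and \<xi>: "\<And>i. i < n \<Longrightarrow> \<xi> i \<in> borel_measurable (F (t i))"
    and Z: "\<And>i. i < n \<Longrightarrow> Z i \<in> borel_measurable (F (t (Suc i)))"
    and ind: "\<And>i U. i < n \<Longrightarrow> U \<in> borel_measurable (F (t i)) \<Longrightarrow> indep_var borel U borel (Z i)"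
    and \<xi>2: "\<And>i. i < n \<Longrightarrow> integrable M (\<lambda>\<omega>. (\<xi> i \<omega>)\<^sup>2)"
    and Z2: "\<And>i. i < n \<Longrightarrow> integrable M (\<lambda>\<omega>. (Z i \<omega>)\<^sup>2)"
    and Z0: "\<And>i. i < n \<Longrightarrow> (\<integral>\<omega>. Z i \<omega> \<partial>M) = 0"
  shows "(\<lambda>\<omega>. \<Sum>i<n. \<xi> i \<omega> * Z i \<omega>) \<in> borel_measurable (F (t n)) \<and>
    has_bochner_integral M (\<lambda>\<omega>. (\<Sum>i<n. \<xi> i \<omega> * Z i \<omega>)\<^sup>2) (\<Sum>i<n. (\<integral>\<omega>. (\<xi> i \<omega>)\<^sup>2 \<partial>M) * (\<integral>\<omega>. (Z i \<omega>)\<^sup>2 \<partial>M))"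
  using assms
proof (induction n)
  case (Suc n)
  let ?S = "\<lambda>\<omega>. \<Sum>i<n. \<xi> i \<omega> * Z i \<omega>"
  have IH: "?S \<in> borel_measurable (F (t n))"
    "has_bochner_integral M (\<lambda>\<omega>. (?S \<omega>)\<^sup>2) (\<Sum>i<n. (\<integral>\<omega>. (\<xi> i \<omega>)\<^sup>2 \<partial>M) * (\<integral>\<omega>. (Z i \<omega>)\<^sup>2 \<partial>M))"
  proof -
    have "?S \<in> borel_measurable (F (t n)) \<and>
      has_bochner_integral M (\<lambda>\<omega>. (?S \<omega>)\<^sup>2) (\<Sum>i<n. (\<integral>\<omega>. (\<xi> i \<omega>)\<^sup>2 \<partial>M) * (\<integral>\<omega>. (Z i \<omega>)\<^sup>2 \<partial>M))"
      by (rule Suc.IH) (use Suc.prems in \<open>blast intro: less_SucI\<close>)+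
    then show "?S \<in> borel_measurable (F (t n))"
      "has_bochner_integral M (\<lambda>\<omega>. (?S \<omega>)\<^sup>2) (\<Sum>i<n. (\<integral>\<omega>. (\<xi> i \<omega>)\<^sup>2 \<partial>M) * (\<integral>\<omega>. (Z i \<omega>)\<^sup>2 \<partial>M))"
      by simp_all
  qed
  have [measurable]: "\<xi> n \<in> borel_measurable (F (t n))" using Suc.prems by simp
  note [measurable] = IH(1)
  have m1: "(\<lambda>\<omega>. \<Sum>i<Suc n. \<xi> i \<omega> * Z i \<omega>) \<in> borel_measurable (F (t (Suc n)))"
    using measurable_F_mono[OF IH(1), of "t (Suc n)"] measurable_F_mono[of "\<xi> n" "t n" borel "t (Suc n)"] Suc.prems
    by auto
  have M: "?S \<in> borel_measurable M" "\<xi> n \<in> borel_measurable M" "Z n \<in> borel_measurable M"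
    using measurable_F_imp_M[OF IH(1)] measurable_F_imp_M[OF Suc.prems(2)[of n]]
      measurable_F_imp_M[OF Suc.prems(3)[of n]] by simp_all
  have "integrable M (\<lambda>\<omega>. ?S \<omega> * \<xi> n \<omega>)"
    by (rule integrable_mult_of_squares) (use M IH Suc.prems in \<open>auto simp: has_bochner_integral_iff\<close>)
  moreover have "integrable M (Z n)"
    by (rule square_integrable_imp_integrable) (use M Suc.prems in auto)
  moreover have "indep_var borel (\<lambda>\<omega>. ?S \<omega> * \<xi> n \<omega>) borel (Z n)"
    by (rule Suc.prems(4)) auto
  ultimately have cross: "has_bochner_integral M (\<lambda>\<omega>. (?S \<omega> * \<xi> n \<omega>) * Z n \<omega>) 0"
    using has_bochner_integral_indep_times[of "\<lambda>\<omega>. ?S \<omega> * \<xi> n \<omega>" "Z n"] Suc.prems(7)[of n] by simp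
  have "indep_var borel (\<lambda>\<omega>. (\<xi> n \<omega>)\<^sup>2) borel (\<lambda>\<omega>. (Z n \<omega>)\<^sup>2)"
    using indep_var_compose[OF Suc.prems(4)[of n "\<xi> n"], of "\<lambda>x. x\<^sup>2" borel "\<lambda>x. x\<^sup>2" borel] by (simp add: comp_def)
  then have sq: "has_bochner_integral M (\<lambda>\<omega>. (\<xi> n \<omega>)\<^sup>2 * (Z n \<omega>)\<^sup>2) ((\<integral>\<omega>. (\<xi> n \<omega>)\<^sup>2 \<partial>M) * (\<integral>\<omega>. (Z n \<omega>)\<^sup>2 \<partial>M))"
    using has_bochner_integral_indep_times[of "\<lambda>\<omega>. (\<xi> n \<omega>)\<^sup>2" "\<lambda>\<omega>. (Z n \<omega>)\<^sup>2"] Suc.prems(5)[of n]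
      Suc.prems(6)[of n] by simp
  have "(\<Sum>i<Suc n. \<xi> i \<omega> * Z i \<omega>)\<^sup>2 = ((?S \<omega>)\<^sup>2 + 2 * ((?S \<omega> * \<xi> n \<omega>) * Z n \<omega>)) + (\<xi> n \<omega>)\<^sup>2 * (Z n \<omega>)\<^sup>2" for \<omega>
    by (simp add: power2_eq_square algebra_simps)
  then have "has_bochner_integral M (\<lambda>\<omega>. (\<Sum>i<Suc n. \<xi> i \<omega> * Z i \<omega>)\<^sup>2)
     (((\<Sum>i<n. (\<integral>\<omega>. (\<xi> i \<omega>)\<^sup>2 \<partial>M) * (\<integral>\<omega>. (Z i \<omega>)\<^sup>2 \<partial>M)) + 2 * 0) + (\<integral>\<omega>. (\<xi> n \<omega>)\<^sup>2 \<partial>M) * (\<integral>\<omega>. (Z n \<omega>)\<^sup>2 \<partial>M))"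
    using has_bochner_integral_add[OF has_bochner_integral_add[OF IH(2) has_bochner_integral_mult_right[OF cross, of 2]] sq]
    by simp
  with m1 show ?case by simp
qed (simp add: has_bochner_integral_iff)

definition grid_sum :: "(real \<Rightarrow> 'a \<Rightarrow> real) \<Rightarrow> real \<Rightarrow> nat \<Rightarrow> 'a \<Rightarrow> real" where
  "grid_sum H t n \<omega> = (\<Sum>i<n. H (grid t n i) \<omega> *
     (W (grid t n (Suc i)) \<omega> - W (grid t n i) \<omega>))"

lemma grid_sum_square:
  assumes t: "0 < t"
    and H: "\<And>s. 0 \<le> s \<Longrightarrow> s \<le> t \<Longrightarrow> H s \<in> borel_measurable (F s)"
    and H2: "\<And>s. 0 \<le> s \<Longrightarrow> s \<le> t \<Longrightarrow> integrable M (\<lambda>\<omega>. (H s \<omega>)\<^sup>2)"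
  shows "has_bochner_integral M (\<lambda>\<omega>. (grid_sum H t n \<omega>)\<^sup>2) (\<Sum>i<n. (\<integral>\<omega>. (H (grid t n i) \<omega>)\<^sup>2 \<partial>M) * (t / real n))"
proof -
  let ?h = "t / real n"
  have sum: "(\<Sum>i<n. (\<integral>\<omega>. (H (real i * ?h) \<omega>)\<^sup>2 \<partial>M) * (\<integral>\<omega>. (W (real (Suc i) * ?h) \<omega> - W (real i * ?h) \<omega>)\<^sup>2 \<partial>M)) =
     (\<Sum>i<n. (\<integral>\<omega>. (H (real i * ?h) \<omega>)\<^sup>2 \<partial>M) * ?h)"
  proof (rule sum.cong)
    fix i assume "i \<in> {..<n}"
    then have "0 < ?h" using t by auto
    then have "(\<integral>\<omega>. (W (real (Suc i) * ?h) \<omega> - W (real i * ?h) \<omega>)\<^sup>2 \<partial>M) = real (Suc i) * ?h - real i * ?h"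
      by (intro has_bochner_integral_integral_eq increment_square mult_strict_right_mono mult_nonneg_nonneg) auto
    then show "(\<integral>\<omega>. (H (real i * ?h) \<omega>)\<^sup>2 \<partial>M) * (\<integral>\<omega>. (W (real (Suc i) * ?h) \<omega> - W (real i * ?h) \<omega>)\<^sup>2 \<partial>M) =
      (\<integral>\<omega>. (H (real i * ?h) \<omega>)\<^sup>2 \<partial>M) * ?h" by (simp add: algebra_simps add_divide_distrib)
  qed simp
  have in_range: "0 \<le> real i * ?h" "real i * ?h \<le> t" "0 < ?h" "real i * ?h < real (Suc i) * ?h" if "i < n" for i
    using that t by (auto simp: field_simps)
  show ?thesis
    unfolding grid_sum_def sum[symmetric]
  proof (intro orthogonal_sum[where t="\<lambda>i. real i * ?h", THEN conjunct2] H H2)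
    fix i assume i: "i < n"
    note r = in_range[OF i]
    have r': "0 \<le> real (Suc i) * ?h" using r by linarith
    show "real i * ?h \<le> real (Suc i) * ?h" using r by simp
    show "(\<lambda>\<omega>. W (real (Suc i) * ?h) \<omega> - W (real i * ?h) \<omega>) \<in> borel_measurable (F (real (Suc i) * ?h))"
      by (intro borel_measurable_diff W_measurable_F order_refl r' less_imp_le[OF r(4)] r(1))
    show "indep_var borel U borel (\<lambda>\<omega>. W (real (Suc i) * ?h) \<omega> - W (real i * ?h) \<omega>)"
      if "U \<in> borel_measurable (F (real i * ?h))" for U
      by (rule indep_increment[OF r(1) r(4) that, of "\<lambda>x. x"]) simp
    show "integrable M (\<lambda>\<omega>. (W (real (Suc i) * ?h) \<omega> - W (real i * ?h) \<omega>)\<^sup>2)"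
      "(\<integral>\<omega>. W (real (Suc i) * ?h) \<omega> - W (real i * ?h) \<omega> \<partial>M) = 0"
      using increment_square[OF r(1) r(4)] increment_mean[OF r(1) r(4)]
      by (simp_all add: has_bochner_integral_iff)
  qed (use in_range in auto)
qed

text \<open>Lenglart's inequality: truncate the integrand once its accumulated square exceeds \<open>\<delta>\<close>.\<close>

lemma grid_sum_prob_le:
  assumes t: "0 < t" and e: "0 < e" and d: "0 \<le> d"
    and H: "\<And>s. 0 \<le> s \<Longrightarrow> s \<le> t \<Longrightarrow> H s \<in> borel_measurable (F s)"
  shows "prob {\<omega>\<in>space M. e \<le> \<bar>grid_sum H t n \<omega>\<bar>} \<le> d / e\<^sup>2 +
    prob {\<omega>\<in>space M. d \<le> (\<Sum>i<n. (H (grid t n i) \<omega>)\<^sup>2 * (t / real n))}"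
proof (cases "n = 0")
  case True then show ?thesis using e d by (simp add: grid_sum_def)
next
  case False
  define h where "h = t / real n"
  have h: "0 < h" using t False by (simp add: h_def)
  \<comment> \<open>\<open>grid_sum\<close> expects a process indexed by real time, so the index of
    the last grid point up to \<open>s\<close> is recovered from \<open>s\<close>.\<close>
  define k where "k s = nat \<lfloor>s / h\<rfloor>" for s
  have k: "k (real i * h) = i" for i using h by (simp add: k_def)
  \<comment> \<open>The test includes the current square, which is already known at the left
    endpoint. So \<open>H'\<close> stays adapted, its accumulated square never overshoots
    \<open>d\<close>, and it is bounded, although \<open>H\<close> need not be square
    integrable.\<close>
  define H' where "H' s \<omega> = (if (\<Sum>j\<le>k s. (H (real j * h) \<omega>)\<^sup>2 * h) \<le> d then H (real (k s) * h) \<omega> else 0)" for s \<omega>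
  have k_le: "real (k s) * h \<le> s" if "0 \<le> s" for s
  proof -
    have "real (k s) \<le> s / h" using that h unfolding k_def by simp
    then show ?thesis using h by (simp add: field_simps)
  qed
  have Hm: "H (real j * h) \<in> borel_measurable (F s)" if "0 \<le> s" "s \<le> t" "j \<le> k s" for s j
  proof -
    have "real j * h \<le> real (k s) * h" using that(3) h by simp
    then have "real j * h \<le> s" using k_le[OF that(1)] by linarith
    then show ?thesis using measurable_F_mono[OF H] that h by (smt (verit) mult_nonneg_nonneg of_nat_0_le_iff)
  qed
  have H'm: "H' s \<in> borel_measurable (F s)" if "0 \<le> s" "s \<le> t" for s
  proof -
    have [measurable]: "\<And>j. j \<in> {..k s} \<Longrightarrow> H (real j * h) \<in> borel_measurable (F s)" "H (real (k s) * h) \<in> borel_measurable (F s)"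
      using Hm[OF that] by auto
    show ?thesis unfolding H'_def by measurable
  qed
  have H'_bound: "(H' s \<omega>)\<^sup>2 \<le> d / h" for s \<omega>
  proof -
    have "(H (real (k s) * h) \<omega>)\<^sup>2 * h \<le> (\<Sum>j\<le>k s. (H (real j * h) \<omega>)\<^sup>2 * h)"
      using h by (intro member_le_sum) auto
    then show ?thesis using h d by (auto simp: H'_def field_simps)
  qed
  have H'2: "integrable M (\<lambda>\<omega>. (H' s \<omega>)\<^sup>2)" if "0 \<le> s" "s \<le> t" for s
    by (rule integrable_const_bound[where B="d / h"])
       (use H'_bound measurable_F_imp_M[OF H'm[OF that]] in auto)
  \<comment> \<open>If the last term survives, the whole sum of squares of \<open>H\<close> up to it
    is at most \<open>d\<close>; if it is cut, it adds nothing to the previous bound.\<close>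
  have sum_le: "(\<Sum>i<m. (H' (real i * h) \<omega>)\<^sup>2 * h) \<le> d" for m \<omega>
  proof (induction m)
    case (Suc m)
    show ?case
    proof (cases "(\<Sum>j\<le>m. (H (real j * h) \<omega>)\<^sup>2 * h) \<le> d")
      case True
      have "(\<Sum>i<Suc m. (H' (real i * h) \<omega>)\<^sup>2 * h) \<le> (\<Sum>j<Suc m. (H (real j * h) \<omega>)\<^sup>2 * h)"
        using h by (intro sum_mono) (auto simp: H'_def k)
      then show ?thesis using True by (simp add: lessThan_Suc_atMost)
    qed (use Suc in \<open>simp add: H'_def k\<close>)
  qed (use d in simp)
  note I = grid_sum_square[OF t H'm H'2, of n, folded h_def]
  have "(\<Sum>i<n. (\<integral>\<omega>. (H' (real i * h) \<omega>)\<^sup>2 \<partial>M) * h) = (\<integral>\<omega>. (\<Sum>i<n. (H' (real i * h) \<omega>)\<^sup>2 * h) \<partial>M)"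
  proof (subst Bochner_Integration.integral_sum)
    fix i assume "i \<in> {..<n}"
    then have "0 \<le> real i * h" "real i * h \<le> t" using h t by (auto simp: h_def field_simps)
    from H'2[OF this] show "integrable M (\<lambda>\<omega>. (H' (real i * h) \<omega>)\<^sup>2 * h)" by simp
  qed simp
  also have "\<dots> \<le> (\<integral>\<omega>. d \<partial>M)"
  proof (rule integral_mono_AE')
    show "AE \<omega> in M. 0 \<le> d" using d by simp
  qed (use sum_le in auto)
  finally have E2: "(\<integral>\<omega>. (grid_sum H' t n \<omega>)\<^sup>2 \<partial>M) \<le> d"
    using I by (simp add: has_bochner_integral_iff prob_space)
  have mG: "grid_sum G t n \<in> borel_measurable M" if "\<And>s. 0 \<le> s \<Longrightarrow> s \<le> t \<Longrightarrow> G s \<in> borel_measurable (F s)" for G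
    unfolding grid_sum_def h_def[symmetric]
  proof (intro borel_measurable_sum borel_measurable_times borel_measurable_diff W_measurable)
    fix i assume "i \<in> {..<n}"
    then have "0 \<le> real i * h" "real i * h \<le> t" using h t by (auto simp: h_def field_simps)
    then show "G (real i * h) \<in> borel_measurable M" using that measurable_F_imp_M by blast
  qed (use h in auto)
  have [measurable]: "grid_sum H t n \<in> borel_measurable M" "grid_sum H' t n \<in> borel_measurable M"
    using mG H H'm by auto
  have [measurable]: "i < n \<Longrightarrow> H (real i * h) \<in> borel_measurable M" for i
    using measurable_F_imp_M[OF H[of "real i * h"]] h t by (auto simp: h_def field_simps)
  have "prob {\<omega>\<in>space M. e \<le> \<bar>grid_sum H t n \<omega>\<bar>} \<le>
    prob ({\<omega>\<in>space M. e\<^sup>2 \<le> (grid_sum H' t n \<omega>)\<^sup>2} \<union> {\<omega>\<in>space M. d \<le> (\<Sum>i<n. (H (real i * h) \<omega>)\<^sup>2 * h)})"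
  proof (rule finite_measure_mono)
    show "{\<omega>\<in>space M. e \<le> \<bar>grid_sum H t n \<omega>\<bar>} \<subseteq>
      {\<omega>\<in>space M. e\<^sup>2 \<le> (grid_sum H' t n \<omega>)\<^sup>2} \<union> {\<omega>\<in>space M. d \<le> (\<Sum>i<n. (H (real i * h) \<omega>)\<^sup>2 * h)}"
    proof safe
      fix \<omega> assume w: "\<omega> \<in> space M" "e \<le> \<bar>grid_sum H t n \<omega>\<bar>" "\<not> d \<le> (\<Sum>i<n. (H (real i * h) \<omega>)\<^sup>2 * h)"
      \<comment> \<open>Partial sums of squares increase, so a total below \<open>d\<close> means
        that no term was cut and the two left-point sums coincide on this path.\<close>
      have "H' (real i * h) \<omega> = H (real i * h) \<omega>" if "i < n" for i
      proof -
        have "(\<Sum>j\<le>i. (H (real j * h) \<omega>)\<^sup>2 * h) \<le> (\<Sum>j<n. (H (real j * h) \<omega>)\<^sup>2 * h)"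
          using that h by (intro sum_mono2) auto
        then show ?thesis using w(3) by (simp add: H'_def k)
      qed
      then have "grid_sum H' t n \<omega> = grid_sum H t n \<omega>"
        unfolding grid_sum_def h_def[symmetric] by (intro sum.cong) auto
      then show "e\<^sup>2 \<le> (grid_sum H' t n \<omega>)\<^sup>2" using w(2) e abs_le_square_iff[of e "grid_sum H t n \<omega>"] by simp
    qed
  qed measurable
  also have "\<dots> \<le> prob {\<omega>\<in>space M. e\<^sup>2 \<le> (grid_sum H' t n \<omega>)\<^sup>2} + prob {\<omega>\<in>space M. d \<le> (\<Sum>i<n. (H (real i * h) \<omega>)\<^sup>2 * h)}"
    by (rule measure_Un_le) measurable
  also have "prob {\<omega>\<in>space M. e\<^sup>2 \<le> (grid_sum H' t n \<omega>)\<^sup>2} \<le> (\<integral>\<omega>. (grid_sum H' t n \<omega>)\<^sup>2 \<partial>M) / e\<^sup>2"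
    using integral_Markov_inequality_measure[where u="\<lambda>\<omega>. (grid_sum H' t n \<omega>)\<^sup>2" and c="e\<^sup>2" and A="{}" and M=M] e
      integrable.intros[OF I] by simp
  also have "\<dots> \<le> d / e\<^sup>2" using E2 e by (simp add: divide_right_mono)
  finally show ?thesis by (simp add: h_def)
qed

end

section \<open>It\^o integrals of continuous integrands\<close>

lemma grid_floor:
  fixes t s :: real
  assumes t: "0 < t" and s: "0 \<le> s"
  defines "k \<equiv> \<lambda>n. nat \<lfloor>s / (t / real n)\<rfloor>"
  shows "n > 0 \<Longrightarrow> grid t n (k n) \<le> s"
    and "n > 0 \<Longrightarrow> s < grid t n (Suc (k n))"
    and "n > 0 \<Longrightarrow> s < t \<Longrightarrow> k n < n"
    and "(\<lambda>n. grid t n (k n)) \<longlonglongrightarrow> s"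
proof -
  have 1: "grid t n (k n) \<le> s \<and> s < grid t n (Suc (k n))" if "n > 0" for n
  proof -
    have h: "0 < t / real n" using t that by simp
    have "0 \<le> s / (t / real n)" using s h by (intro divide_nonneg_pos)
    then have k: "real (k n) = real_of_int \<lfloor>s / (t / real n)\<rfloor>" by (simp add: k_def)
    then have "real (k n) \<le> s / (t / real n)" "s / (t / real n) < real (Suc (k n))" by simp_all linarith
    then show ?thesis using h pos_le_divide_eq[OF h] pos_divide_less_eq[OF h] by blast
  qed
  then show "n > 0 \<Longrightarrow> grid t n (k n) \<le> s" "n > 0 \<Longrightarrow> s < grid t n (Suc (k n))" by auto
  show "k n < n" if "n > 0" "s < t"
  proof -
    have "grid t n (k n) < grid t n n" using 1[OF that(1)] that by simp
    then have "real (k n) < real n" by (rule mult_right_less_imp_less) (use t in simp)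
    then show ?thesis by simp
  qed
  show "(\<lambda>n. grid t n (k n)) \<longlonglongrightarrow> s"
  proof (rule tendsto_sandwich[where f="\<lambda>n. s - t / real n" and h="\<lambda>_. s"])
    show "\<forall>\<^sub>F n in sequentially. s - t / real n \<le> grid t n (k n)"
      using eventually_gt_at_top[of 0]
    proof eventually_elim
      case (elim n)
      then show ?case using 1[of n] by (simp add: algebra_simps add_divide_distrib)
    qed
    show "\<forall>\<^sub>F n in sequentially. grid t n (k n) \<le> s"
      using eventually_gt_at_top[of 0] by eventually_elim (use 1 in auto)
    have "(\<lambda>n. t / real n) \<longlonglongrightarrow> 0" by (rule lim_const_over_n)
    from tendsto_diff[OF tendsto_const this] show "(\<lambda>n. s - t / real n) \<longlonglongrightarrow> s" by simp
  qed simp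
qed

lemma grid_point:
  assumes "i \<le> n" "0 \<le> t" shows "0 \<le> grid t n i" "grid t n i \<le> t"
proof -
  have "grid t n i \<le> grid t n n" using assms by (intro mult_right_mono) auto
  also have "\<dots> \<le> t" using assms by simp
  finally show "grid t n i \<le> t" .
qed (use assms in simp)

lemma sum_indicator_unique:
  fixes a :: "nat \<Rightarrow> real"
  assumes "k < n" "s \<in> A k" "\<And>i. i < n \<Longrightarrow> s \<in> A i \<Longrightarrow> i = k"
  shows "(\<Sum>i<n. a i * indicator (A i) s) = a k"
proof -
  have "(\<Sum>i<n. a i * indicator (A i) s) = (\<Sum>i<n. if i = k then a k else 0)"
  proof (intro sum.cong refl)
    fix i assume "i \<in> {..<n}"
    then show "a i * indicator (A i) s = (if i = k then a k else 0)"
      using assms(2) assms(3)[of i] by (cases "s \<in> A i") auto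
  qed
  also have "\<dots> = a k" using assms(1) by simp
  finally show ?thesis .
qed

text \<open>Left endpoints approach \<open>s\<close> from below, so continuity from the left
  suffices for the step functions to converge pointwise; the bound \<open>B\<close> allows dominated
  convergence. This generality is wanted because paths of simple integrands jump, but are continuous
  from the left.\<close>

lemma riemann_sum_left_continuous:
  fixes f :: "real \<Rightarrow> real"
  assumes t: "0 < t"
    and cont: "\<And>s. 0 \<le> s \<Longrightarrow> s \<le> t \<Longrightarrow> continuous (at s within {0..s}) f"
    and bound: "\<And>s. 0 \<le> s \<Longrightarrow> s \<le> t \<Longrightarrow> \<bar>f s\<bar> \<le> B"
  shows "integrable lborel (\<lambda>s. indicator {0..t} s * f s)"
    and "(\<lambda>n. \<Sum>i<n. f (grid t n i) * (t / real n)) \<longlonglongrightarrow> (\<integral>s. indicator {0..t} s * f s \<partial>lborel)"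
proof -
  define g where "g n s = (\<Sum>i<n. f (grid t n i) * indicator {grid t n i..<grid t n (Suc i)} s)" for n s
  have B: "0 \<le> B" using bound[of 0] t by linarith
  have g_in: "g n s = f (grid t n (nat \<lfloor>s / (t / real n)\<rfloor>))" if "0 \<le> s" "s < t" "n > 0" for n s
    unfolding g_def
  proof (rule sum_indicator_unique)
    show "nat \<lfloor>s / (t / real n)\<rfloor> < n" using grid_floor(3)[OF t that(1) that(3,2)] .
    show "s \<in> {grid t n (nat \<lfloor>s / (t / real n)\<rfloor>)..<real (Suc (nat \<lfloor>s / (t / real n)\<rfloor>)) * (t / real n)}"
      using grid_floor(1,2)[OF t that(1,3)] by simp
    fix i assume i: "i < n" "s \<in> {grid t n i..<grid t n (Suc i)}"
    have h: "0 < t / real n" using t that by simp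
    have "real i \<le> s / (t / real n)" "s / (t / real n) < real i + 1"
      using i(2) unfolding pos_le_divide_eq[OF h] pos_divide_less_eq[OF h] by (simp_all add: add.commute)
    then have "\<lfloor>s / (t / real n)\<rfloor> = int i" by (simp add: floor_eq_iff)
    then show "i = nat \<lfloor>s / (t / real n)\<rfloor>" by simp
  qed
  have g_out: "g n s = 0" if "s < 0 \<or> t \<le> s" for n s
    unfolding g_def
  proof (intro sum.neutral ballI)
    fix i assume i: "i \<in> {..<n}"
    then have "grid t n (Suc i) \<le> t" "0 \<le> grid t n i"
      using grid_point(2)[of "Suc i" n t] grid_point(1)[of i n t] t by auto
    then have "s \<notin> {grid t n i..<grid t n (Suc i)}" using that by auto
    then show "f (grid t n i) * indicator {grid t n i..<grid t n (Suc i)} s = 0" by simp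
  qed
  have lim: "(\<lambda>n. g n s) \<longlonglongrightarrow> indicator {0..<t} s * f s" for s
  proof (cases "0 \<le> s \<and> s < t")
    case True
    have "(\<lambda>n. f (grid t n (nat \<lfloor>s / (t / real n)\<rfloor>))) \<longlonglongrightarrow> f s"
    proof (rule continuous_within_tendsto_compose[where f=f and S="{0..s}"])
      show "continuous (at s within {0..s}) f" using cont True by simp
      show "\<forall>\<^sub>F n in sequentially. grid t n (nat \<lfloor>s / (t / real n)\<rfloor>) \<in> {0..s}"
        using eventually_gt_at_top[of 0]
        by eventually_elim (use grid_floor(1)[OF t] True t in auto)
      show "(\<lambda>n. grid t n (nat \<lfloor>s / (t / real n)\<rfloor>)) \<longlonglongrightarrow> s"
        using grid_floor(4)[OF t] True by simp
    qed
    moreover have "\<forall>\<^sub>F n in sequentially. f (grid t n (nat \<lfloor>s / (t / real n)\<rfloor>)) = g n s"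
      using eventually_gt_at_top[of 0] by eventually_elim (use g_in True in auto)
    ultimately have "(\<lambda>n. g n s) \<longlonglongrightarrow> f s" by (rule Lim_transform_eventually)
    then show ?thesis using True by simp
  next
    case False
    then have "g n s = 0" for n using g_out by force
    then show ?thesis using False by (auto simp: indicator_def)
  qed
  have gm: "g n \<in> borel_measurable lborel" for n unfolding g_def by measurable
  have m: "(\<lambda>s. indicator {0..<t} s * f s) \<in> borel_measurable lborel"
    by (rule borel_measurable_LIMSEQ_real[OF lim gm])
  have g_bound: "norm (g n s) \<le> B * indicator {0..t} s" for n s
  proof (cases "0 \<le> s \<and> s < t \<and> n > 0")
    case True
    then have "grid t n (nat \<lfloor>s / (t / real n)\<rfloor>) \<le> s" "0 \<le> grid t n (nat \<lfloor>s / (t / real n)\<rfloor>)"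
      using grid_floor(1)[OF t] t by auto
    then show ?thesis using bound True by (simp add: g_in)
  next
    case False
    then consider "n = 0" | "s < 0 \<or> t \<le> s" by linarith
    then have "g n s = 0" by cases (simp add: g_def, rule g_out)
    then show ?thesis using B by simp
  qed
  have w: "integrable lborel (\<lambda>s. B * indicator {0..t} s :: real)"
    using t by (auto intro!: integrable_mult_right integrable_real_indicator)
  \<comment> \<open>The step functions vanish at \<open>t\<close>, so their limit sees
    \<open>[0, t)\<close>; the missing endpoint is a null set.\<close>
  have AEeq: "AE s in lborel. indicator {0..<t} s * f s = indicator {0..t} s * f s"
    using AE_lborel_singleton[of t] by eventually_elim (auto simp: indicator_def)
  have m2: "(\<lambda>s. indicator {0..t} s * f s) \<in> borel_measurable lborel"
  proof -
    have "(\<lambda>s. indicator {0..t} s * f s) = (\<lambda>s. indicator {0..<t} s * f s + f t * indicator {t} s)"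
      using t by (auto simp: indicator_def fun_eq_iff)
    then show ?thesis using m by simp
  qed
  have AEs: "AE s in lborel. (\<lambda>n. g n s) \<longlonglongrightarrow> indicator {0..<t} s * f s"
    "\<And>n. AE s in lborel. norm (g n s) \<le> B * indicator {0..t} s"
    using lim g_bound by auto
  note dc = integrable_dominated_convergence[OF m gm w AEs] integral_dominated_convergence[OF m gm w AEs]
  show "integrable lborel (\<lambda>s. indicator {0..t} s * f s)"
    using integrable_cong_AE_imp[OF dc(1) m2] AEeq by auto
  have "(\<integral>s. g n s \<partial>lborel) = (\<Sum>i<n. f (grid t n i) * (t / real n))" for n
    unfolding g_def
  proof (subst Bochner_Integration.integral_sum)
    show "integrable lborel (\<lambda>s. f (grid t n i) * indicator {grid t n i..<grid t n (Suc i)} s)" for i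
    proof (intro integrable_mult_right integrable_real_indicator)
      have le: "grid t n i \<le> grid t n (Suc i)" using t by (intro mult_right_mono) auto
      show "emeasure lborel {grid t n i..<grid t n (Suc i)} < \<infinity>"
        unfolding emeasure_lborel_Ico[OF le] by simp
    qed simp
    have "measure lborel {grid t n i..<grid t n (Suc i)} = t / real n" for i
      using t by (subst measure_lborel_Ico) (auto simp: algebra_simps add_divide_distrib intro!: mult_right_mono divide_right_mono)
    then show "(\<Sum>i<n. \<integral>s. f (grid t n i) * indicator {grid t n i..<grid t n (Suc i)} s \<partial>lborel)
      = (\<Sum>i<n. f (grid t n i) * (t / real n))" by simp
  qed
  moreover have "(\<integral>s. indicator {0..<t} s * f s \<partial>lborel) = (\<integral>s. indicator {0..t} s * f s \<partial>lborel)"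
    by (rule integral_cong_AE) (use m m2 AEeq in auto)
  ultimately show "(\<lambda>n. \<Sum>i<n. f (grid t n i) * (t / real n)) \<longlonglongrightarrow> (\<integral>s. indicator {0..t} s * f s \<partial>lborel)"
    using dc(2) by simp
qed

text \<open>Cutting the integrand off at \<open>q\<close> makes the sum telescope to the first grid
  point past \<open>q\<close>, capped at \<open>t\<close>. That point is within one step of
  \<open>min t q\<close>, and \<open>w\<close> is continuous.\<close>

lemma grid_cut_sum:
  fixes w :: "real \<Rightarrow> real"
  assumes t: "0 < t" and q: "0 \<le> q" and w: "continuous_on {0..} w"
  shows "(\<lambda>n. \<Sum>i<n. indicator {..q} (grid t n i) * (w (grid t n (Suc i)) - w (grid t n i)))
     \<longlonglongrightarrow> w (min t q) - w 0"
proof -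
  \<comment> \<open>The number of left endpoints in the grid that are at most \<open>q\<close>:
    indices start at 0, hence the \<open>Suc\<close>.\<close>
  define m where "m n = min n (Suc (nat \<lfloor>q / (t / real n)\<rfloor>))" for n
  have sum: "(\<Sum>i<n. indicator {..q} (grid t n i) * (w (grid t n (Suc i)) - w (grid t n i)))
      = w (grid t n (m n)) - w 0" if "n > 0" for n
  proof -
    have h: "0 < t / real n" using t that by simp
    have iff: "grid t n i \<le> q \<longleftrightarrow> i < Suc (nat \<lfloor>q / (t / real n)\<rfloor>)" for i
    proof -
      have "grid t n i \<le> q \<longleftrightarrow> real i \<le> q / (t / real n)" using pos_le_divide_eq[OF h] by blast
      also have "\<dots> \<longleftrightarrow> int i \<le> \<lfloor>q / (t / real n)\<rfloor>" by (simp add: le_floor_iff)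
      also have "\<dots> \<longleftrightarrow> i < Suc (nat \<lfloor>q / (t / real n)\<rfloor>)"
      proof -
        have "0 \<le> q / (t / real n)" using q h by (intro divide_nonneg_pos)
        then have "0 \<le> \<lfloor>q / (t / real n)\<rfloor>" by (simp only: zero_le_floor)
        then show ?thesis by (simp only: less_Suc_eq_le le_nat_iff)
      qed
      finally show ?thesis .
    qed
    have "(\<Sum>i<n. indicator {..q} (grid t n i) * (w (grid t n (Suc i)) - w (grid t n i)))
      = (\<Sum>i<n. if i < m n then w (grid t n (Suc i)) - w (grid t n i) else 0)"
    proof (intro sum.cong refl)
      fix i assume i: "i \<in> {..<n}"
      show "indicator {..q} (grid t n i) * (w (grid t n (Suc i)) - w (grid t n i)) =
        (if i < m n then w (grid t n (Suc i)) - w (grid t n i) else 0)"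
        unfolding indicator_def atMost_iff iff using i by (simp add: m_def)
    qed
    also have "\<dots> = (\<Sum>i\<in>{..<n} \<inter> {i. i < m n}. w (grid t n (Suc i)) - w (grid t n i))"
      by (simp add: sum.If_cases)
    also have "{..<n} \<inter> {i. i < m n} = {..<m n}" by (auto simp: m_def)
    also have "(\<Sum>i<m n. w (grid t n (Suc i)) - w (grid t n i)) = w (grid t n (m n)) - w (grid t n 0)"
      by (rule sum_lessThan_telescope)
    finally show ?thesis by simp
  qed
  have m_ge: "0 \<le> grid t n (m n)" for n using t by simp
  have near: "\<bar>grid t n (m n) - min t q\<bar> \<le> t / real n" if "n > 0" for n
  proof -
    have h: "0 < t / real n" using t that by simp
    have nh: "grid t n n = t" using that by simp
    note fl = grid_floor(1,2)[OF t q that]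
    let ?k = "nat \<lfloor>q / (t / real n)\<rfloor>"
    have Sk: "grid t n (Suc ?k) = real ?k * (t / real n) + t / real n" by (simp add: algebra_simps add_divide_distrib)
    show ?thesis
    proof (cases "n \<le> Suc ?k")
      case True
      then have mn: "grid t n (m n) = t" using nh by (simp add: m_def)
      have "grid t n n \<le> grid t n (Suc ?k)" using True h by (intro mult_right_mono) auto
      then have "t \<le> q + t / real n" using nh Sk fl by linarith
      then show ?thesis using h unfolding mn by linarith
    next
      case False
      then have mn: "grid t n (m n) = grid t n (Suc ?k)" by (simp add: m_def)
      have "grid t n (Suc ?k) \<le> grid t n n" using False h by (intro mult_right_mono) auto
      then show ?thesis using nh Sk fl unfolding mn by linarith
    qed
  qed
  have "(\<lambda>n. grid t n (m n) - min t q) \<longlonglongrightarrow> 0"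
  proof (rule Lim_null_comparison)
    show "\<forall>\<^sub>F n in sequentially. norm (grid t n (m n) - min t q) \<le> t / real n"
      using eventually_gt_at_top[of 0] by eventually_elim (use near in auto)
    show "(\<lambda>n. t / real n) \<longlonglongrightarrow> 0" by (rule lim_const_over_n)
  qed
  then have "(\<lambda>n. grid t n (m n)) \<longlonglongrightarrow> min t q" by (rule LIM_zero_cancel)
  then have "(\<lambda>n. w (grid t n (m n))) \<longlonglongrightarrow> w (min t q)"
    by (rule continuous_on_tendsto_compose[OF w]) (use t q m_ge in auto)
  then have "(\<lambda>n. w (grid t n (m n)) - w 0) \<longlonglongrightarrow> w (min t q) - w 0" by (intro tendsto_intros)
  then show ?thesis
    by (rule Lim_transform_eventually) (use eventually_gt_at_top[of 0] in \<open>eventually_elim, simp only: sum\<close>)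
qed

lemma simple_integrand_nonneg:
  assumes "simple_integrand M F n p \<xi>" "i \<le> n" shows "0 \<le> p i"
  using assms(2)
proof (induction i)
  case 0 then show ?case using assms(1) by (simp add: simple_integrand_def)
next
  case (Suc i)
  then have "p i \<le> p (Suc i)" using assms(1) by (simp add: simple_integrand_def)
  then show ?case using Suc by simp
qed

lemma continuous_left_indicator:
  "continuous (at s within {0..s}) (indicator {a<..b} :: real \<Rightarrow> real)"
proof -
  have lt: "\<forall>\<^sub>F x in at s within {0..s}. c < x" if "c < s" for c
    using order_tendstoD(1)[OF tendsto_ident_at that] .
  have le: "\<forall>\<^sub>F x in at s within {0..s}. x \<le> s"
    by (simp add: eventually_at_filter)
  have "\<forall>\<^sub>F x in at s within {0..s}. indicator {a<..b} x = (indicator {a<..b} s :: real)"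
  proof (cases "s \<le> a")
    case True
    show ?thesis using le by eventually_elim (use True in \<open>auto simp: indicator_def\<close>)
  next
    case False
    show ?thesis
    proof (cases "s \<le> b")
      case True
      have "\<forall>\<^sub>F x in at s within {0..s}. a < x" using lt False by simp
      with le show ?thesis by eventually_elim (use True False in \<open>auto simp: indicator_def\<close>)
    next
      case b: False
      show ?thesis using lt[of b] b by (auto elim!: eventually_mono simp: indicator_def)
    qed
  qed
  then show ?thesis unfolding continuous_within by (rule tendsto_eventually)
qed

section \<open>From the Ito integral to left-point sums\<close>

context brownian
begin

lemma simple_process_measurable_F:
  assumes s: "simple_integrand M F n p \<xi>" and "0 \<le> r"
  shows "simple_process n p \<xi> r \<in> borel_measurable (F r)"
proof -
  have "(\<lambda>\<omega>. \<xi> i \<omega> * indicator {p i<..p (Suc i)} r) \<in> borel_measurable (F r)" if "i \<in> {..<n}" for i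
  proof (cases "p i < r")
    case True
    have "\<xi> i \<in> borel_measurable (F (p i))" using s that by (simp add: simple_integrand_def)
    then have "\<xi> i \<in> borel_measurable (F r)" by (rule measurable_F_mono) (use True in simp)
    then show ?thesis by simp
  qed simp
  then show ?thesis unfolding simple_process_def[abs_def] by (rule borel_measurable_sum)
qed

text \<open>The indicator of \<open>(p j, p (Suc j)]\<close> is the difference of two cut-offs, and
  \<open>grid_cut_sum\<close> treats each of them. The points \<open>p j\<close> need not lie on the
  grid.\<close>

lemma grid_sum_simple_process:
  assumes s: "simple_integrand M F n p \<xi>" and t: "0 < t" and w: "\<omega> \<in> space M"
  shows "(\<lambda>m. grid_sum (simple_process n p \<xi>) t m \<omega>) \<longlonglongrightarrow> simple_integral W n p \<xi> t \<omega>"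
proof -
  note c = W_continuous[OF w]
  let ?D = "\<lambda>m i. W (grid t m (Suc i)) \<omega> - W (grid t m i) \<omega>"
  have pos: "0 \<le> p j" "0 \<le> p (Suc j)" "p j \<le> p (Suc j)" if "j < n" for j
    using simple_integrand_nonneg[OF s] s that by (auto simp: simple_integrand_def)
  have ind: "indicator {p j<..p (Suc j)} x = indicator {..p (Suc j)} x - (indicator {..p j} x :: real)" if "j < n" for j and x :: real
    using pos[OF that] by (auto simp: indicator_def)
  have eq: "grid_sum (simple_process n p \<xi>) t m \<omega> = (\<Sum>j<n. \<xi> j \<omega> *
      ((\<Sum>i<m. indicator {..p (Suc j)} (grid t m i) * ?D m i) - (\<Sum>i<m. indicator {..p j} (grid t m i) * ?D m i)))" for m
  proof -
    have "grid_sum (simple_process n p \<xi>) t m \<omega> =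
      (\<Sum>i<m. \<Sum>j<n. \<xi> j \<omega> * (indicator {p j<..p (Suc j)} (grid t m i) * ?D m i))"
      unfolding grid_sum_def simple_process_def sum_distrib_right by (simp add: mult.assoc)
    also have "\<dots> = (\<Sum>j<n. \<Sum>i<m. \<xi> j \<omega> * (indicator {p j<..p (Suc j)} (grid t m i) * ?D m i))"
      by (rule sum.swap)
    also have "\<dots> = (\<Sum>j<n. \<xi> j \<omega> *
      ((\<Sum>i<m. indicator {..p (Suc j)} (grid t m i) * ?D m i) - (\<Sum>i<m. indicator {..p j} (grid t m i) * ?D m i)))"
      unfolding sum_distrib_left[symmetric] sum_subtractf[symmetric]
      by (intro sum.cong arg_cong2[where f="(*)"] refl) (simp add: ind left_diff_distrib)
    finally show ?thesis .
  qed
  have "(\<lambda>m. grid_sum (simple_process n p \<xi>) t m \<omega>) \<longlonglongrightarrow>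
    (\<Sum>j<n. \<xi> j \<omega> * ((W (min t (p (Suc j))) \<omega> - W 0 \<omega>) - (W (min t (p j)) \<omega> - W 0 \<omega>)))"
    unfolding eq by (intro tendsto_sum tendsto_mult tendsto_const tendsto_diff grid_cut_sum t c pos) auto
  then show ?thesis by (simp add: simple_integral_def)
qed

lemma grid_sum_measurable:
  assumes t: "0 \<le> t" and H: "\<And>s. 0 \<le> s \<Longrightarrow> s \<le> t \<Longrightarrow> H s \<in> borel_measurable M"
  shows "grid_sum H t n \<in> borel_measurable M"
  unfolding grid_sum_def
proof (intro borel_measurable_sum borel_measurable_times borel_measurable_diff W_measurable)
  fix i assume "i \<in> {..<n}"
  then have "0 \<le> grid t n i" "grid t n i \<le> t" using grid_point[of i n t] t by auto
  then show "H (grid t n i) \<in> borel_measurable M" using H by blast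
qed (use t in auto)

lemma adapted_continuous_measurable:
  assumes "adapted_continuous M F H" "0 \<le> s"
  shows "s \<le> t \<Longrightarrow> H s \<in> borel_measurable (F t)" "H s \<in> borel_measurable M"
  using assms measurable_F_mono measurable_F_imp_M unfolding adapted_continuous_def by blast+

lemma adapted_continuous_bounded:
  assumes H: "adapted_continuous M F H" and w: "\<omega> \<in> space M"
  obtains B where "0 < B" "\<And>s. 0 \<le> s \<Longrightarrow> s \<le> t \<Longrightarrow> \<bar>H s \<omega>\<bar> \<le> B"
proof -
  have "continuous_on {0..t} (\<lambda>s. H s \<omega>)"
    using H w unfolding adapted_continuous_def by (auto intro: continuous_on_subset)
  then have "bounded ((\<lambda>s. H s \<omega>) ` {0..t})" by (intro compact_imp_bounded compact_continuous_image) auto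
  then obtain B where B: "B > 0" "\<forall>x\<in>(\<lambda>s. H s \<omega>) ` {0..t}. norm x \<le> B" unfolding bounded_pos by blast
  show ?thesis using that[of B] B by auto
qed

text \<open>Left-point sums of a simple integrand on ever finer uniform grids converge pathwise to its integral,
  and Lenglart's inequality controls those of the difference to \<open>H\<close>; so no common refinement of two
  partitions is ever needed.\<close>

lemma has_ito_integral_imp_grid_sum:
  assumes I: "has_ito_integral M F W H t Y" and H: "adapted_continuous M F H" and t: "0 < t"
  shows "conv_prob (grid_sum H t) Y"
proof -
  from I obtain N p \<xi> where simp_int: "\<And>n. simple_integrand M F (N n) (p n) (\<xi> n)"
    and nul1: "null_in_probability M (\<lambda>n \<omega>. \<integral>\<^sup>+ s. ennreal ((simple_process (N n) (p n) (\<xi> n) s \<omega> - H s \<omega>)\<^sup>2) * indicator {0..t} s \<partial>lborel)"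
    and nul2: "null_in_probability M (\<lambda>n \<omega>. ennreal \<bar>simple_integral W (N n) (p n) (\<xi> n) t \<omega> - Y \<omega>\<bar>)"
    and Y[measurable]: "Y \<in> borel_measurable M"
    unfolding has_ito_integral_def by blast
  define \<phi> where "\<phi> n = simple_process (N n) (p n) (\<xi> n)" for n
  define J where "J n \<omega> = (\<integral>s. indicator {0..t} s * (\<phi> n s \<omega> - H s \<omega>)\<^sup>2 \<partial>lborel)" for n \<omega>
  define R where "R n m \<omega> = (\<Sum>i<m. (\<phi> n (grid t m i) \<omega> - H (grid t m i) \<omega>)\<^sup>2 * (t / real m))" for n m \<omega>
  define S where "S n = simple_integral W (N n) (p n) (\<xi> n) t" for n
  have \<phi>F: "\<phi> n s \<in> borel_measurable (F s)" if "0 \<le> s" for n s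
    unfolding \<phi>_def by (rule simple_process_measurable_F[OF simp_int that])
  have \<phi>M: "\<phi> n s \<in> borel_measurable M" if "0 \<le> s" for n s
    using \<phi>F[OF that] by (rule measurable_F_imp_M)
  note HM = adapted_continuous_measurable(2)[OF H]
  \<comment> \<open>On each path the error is bounded and continuous from the left. Hence its square
    has the finite integral \<open>J n\<close>, which turns the extended integral of the definition
    into a real one, and the Riemann sums \<open>R n m\<close> converge to it.\<close>
  have path: "integrable lborel (\<lambda>s. indicator {0..t} s * (\<phi> n s \<omega> - H s \<omega>)\<^sup>2)" "(\<lambda>m. R n m \<omega>) \<longlonglongrightarrow> J n \<omega>"
    if w: "\<omega> \<in> space M" for n \<omega>
  proof -
    obtain B where B: "0 < B" "\<And>s. 0 \<le> s \<Longrightarrow> s \<le> t \<Longrightarrow> \<bar>H s \<omega>\<bar> \<le> B"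
      using adapted_continuous_bounded[OF H w] by blast
    have c: "continuous (at s within {0..s}) (\<lambda>s. (\<phi> n s \<omega> - H s \<omega>)\<^sup>2)" if "0 \<le> s" for s
    proof (intro continuous_intros)
      show "continuous (at s within {0..s}) (\<lambda>s. \<phi> n s \<omega>)"
        unfolding \<phi>_def simple_process_def by (intro continuous_intros continuous_left_indicator)
      have "continuous (at s within {0..}) (\<lambda>s. H s \<omega>)"
        using H w that unfolding adapted_continuous_def continuous_on_eq_continuous_within by auto
      then show "continuous (at s within {0..s}) (\<lambda>s. H s \<omega>)" by (rule continuous_within_subset) auto
    qed
    have b\<phi>: "\<bar>\<phi> n s \<omega>\<bar> \<le> (\<Sum>i<N n. \<bar>\<xi> n i \<omega>\<bar>)" for s
      unfolding \<phi>_def simple_process_def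
      by (rule order_trans[OF sum_abs sum_mono]) (auto simp: indicator_def)
    have b: "\<bar>(\<phi> n s \<omega> - H s \<omega>)\<^sup>2\<bar> \<le> ((\<Sum>i<N n. \<bar>\<xi> n i \<omega>\<bar>) + B)\<^sup>2" if "0 \<le> s" "s \<le> t" for s
    proof -
      have "\<bar>\<phi> n s \<omega> - H s \<omega>\<bar> \<le> (\<Sum>i<N n. \<bar>\<xi> n i \<omega>\<bar>) + B" using b\<phi>[of s] B(2)[OF that] by linarith
      then have "\<bar>\<phi> n s \<omega> - H s \<omega>\<bar>\<^sup>2 \<le> ((\<Sum>i<N n. \<bar>\<xi> n i \<omega>\<bar>) + B)\<^sup>2" by (rule power_mono) simp
      then show ?thesis by simp
    qed
    show "integrable lborel (\<lambda>s. indicator {0..t} s * (\<phi> n s \<omega> - H s \<omega>)\<^sup>2)" "(\<lambda>m. R n m \<omega>) \<longlonglongrightarrow> J n \<omega>"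
      using riemann_sum_left_continuous[OF t c b] unfolding R_def J_def by auto
  qed
  have Rm[measurable]: "R n m \<in> borel_measurable M" for n m
    unfolding R_def using t by (intro borel_measurable_sum borel_measurable_times borel_measurable_power borel_measurable_diff HM \<phi>M) auto
  have Jm[measurable]: "J n \<in> borel_measurable M" for n
    by (rule borel_measurable_LIMSEQ_real[of M "R n"]) (use path(2) Rm in auto)
  have Gm[measurable]: "grid_sum (\<phi> n) t m \<in> borel_measurable M" "grid_sum H t m \<in> borel_measurable M"
     "grid_sum (\<lambda>s \<omega>. \<phi> n s \<omega> - H s \<omega>) t m \<in> borel_measurable M" for n m
    using t by (auto intro!: grid_sum_measurable \<phi>M HM borel_measurable_diff)
  have lim_S: "(\<lambda>m. grid_sum (\<phi> n) t m \<omega>) \<longlonglongrightarrow> S n \<omega>" if "\<omega> \<in> space M" for n \<omega>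
    unfolding \<phi>_def S_def by (rule grid_sum_simple_process[OF simp_int t that])
  have Sm[measurable]: "S n \<in> borel_measurable M" for n
    by (rule borel_measurable_LIMSEQ_real[of M "grid_sum (\<phi> n) t"]) (use lim_S in auto)
  have c1: "conv_prob (grid_sum (\<phi> n) t) (S n)" for n
    by (rule conv_prob_AE_tendsto) (use lim_S in auto)
  have c2: "conv_prob (R n) (J n)" for n
    by (rule conv_prob_AE_tendsto) (use path in auto)
  have nnJ: "(\<integral>\<^sup>+ s. ennreal ((\<phi> n s \<omega> - H s \<omega>)\<^sup>2) * indicator {0..t} s \<partial>lborel) = ennreal (J n \<omega>)" if "\<omega> \<in> space M" for n \<omega>
  proof -
    have "(\<integral>\<^sup>+ s. ennreal ((\<phi> n s \<omega> - H s \<omega>)\<^sup>2) * indicator {0..t} s \<partial>lborel) = (\<integral>\<^sup>+ s. ennreal (indicator {0..t} s * (\<phi> n s \<omega> - H s \<omega>)\<^sup>2) \<partial>lborel)"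
      by (intro nn_integral_cong) (auto simp: indicator_def)
    then show ?thesis using nn_integral_eq_integral[OF path(1)[OF that, of n]] by (simp add: J_def)
  qed
  have J_nonneg: "0 \<le> J n \<omega>" for n \<omega> unfolding J_def by (rule integral_nonneg_AE) auto
  have null1: "(\<lambda>n. prob {\<omega>\<in>space M. d \<le> J n \<omega>}) \<longlonglongrightarrow> 0" if "0 < d" for d
  proof -
    have "{\<omega>\<in>space M. d \<le> J n \<omega>} = {\<omega>\<in>space M. ennreal d \<le> (\<integral>\<^sup>+ s. ennreal ((\<phi> n s \<omega> - H s \<omega>)\<^sup>2) * indicator {0..t} s \<partial>lborel)}" for n
      using that J_nonneg by (auto simp: nnJ ennreal_le_iff)
    then show ?thesis using nul1 that unfolding null_in_probability_def \<phi>_def by simp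
  qed
  have null2: "(\<lambda>n. prob {\<omega>\<in>space M. d \<le> \<bar>S n \<omega> - Y \<omega>\<bar>}) \<longlonglongrightarrow> 0" if "0 < d" for d
    using nul2 that unfolding null_in_probability_def S_def by (simp add: ennreal_le_iff)
  show ?thesis
    unfolding conv_prob_iff
  proof (intro conjI allI impI)
    fix e :: real assume e: "0 < e"
    show "(\<lambda>m. prob {\<omega>\<in>space M. e \<le> \<bar>grid_sum H t m \<omega> - Y \<omega>\<bar>}) \<longlonglongrightarrow> 0"
    proof (rule order_tendstoI)
      fix r :: real assume r: "0 < r"
      \<comment> \<open>The error passes through two intermediate terms, so \<open>e\<close> is
        split in three. \<open>d\<close> is chosen to make \<open>d / e'^2\<close> equal to
        \<open>r / 5\<close>: Lenglart's term is one of five contributions, the others being the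
        deviations of \<open>R\<close>, \<open>J\<close>, the sums of \<open>\<phi> n\<close>, and
        \<open>S\<close>.\<close>
      define e' where "e' = e / 3"
      define d where "d = r / 5 * e'\<^sup>2"
      have pos: "0 < e'" "0 < d" "0 < d / 2" "0 < r / 5" using e r by (auto simp: e'_def d_def)
      \<comment> \<open>The order of the limits matters: the approximating simple integrand
        \<open>n\<close> is fixed here, and only afterwards is the grid refined.\<close>
      have "\<forall>\<^sub>F n in sequentially. prob {\<omega>\<in>space M. d/2 \<le> J n \<omega>} < r/5 \<and> prob {\<omega>\<in>space M. e' \<le> \<bar>S n \<omega> - Y \<omega>\<bar>} < r/5"
        by (intro eventually_conj order_tendstoD(2)[OF null1] order_tendstoD(2)[OF null2] pos)
      then obtain n where n: "prob {\<omega>\<in>space M. d/2 \<le> J n \<omega>} < r/5" "prob {\<omega>\<in>space M. e' \<le> \<bar>S n \<omega> - Y \<omega>\<bar>} < r/5"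
        by (auto simp: eventually_sequentially)
      have "(\<lambda>m. prob {\<omega>\<in>space M. e' \<le> \<bar>grid_sum (\<phi> n) t m \<omega> - S n \<omega>\<bar>}) \<longlonglongrightarrow> 0"
        "(\<lambda>m. prob {\<omega>\<in>space M. d/2 \<le> \<bar>R n m \<omega> - J n \<omega>\<bar>}) \<longlonglongrightarrow> 0"
        using c1[of n] c2[of n] pos unfolding conv_prob_iff by blast+
      note l = this
      have "\<forall>\<^sub>F m in sequentially. prob {\<omega>\<in>space M. e' \<le> \<bar>grid_sum (\<phi> n) t m \<omega> - S n \<omega>\<bar>} < r/5 \<and>
          prob {\<omega>\<in>space M. d/2 \<le> \<bar>R n m \<omega> - J n \<omega>\<bar>} < r/5"
        by (rule eventually_conj[OF order_tendstoD(2)[OF l(1) pos(4)] order_tendstoD(2)[OF l(2) pos(4)]])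
      then show "\<forall>\<^sub>F m in sequentially. prob {\<omega>\<in>space M. e \<le> \<bar>grid_sum H t m \<omega> - Y \<omega>\<bar>} < r"
      proof eventually_elim
        case (elim m)
        let ?P = "\<lambda>Q. {\<omega>\<in>space M. Q \<omega>}"
        have diff: "grid_sum (\<lambda>s \<omega>. \<phi> n s \<omega> - H s \<omega>) t m \<omega> = grid_sum (\<phi> n) t m \<omega> - grid_sum H t m \<omega>" for \<omega>
          by (simp add: grid_sum_def sum_subtractf left_diff_distrib)
        have "prob (?P (\<lambda>\<omega>. e \<le> \<bar>grid_sum H t m \<omega> - Y \<omega>\<bar>)) \<le>
          prob (?P (\<lambda>\<omega>. e' \<le> \<bar>grid_sum (\<lambda>s \<omega>. \<phi> n s \<omega> - H s \<omega>) t m \<omega>\<bar>) \<union>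
            (?P (\<lambda>\<omega>. e' \<le> \<bar>grid_sum (\<phi> n) t m \<omega> - S n \<omega>\<bar>) \<union> ?P (\<lambda>\<omega>. e' \<le> \<bar>S n \<omega> - Y \<omega>\<bar>)))"
        proof (rule finite_measure_mono)
          have "e' \<le> \<bar>a - b\<bar> \<or> e' \<le> \<bar>a - c\<bar> \<or> e' \<le> \<bar>c - d\<bar>" if "e \<le> \<bar>b - d\<bar>" for a b c d :: real
          proof (rule ccontr)
            assume "\<not> ?thesis"
            then have "\<bar>a - b\<bar> < e / 3" "\<bar>a - c\<bar> < e / 3" "\<bar>c - d\<bar> < e / 3" by (auto simp: e'_def)
            then show False using that by linarith
          qed
          then show "?P (\<lambda>\<omega>. e \<le> \<bar>grid_sum H t m \<omega> - Y \<omega>\<bar>) \<subseteq>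
            ?P (\<lambda>\<omega>. e' \<le> \<bar>grid_sum (\<lambda>s \<omega>. \<phi> n s \<omega> - H s \<omega>) t m \<omega>\<bar>) \<union>
            (?P (\<lambda>\<omega>. e' \<le> \<bar>grid_sum (\<phi> n) t m \<omega> - S n \<omega>\<bar>) \<union> ?P (\<lambda>\<omega>. e' \<le> \<bar>S n \<omega> - Y \<omega>\<bar>))"
            unfolding diff by blast
        qed measurable
        also have "\<dots> \<le> prob (?P (\<lambda>\<omega>. e' \<le> \<bar>grid_sum (\<lambda>s \<omega>. \<phi> n s \<omega> - H s \<omega>) t m \<omega>\<bar>)) +
            (prob (?P (\<lambda>\<omega>. e' \<le> \<bar>grid_sum (\<phi> n) t m \<omega> - S n \<omega>\<bar>)) + prob (?P (\<lambda>\<omega>. e' \<le> \<bar>S n \<omega> - Y \<omega>\<bar>)))"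
          by (intro order_trans[OF measure_Un_le] add_left_mono measure_Un_le) measurable
        also have "prob (?P (\<lambda>\<omega>. e' \<le> \<bar>grid_sum (\<lambda>s \<omega>. \<phi> n s \<omega> - H s \<omega>) t m \<omega>\<bar>)) \<le> d / e'\<^sup>2 + prob (?P (\<lambda>\<omega>. d \<le> R n m \<omega>))"
          unfolding R_def using pos adapted_continuous_measurable(1)[OF H]
          by (intro grid_sum_prob_le t borel_measurable_diff \<phi>F) auto
        also have "prob (?P (\<lambda>\<omega>. d \<le> R n m \<omega>)) \<le> prob (?P (\<lambda>\<omega>. d/2 \<le> \<bar>R n m \<omega> - J n \<omega>\<bar>) \<union> ?P (\<lambda>\<omega>. d/2 \<le> J n \<omega>))"
        proof (rule finite_measure_mono)
          have "d/2 \<le> \<bar>x - y\<bar> \<or> d/2 \<le> y" if "d \<le> x" for x y using that by argo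
          then show "?P (\<lambda>\<omega>. d \<le> R n m \<omega>) \<subseteq> ?P (\<lambda>\<omega>. d/2 \<le> \<bar>R n m \<omega> - J n \<omega>\<bar>) \<union> ?P (\<lambda>\<omega>. d/2 \<le> J n \<omega>)" by blast
        qed measurable
        also have "\<dots> \<le> prob (?P (\<lambda>\<omega>. d/2 \<le> \<bar>R n m \<omega> - J n \<omega>\<bar>)) + prob (?P (\<lambda>\<omega>. d/2 \<le> J n \<omega>))"
          by (rule measure_Un_le) measurable
        also have "d / e'\<^sup>2 = r / 5" using pos by (simp add: d_def)
        finally show ?case using elim n by linarith
      qed
    next
      fix r :: real assume "r < 0"
      then show "\<forall>\<^sub>F m in sequentially. r < prob {\<omega>\<in>space M. e \<le> \<bar>grid_sum H t m \<omega> - Y \<omega>\<bar>}"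
        by (intro always_eventually allI) (rule less_le_trans, auto)
    qed
  qed auto
qed

end

section \<open>From left-point sums to the Ito integral\<close>

lemma grid_ceiling:
  fixes t s :: real
  assumes s: "0 < s" "s \<le> t"
  defines "k \<equiv> \<lambda>n. nat (\<lceil>s / (t / real n)\<rceil> - 1)"
  shows "n > 0 \<Longrightarrow> grid t n (k n) < s"
    and "n > 0 \<Longrightarrow> s \<le> grid t n (Suc (k n))"
    and "n > 0 \<Longrightarrow> k n < n"
    and "(\<lambda>n. grid t n (k n)) \<longlonglongrightarrow> s"
proof -
  have t: "0 < t" using s by simp
  \<comment> \<open>The cells are now open on the left, like those of a simple process; hence
    \<open>s > 0\<close>, and the ceiling minus one in place of the floor.\<close>
  have 1: "grid t n (k n) < s \<and> s \<le> grid t n (Suc (k n))" if "n > 0" for n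
  proof -
    have h: "0 < t / real n" using t that by simp
    have "0 < s / (t / real n)" using divide_pos_pos[OF s(1) h] .
    then have "0 < \<lceil>s / (t / real n)\<rceil>" by (simp only: zero_less_ceiling)
    then have k: "real (k n) = real_of_int \<lceil>s / (t / real n)\<rceil> - 1" unfolding k_def by linarith
    have "real (k n) < s / (t / real n)" "s / (t / real n) \<le> real (Suc (k n))"
      unfolding of_nat_Suc k by linarith+
    then show ?thesis using pos_less_divide_eq[OF h] pos_divide_le_eq[OF h] by blast
  qed
  then show "n > 0 \<Longrightarrow> grid t n (k n) < s" "n > 0 \<Longrightarrow> s \<le> grid t n (Suc (k n))" by auto
  show "k n < n" if "n > 0"
  proof -
    have "grid t n (k n) < grid t n n" using 1[OF that] s that by simp
    then have "real (k n) < real n" by (rule mult_right_less_imp_less) (use t in simp)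
    then show ?thesis by simp
  qed
  show "(\<lambda>n. grid t n (k n)) \<longlonglongrightarrow> s"
  proof (rule tendsto_sandwich[where f="\<lambda>n. s - t / real n" and h="\<lambda>_. s"])
    show "\<forall>\<^sub>F n in sequentially. s - t / real n \<le> grid t n (k n)"
      using eventually_gt_at_top[of 0]
    proof eventually_elim
      case (elim n)
      then show ?case using 1[of n] by (simp add: algebra_simps add_divide_distrib)
    qed
    show "\<forall>\<^sub>F n in sequentially. grid t n (k n) \<le> s"
      using eventually_gt_at_top[of 0]
    proof eventually_elim
      case (elim n)
      then show ?case using 1[of n] by linarith
    qed
    have "(\<lambda>n. t / real n) \<longlonglongrightarrow> 0" by (rule lim_const_over_n)
    from tendsto_diff[OF tendsto_const this] show "(\<lambda>n. s - t / real n) \<longlonglongrightarrow> s" by simp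
  qed simp
qed

text \<open>Progressive measurability speaks of \<open>[0, t]\<close> and \<open>F t\<close> only.
  Clipping time to \<open>[0, t]\<close> gives a function on the whole product with
  \<open>M\<close>, to which measurability of integrals over \<open>s\<close> applies;
  \<open>\<omega>\<close> comes first because it is the parameter that remains.\<close>

lemma progressively_measurable_clip:
  assumes H: "progressively_measurable F H" and t: "0 \<le> t"
    and F: "sets (F t) \<subseteq> sets M" "space (F t) = space M"
  shows "(\<lambda>(\<omega>, s). H (max 0 (min t s)) \<omega>) \<in> borel_measurable (M \<Otimes>\<^sub>M borel)"
proof -
  have H': "(\<lambda>(s, \<omega>). H s \<omega>) \<in> borel_measurable (restrict_space borel {0..t} \<Otimes>\<^sub>M F t)"
    using H t by (simp add: progressively_measurable_def)
  have id: "(\<lambda>\<omega>. \<omega>) \<in> measurable M (F t)"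
    using F by (intro measurableI) (auto simp: sets.Int_space_eq2 intro: sets.sets_into_space)
  have "(\<lambda>z. (max 0 (min t (snd z)), fst z)) \<in> measurable (M \<Otimes>\<^sub>M borel) (restrict_space borel {0..t} \<Otimes>\<^sub>M F t)"
  proof (rule measurable_Pair)
    show "(\<lambda>z. max 0 (min t (snd z))) \<in> measurable (M \<Otimes>\<^sub>M borel) (restrict_space borel {0..t})"
      using t by (intro measurable_restrict_space2) auto
    show "fst \<in> measurable (M \<Otimes>\<^sub>M borel) (F t)"
      using measurable_compose[OF measurable_fst id] .
  qed
  from measurable_compose[OF this H'] show ?thesis by (simp add: case_prod_beta')
qed

context prob_space
begin

lemma conv_prob_Suc:
  assumes "\<And>n. X n \<in> borel_measurable M"
  shows "conv_prob (\<lambda>n. X (Suc n)) Y \<longleftrightarrow> conv_prob X Y"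
  using assms LIMSEQ_Suc LIMSEQ_imp_Suc by (auto simp: conv_prob_def dest: LIMSEQ_Suc LIMSEQ_imp_Suc)

lemma null_in_probability_tendsto:
  assumes X[measurable]: "\<And>n. X n \<in> borel_measurable M"
    and lim: "AE \<omega> in M. (\<lambda>n. X n \<omega>) \<longlonglongrightarrow> 0"
  shows "null_in_probability M X"
  unfolding null_in_probability_def
proof (intro conjI allI impI)
  fix e :: real assume e: "e > 0"
  have "(\<lambda>n. \<integral>\<omega>. indicator {\<omega> \<in> space M. ennreal e \<le> X n \<omega>} \<omega> \<partial>M) \<longlonglongrightarrow> (\<integral>\<omega>. (0::real) \<partial>M)"
  proof (rule integral_dominated_convergence[where w="\<lambda>_. 1"])
    show "AE \<omega> in M. (\<lambda>n. indicator {\<omega> \<in> space M. ennreal e \<le> X n \<omega>} \<omega> :: real) \<longlonglongrightarrow> 0"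
      using lim
    proof eventually_elim
      case (elim \<omega>)
      then have "\<forall>\<^sub>F n in sequentially. X n \<omega> < ennreal e" using e by (intro order_tendstoD(2)) auto
      then have "\<forall>\<^sub>F n in sequentially. indicator {\<omega> \<in> space M. ennreal e \<le> X n \<omega>} \<omega> = (0::real)"
        by eventually_elim (auto simp: indicator_def)
      then show ?case by (rule tendsto_eventually)
    qed
  qed (auto simp: indicator_def)
  then show "(\<lambda>n. prob {\<omega> \<in> space M. ennreal e \<le> X n \<omega>}) \<longlonglongrightarrow> 0" by simp
qed simp

lemma null_in_probability_cong:
  assumes X: "null_in_probability M X" and X': "\<And>n. X' n \<in> borel_measurable M"
    and eq: "\<And>n. AE \<omega> in M. X n \<omega> = X' n \<omega>"
  shows "null_in_probability M X'"
proof -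
  have [measurable]: "\<And>n. X n \<in> borel_measurable M" using X by (simp add: null_in_probability_def)
  note X'[measurable]
  have "prob {\<omega> \<in> space M. ennreal e \<le> X n \<omega>} = prob {\<omega> \<in> space M. ennreal e \<le> X' n \<omega>}" for e n
    by (rule finite_measure_eq_AE) (use eq[of n] in auto)
  then show ?thesis using X X' by (simp add: null_in_probability_def)
qed

lemma null_in_probability_conv_prob:
  assumes "conv_prob X Y" shows "null_in_probability M (\<lambda>n \<omega>. ennreal \<bar>X n \<omega> - Y \<omega>\<bar>)"
proof -
  note [measurable] = conv_prob_measurable[OF assms]
  show ?thesis using assms unfolding null_in_probability_def conv_prob_iff by (simp add: ennreal_le_iff)
qed

end

context brownian
begin

lemma adapted_continuous_clip:
  assumes H: "adapted_continuous M F H" and w: "\<omega> \<in> space M"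
  shows "continuous_on UNIV (\<lambda>s. H (max 0 s) \<omega>)"
proof -
  have "continuous_on {0..} (\<lambda>s. H s \<omega>)" using H w by (simp add: adapted_continuous_def)
  then show ?thesis by (rule continuous_on_compose2) (auto intro!: continuous_intros)
qed

lemma adapted_continuous_joint:
  assumes H: "adapted_continuous M F H"
  shows "(\<lambda>(s, \<omega>). H (max 0 s) \<omega>) \<in> borel_measurable (borel \<Otimes>\<^sub>M M)"
  by (rule measurable_continuous_process)
     (use adapted_continuous_clip[OF H] adapted_continuous_measurable(2)[OF H] in auto)

lemma adapted_continuous_progressive:
  assumes H: "adapted_continuous M F H"
  shows "progressively_measurable F H"
  unfolding progressively_measurable_def
proof (intro allI impI)
  fix t :: real assume t: "0 \<le> t"
  have "(\<lambda>(s, \<omega>). H (max 0 (min s t)) \<omega>) \<in> borel_measurable (borel \<Otimes>\<^sub>M F t)"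
  proof (rule measurable_continuous_process)
    show "H (max 0 (min s t)) \<in> borel_measurable (F t)" for s
      using t by (intro adapted_continuous_measurable[OF H]) auto
    fix \<omega> assume "\<omega> \<in> space (F t)"
    then have "continuous_on UNIV (\<lambda>s. H (max 0 s) \<omega>)" using adapted_continuous_clip[OF H] by simp
    then show "continuous_on UNIV (\<lambda>s. H (max 0 (min s t)) \<omega>)"
      by (rule continuous_on_compose2) (auto intro!: continuous_intros)
  qed
  moreover have "(\<lambda>z. z) \<in> measurable (restrict_space borel {0..t} \<Otimes>\<^sub>M F t) (borel \<Otimes>\<^sub>M F t)"
  proof -
    have "(\<lambda>z. (fst z, snd z)) \<in> measurable (restrict_space borel {0..t} \<Otimes>\<^sub>M F t) (borel \<Otimes>\<^sub>M F t)"
      by (intro measurable_Pair measurable_snd measurable_compose[OF measurable_fst measurable_restrict_space1]) simp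
    then show ?thesis by simp
  qed
  ultimately have "(\<lambda>(s, \<omega>). H (max 0 (min s t)) \<omega>) \<in> borel_measurable (restrict_space borel {0..t} \<Otimes>\<^sub>M F t)"
    using measurable_compose by blast
  moreover have "(\<lambda>(s, \<omega>). H s \<omega>) \<in> borel_measurable (restrict_space borel {0..t} \<Otimes>\<^sub>M F t) \<longleftrightarrow>
    (\<lambda>(s, \<omega>). H (max 0 (min s t)) \<omega>) \<in> borel_measurable (restrict_space borel {0..t} \<Otimes>\<^sub>M F t)"
    by (rule measurable_cong) (auto simp: space_pair_measure space_restrict_space)
  ultimately show "(\<lambda>(s, \<omega>). H s \<omega>) \<in> borel_measurable (restrict_space borel {0..t} \<Otimes>\<^sub>M F t)" by blast
qed

lemma simple_integrand_measurable:
  assumes "simple_integrand M F n p \<xi>" "i < n" shows "\<xi> i \<in> borel_measurable M"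
  using assms measurable_F_imp_M unfolding simple_integrand_def by blast

text \<open>Needed because convergence in probability, as defined for
  \<open>[0, \<infinity>]\<close>-valued variables, asks for measurability explicitly. It follows
  from Tonelli, with the integrand clipped to \<open>[0, t]\<close>.\<close>

lemma error_integral_measurable:
  assumes H: "progressively_measurable F H" and t: "0 \<le> t" and \<xi>: "simple_integrand M F n p \<xi>"
  shows "(\<lambda>\<omega>. \<integral>\<^sup>+ s. ennreal ((simple_process n p \<xi> s \<omega> - H s \<omega>)\<^sup>2) * indicator {0..t} s \<partial>lborel) \<in> borel_measurable M"
proof -
  have [measurable]: "(\<lambda>z. H (max 0 (min t (snd z))) (fst z)) \<in> borel_measurable (M \<Otimes>\<^sub>M borel)"
    using progressively_measurable_clip[OF H t sets_F_subset space_F] by (simp add: case_prod_beta')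
  note \<xi>m = simple_integrand_measurable[OF \<xi>]
  have [measurable]: "(\<lambda>z. simple_process n p \<xi> (snd z) (fst z)) \<in> borel_measurable (M \<Otimes>\<^sub>M borel)"
    unfolding simple_process_def
  proof (intro borel_measurable_sum borel_measurable_times)
    fix i assume "i \<in> {..<n}"
    then show "(\<lambda>z. \<xi> i (fst z)) \<in> borel_measurable (M \<Otimes>\<^sub>M borel)"
      using \<xi>m by (intro measurable_compose[OF measurable_fst]) auto
  qed measurable
  have "(\<lambda>z. ennreal ((simple_process n p \<xi> (snd z) (fst z) - H (max 0 (min t (snd z))) (fst z))\<^sup>2) * indicator {0..t} (snd z))
      \<in> borel_measurable (M \<Otimes>\<^sub>M borel)"
    by measurable
  then have "(\<lambda>\<omega>. \<integral>\<^sup>+ s. ennreal ((simple_process n p \<xi> s \<omega> - H (max 0 (min t s)) \<omega>)\<^sup>2) * indicator {0..t} s \<partial>lborel) \<in> borel_measurable M"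
    by (intro lborel.borel_measurable_nn_integral) (simp add: case_prod_beta' measurable_lborel2 cong: measurable_cong_sets)
  moreover have "(\<integral>\<^sup>+ s. ennreal ((simple_process n p \<xi> s \<omega> - H (max 0 (min t s)) \<omega>)\<^sup>2) * indicator {0..t} s \<partial>lborel) =
    (\<integral>\<^sup>+ s. ennreal ((simple_process n p \<xi> s \<omega> - H s \<omega>)\<^sup>2) * indicator {0..t} s \<partial>lborel)" for \<omega>
    by (intro nn_integral_cong) (auto simp: indicator_def)
  ultimately show ?thesis by simp
qed

text \<open>The integrand of the inventory gain is known to be continuous only off the null set
  where \<open>Q\<close> differs from its explicit form. As \<open>F\<close> is not assumed
  complete, the replacement cannot inherit measurability from the original and brings its
  own.\<close>

lemma has_ito_integral_cong_AE:
  assumes I: "has_ito_integral M F W H t Y" and t: "0 \<le> t"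
    and H': "progressively_measurable F H'" and Y'[measurable]: "Y' \<in> borel_measurable M"
    and eq: "AE \<omega> in M. (\<forall>s. 0 \<le> s \<longrightarrow> s \<le> t \<longrightarrow> H s \<omega> = H' s \<omega>) \<and> Y \<omega> = Y' \<omega>"
  shows "has_ito_integral M F W H' t Y'"
proof -
  from I obtain N p \<xi> where simp_int: "\<And>n. simple_integrand M F (N n) (p n) (\<xi> n)"
    and nul1: "null_in_probability M (\<lambda>n \<omega>. \<integral>\<^sup>+ s. ennreal ((simple_process (N n) (p n) (\<xi> n) s \<omega> - H s \<omega>)\<^sup>2) * indicator {0..t} s \<partial>lborel)"
    and nul2: "null_in_probability M (\<lambda>n \<omega>. ennreal \<bar>simple_integral W (N n) (p n) (\<xi> n) t \<omega> - Y \<omega>\<bar>)"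
    and Y[measurable]: "Y \<in> borel_measurable M"
    unfolding has_ito_integral_def by blast
  have "null_in_probability M (\<lambda>n \<omega>. \<integral>\<^sup>+ s. ennreal ((simple_process (N n) (p n) (\<xi> n) s \<omega> - H' s \<omega>)\<^sup>2) * indicator {0..t} s \<partial>lborel)"
  proof (rule null_in_probability_cong[OF nul1 error_integral_measurable[OF H' t simp_int]])
    show "AE \<omega> in M. (\<integral>\<^sup>+ s. ennreal ((simple_process (N n) (p n) (\<xi> n) s \<omega> - H s \<omega>)\<^sup>2) * indicator {0..t} s \<partial>lborel)
      = (\<integral>\<^sup>+ s. ennreal ((simple_process (N n) (p n) (\<xi> n) s \<omega> - H' s \<omega>)\<^sup>2) * indicator {0..t} s \<partial>lborel)" for n
      using eq by eventually_elim (auto intro!: nn_integral_cong simp: indicator_def)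
  qed
  moreover have "null_in_probability M (\<lambda>n \<omega>. ennreal \<bar>simple_integral W (N n) (p n) (\<xi> n) t \<omega> - Y' \<omega>\<bar>)"
  proof (rule null_in_probability_cong[OF nul2])
    have "simple_integral W (N n) (p n) (\<xi> n) t \<in> borel_measurable M" for n
      unfolding simple_integral_def
    proof (intro borel_measurable_sum borel_measurable_times borel_measurable_diff W_measurable)
      fix i assume i: "i \<in> {..<N n}"
      then show "\<xi> n i \<in> borel_measurable M" by (intro simple_integrand_measurable[OF simp_int]) simp
      show "0 \<le> min t (p n i)" "0 \<le> min t (p n (Suc i))"
        using simple_integrand_nonneg[OF simp_int, of i n] simple_integrand_nonneg[OF simp_int, of "Suc i" n] t i by simp_all
    qed
    then show "(\<lambda>\<omega>. ennreal \<bar>simple_integral W (N n) (p n) (\<xi> n) t \<omega> - Y' \<omega>\<bar>) \<in> borel_measurable M" for n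
      by measurable
    show "AE \<omega> in M. ennreal \<bar>simple_integral W (N n) (p n) (\<xi> n) t \<omega> - Y \<omega>\<bar> =
      ennreal \<bar>simple_integral W (N n) (p n) (\<xi> n) t \<omega> - Y' \<omega>\<bar>" for n
      using eq by eventually_elim simp
  qed
  ultimately show ?thesis using simp_int H' Y' unfolding has_ito_integral_def by blast
qed

text \<open>The left-point values of \<open>H\<close> give the approximating simple integrands.
  These must be bounded uniformly in \<open>\<omega>\<close>, so the values are clamped at
  \<open>Suc n\<close>; a continuous path is bounded on \<open>[0, t]\<close>, hence the clamp is
  inactive on it from some \<open>n\<close> on. That settles both required limits pathwise before
  passing to probability.\<close>

lemma grid_sum_imp_has_ito_integral:
  assumes H: "adapted_continuous M F H" and t: "0 \<le> t" and c: "conv_prob (grid_sum H t) Y"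
  shows "has_ito_integral M F W H t Y"
proof -
  define clamp where "clamp n x = max (- real (Suc n)) (min (real (Suc n)) x)" for n and x :: real
  define p where "p n i = grid t (Suc n) i" for n i
  define \<xi> where "\<xi> n i \<omega> = clamp n (H (p n i) \<omega>)" for n i \<omega>
  note [measurable] = conv_prob_measurable[OF c]
  have p0: "0 \<le> p n i" for n i using t by (simp add: p_def)
  have p_mono: "p n i \<le> p n (Suc i)" for n i using t by (simp add: p_def divide_right_mono mult_right_mono)
  have p_t: "p n i \<le> t" if "i \<le> Suc n" for n i unfolding p_def using grid_point(2)[OF that t] .
  have simp_int: "simple_integrand M F (Suc n) (p n) (\<xi> n)" for n
    unfolding simple_integrand_def
  proof (intro conjI allI impI)
    show "\<exists>B. \<forall>i<Suc n. \<forall>\<omega>\<in>space M. \<bar>\<xi> n i \<omega>\<bar> \<le> B"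
      by (rule exI[of _ "real (Suc n)"]) (auto simp: \<xi>_def clamp_def)
    show "\<xi> n i \<in> borel_measurable (F (p n i))" for i
    proof -
      have [measurable]: "H (p n i) \<in> borel_measurable (F (p n i))"
        using adapted_continuous_measurable(1)[OF H p0] by simp
      show ?thesis unfolding \<xi>_def[abs_def] clamp_def by measurable
    qed
  qed (use p0 p_mono in auto)
  have clamp_eq: "clamp n x = x" if "\<bar>x\<bar> \<le> real n" for n x using that by (auto simp: clamp_def)
  have clamp_abs: "\<bar>clamp n x\<bar> \<le> \<bar>x\<bar>" for n x by (auto simp: clamp_def)
  have "null_in_probability M (\<lambda>n \<omega>. \<integral>\<^sup>+ s. ennreal ((simple_process (Suc n) (p n) (\<xi> n) s \<omega> - H s \<omega>)\<^sup>2) * indicator {0..t} s \<partial>lborel)"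
  proof (rule null_in_probability_tendsto[OF error_integral_measurable[OF adapted_continuous_progressive[OF H] t simp_int] AE_I2])
    fix \<omega> assume w: "\<omega> \<in> space M"
    obtain B where B: "0 < B" "\<And>s. 0 \<le> s \<Longrightarrow> s \<le> t \<Longrightarrow> \<bar>H s \<omega>\<bar> \<le> B"
      using adapted_continuous_bounded[OF H w] by blast
    define k where "k n s = nat (\<lceil>s / (t / real (Suc n))\<rceil> - 1)" for n s
    have val: "simple_process (Suc n) (p n) (\<xi> n) s \<omega> = clamp n (H (p n (k n s)) \<omega>) \<and> p n (k n s) \<le> t" if s: "0 < s" "s \<le> t" for n s
    proof -
      note g = grid_ceiling(1-3)[OF s, of "Suc n", folded k_def p_def]
      have "simple_process (Suc n) (p n) (\<xi> n) s \<omega> = \<xi> n (k n s) \<omega>"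
        unfolding simple_process_def
      proof (rule sum_indicator_unique)
        show "k n s < Suc n" "s \<in> {p n (k n s)<..p n (Suc (k n s))}" using g by auto
        fix i assume i: "s \<in> {p n i<..p n (Suc i)}"
        have h: "0 < t / real (Suc n)" using s by simp
        have "p n i < p n (Suc (k n s))" "p n (k n s) < p n (Suc i)" using i g by auto
        then have "real i < real (Suc (k n s))" "real (k n s) < real (Suc i)"
          unfolding p_def mult_less_cancel_right_pos[OF h] by auto
        then show "i = k n s" by simp
      qed
      then show ?thesis using g(1) s by (simp add: \<xi>_def)
    qed
    let ?f = "\<lambda>n s. ennreal ((simple_process (Suc n) (p n) (\<xi> n) s \<omega> - H (max 0 s) \<omega>)\<^sup>2) * indicator {0..t} s"
    have [measurable]: "(\<lambda>s. H (max 0 s) \<omega>) \<in> borel_measurable borel"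
      using adapted_continuous_clip[OF H w] by (rule borel_measurable_continuous_onI)
    have "(\<lambda>n. \<integral>\<^sup>+ s. ?f n s \<partial>lborel) \<longlonglongrightarrow> (\<integral>\<^sup>+ s. 0 \<partial>(lborel :: real measure))"
    proof (rule nn_integral_dominated_convergence[where w="\<lambda>s. ennreal ((B + B)\<^sup>2) * indicator {0..t} s"])
      show "?f n \<in> borel_measurable lborel" for n
        unfolding simple_process_def by measurable
      show "(\<integral>\<^sup>+ s. ennreal ((B + B)\<^sup>2) * indicator {0..t} s \<partial>lborel) < \<infinity>"
        using t by (simp add: nn_integral_cmult_indicator ennreal_mult_less_top)
      \<comment> \<open>At time 0 the simple process is 0 whatever \<open>H\<close> is, since its
        cells are open on the left; this single time is discarded.\<close>
      have ne0: "AE s in lborel. s \<noteq> (0::real)" using AE_lborel_singleton[of "0::real"] by simp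
      show "AE s in lborel. ?f n s \<le> ennreal ((B + B)\<^sup>2) * indicator {0..t} s" for n
        using ne0
      proof eventually_elim
        case (elim s)
        show ?case
        proof (cases "0 < s \<and> s \<le> t")
          case True
          have "\<bar>simple_process (Suc n) (p n) (\<xi> n) s \<omega> - H (max 0 s) \<omega>\<bar> \<le> B + B"
            using val[of s n] True B(2)[of "p n (k n s)"] B(2)[of s] p0[of n "k n s"]
              clamp_abs[of n "H (p n (k n s)) \<omega>"] by (simp add: max_def)
          then have "\<bar>simple_process (Suc n) (p n) (\<xi> n) s \<omega> - H (max 0 s) \<omega>\<bar>\<^sup>2 \<le> (B + B)\<^sup>2"
            by (rule power_mono) simp
          then show ?thesis using True by (simp add: ennreal_leI)
        qed (use elim in \<open>auto simp: indicator_def\<close>)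
      qed
      show "AE s in lborel. (\<lambda>n. ?f n s) \<longlonglongrightarrow> 0"
        using ne0
      proof eventually_elim
        case (elim s)
        show ?case
        proof (cases "0 < s \<and> s \<le> t")
          case True
          then have s: "0 < s" "s \<le> t" by auto
          have "(\<lambda>n. p n (k n s)) \<longlonglongrightarrow> s"
            using LIMSEQ_Suc[OF grid_ceiling(4)[OF s]] unfolding k_def p_def .
          then have "(\<lambda>n. H (p n (k n s)) \<omega>) \<longlonglongrightarrow> H s \<omega>"
            using H w p0 s unfolding adapted_continuous_def
            by (intro continuous_on_tendsto_compose[where f="\<lambda>s. H s \<omega>" and s="{0..}"]) auto
          moreover have "\<forall>\<^sub>F n in sequentially. H (p n (k n s)) \<omega> = simple_process (Suc n) (p n) (\<xi> n) s \<omega>"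
          proof -
            obtain n0 :: nat where n0: "B \<le> real n0" using real_arch_simple by blast
            have "H (p n (k n s)) \<omega> = simple_process (Suc n) (p n) (\<xi> n) s \<omega>" if "n \<ge> n0" for n
            proof -
              have "\<bar>H (p n (k n s)) \<omega>\<bar> \<le> B" using B(2)[of "p n (k n s)"] p0 val[OF s] by blast
              also have "B \<le> real n" using n0 that by linarith
              finally show ?thesis using val[OF s, of n] clamp_eq by simp
            qed
            then show ?thesis by (auto simp: eventually_sequentially)
          qed
          ultimately have "(\<lambda>n. simple_process (Suc n) (p n) (\<xi> n) s \<omega>) \<longlonglongrightarrow> H s \<omega>"
            by (rule Lim_transform_eventually)
          then have "(\<lambda>n. (simple_process (Suc n) (p n) (\<xi> n) s \<omega> - H s \<omega>)\<^sup>2) \<longlonglongrightarrow> (H s \<omega> - H s \<omega>)\<^sup>2"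
            by (intro tendsto_intros)
          then have "(\<lambda>n. ennreal ((simple_process (Suc n) (p n) (\<xi> n) s \<omega> - H s \<omega>)\<^sup>2)) \<longlonglongrightarrow> ennreal 0"
            by (intro tendsto_ennrealI) simp
          then show ?thesis using s by (simp add: max_def)
        qed (use elim in \<open>auto simp: indicator_def\<close>)
      qed
    qed measurable
    moreover have "(\<integral>\<^sup>+ s. ?f n s \<partial>lborel) = (\<integral>\<^sup>+ s. ennreal ((simple_process (Suc n) (p n) (\<xi> n) s \<omega> - H s \<omega>)\<^sup>2) * indicator {0..t} s \<partial>lborel)" for n
      by (intro nn_integral_cong) (auto simp: indicator_def)
    ultimately show "(\<lambda>n. \<integral>\<^sup>+ s. ennreal ((simple_process (Suc n) (p n) (\<xi> n) s \<omega> - H s \<omega>)\<^sup>2) * indicator {0..t} s \<partial>lborel) \<longlonglongrightarrow> 0"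
      by simp
  qed
  moreover have "null_in_probability M (\<lambda>n \<omega>. ennreal \<bar>simple_integral W (Suc n) (p n) (\<xi> n) t \<omega> - Y \<omega>\<bar>)"
  proof (rule null_in_probability_conv_prob)
    let ?S = "\<lambda>n. simple_integral W (Suc n) (p n) (\<xi> n) t"
    have S: "?S n \<omega> = (\<Sum>i<Suc n. \<xi> n i \<omega> * (W (p n (Suc i)) \<omega> - W (p n i) \<omega>))" for n \<omega>
      unfolding simple_integral_def by (intro sum.cong refl) (use p_t in \<open>simp add: min_absorb2\<close>)
    have G: "grid_sum H t (Suc n) \<omega> = (\<Sum>i<Suc n. H (p n i) \<omega> * (W (p n (Suc i)) \<omega> - W (p n i) \<omega>))" for n \<omega>
      unfolding grid_sum_def p_def ..
    have Sm: "?S n \<in> borel_measurable M" for n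
      unfolding S[abs_def]
      by (intro borel_measurable_sum borel_measurable_times borel_measurable_diff W_measurable p0
          simple_integrand_measurable[OF simp_int]) simp
    \<comment> \<open>The clamped and the original sums are equal on each path for all large
      \<open>n\<close>.\<close>
    have "conv_prob (\<lambda>n \<omega>. ?S n \<omega> - grid_sum H t (Suc n) \<omega>) (\<lambda>_. 0)"
    proof (rule conv_prob_AE_tendsto[OF _ _ AE_I2])
      fix \<omega> assume w: "\<omega> \<in> space M"
      obtain B where B: "0 < B" "\<And>s. 0 \<le> s \<Longrightarrow> s \<le> t \<Longrightarrow> \<bar>H s \<omega>\<bar> \<le> B"
        using adapted_continuous_bounded[OF H w] by blast
      obtain n0 :: nat where n0: "B \<le> real n0" using real_arch_simple by blast
      have "?S n \<omega> - grid_sum H t (Suc n) \<omega> = 0" if "n \<ge> n0" for n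
      proof -
        have "\<xi> n i \<omega> = H (p n i) \<omega>" if "i < Suc n" for i
        proof -
          have "\<bar>H (p n i) \<omega>\<bar> \<le> B" using B(2)[of "p n i"] p0 p_t[of i n] that by simp
          also have "B \<le> real n" using n0 \<open>n \<ge> n0\<close> by linarith
          finally show ?thesis using clamp_eq by (simp add: \<xi>_def)
        qed
        then show ?thesis unfolding S G by simp
      qed
      then show "(\<lambda>n. ?S n \<omega> - grid_sum H t (Suc n) \<omega>) \<longlonglongrightarrow> 0"
        by (intro tendsto_eventually) (auto simp: eventually_sequentially)
    qed (use Sm in auto)
    moreover have "conv_prob (\<lambda>n. grid_sum H t (Suc n)) Y" using c by (simp add: conv_prob_Suc)
    ultimately have "conv_prob (\<lambda>n \<omega>. 1 * (?S n \<omega> - grid_sum H t (Suc n) \<omega>) + 1 * grid_sum H t (Suc n) \<omega>) (\<lambda>\<omega>. 1 * 0 + 1 * Y \<omega>)"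
      by (rule conv_prob_lincomb)
    then show "conv_prob ?S Y" by simp
  qed
  ultimately show ?thesis
    unfolding has_ito_integral_def
    using adapted_continuous_progressive[OF H] simp_int conv_prob_measurable(2)[OF c]
    by (intro conjI exI[of _ "\<lambda>n. Suc n"] exI[of _ p] exI[of _ \<xi>]) auto
qed

end

section \<open>It\^o's formula for exponentials of Brownian motion\<close>

text \<open>The numerator is the second moment of the one-step error \<open>R\<close> of
  \<open>exp_residual_moments\<close>. Its value at 0 vanishes and its linear coefficient is
  \<open>(2 c + a^2) - 2 c - 2 a^2 + a^2 = 0\<close>, so \<open>n\<close> steps of length
  \<open>t / n\<close> contribute a total that tends to 0.\<close>

lemma exp_residual_rate:
  fixes a c :: real
  shows "((\<lambda>h. (exp (2 * c * h + a\<^sup>2 * h) - exp (2 * c * h) - 2 * a\<^sup>2 * h * exp (c * h) + a\<^sup>2 * h) / h) \<longlongrightarrow> 0) (at 0)"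
proof -
  have "((\<lambda>h. exp (2 * c * h + a\<^sup>2 * h) - exp (2 * c * h) - 2 * a\<^sup>2 * h * exp (c * h) + a\<^sup>2 * h) has_real_derivative 0) (at 0)"
    by (auto intro!: derivative_eq_intros)
  then show ?thesis by (simp add: DERIV_def)
qed

lemma exp_difference_rate:
  fixes c :: real
  shows "((\<lambda>h. (exp (c * h) - 1) / h) \<longlongrightarrow> c) (at 0)"
proof -
  have "((\<lambda>h. exp (c * h)) has_real_derivative c) (at 0)" by (auto intro!: derivative_eq_intros)
  then show ?thesis by (simp add: DERIV_def)
qed

lemma filterlim_step_at_0:
  assumes "t \<noteq> (0::real)" shows "filterlim (\<lambda>n. t / real (Suc n)) (at 0) sequentially"
proof -
  have "(\<lambda>n. t / real (Suc n)) \<longlonglongrightarrow> 0"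
    using LIMSEQ_Suc[OF lim_const_over_n[of t]] by simp
  then show ?thesis using assms by (auto simp: filterlim_at)
qed

context brownian
begin

text \<open>\<open>R\<close> is the growth factor of \<open>exp (a W + b t)\<close> over one step,
  minus its mean \<open>exp (c h)\<close> and minus the noise \<open>a (W t - W s)\<close>. Its
  square expands into the Gaussian moments computed above, so no Taylor remainder has to be
  estimated.\<close>

lemma exp_residual_moments:
  fixes a b s t :: real
  assumes st: "0 \<le> s" "s < t"
  defines "h \<equiv> t - s" and "c \<equiv> b + a\<^sup>2 / 2"
  defines "R \<equiv> \<lambda>\<omega>. exp (a * (W t \<omega> - W s \<omega>) + b * h) - exp (c * h) - a * (W t \<omega> - W s \<omega>)"
  shows "has_bochner_integral M R 0"
    and "has_bochner_integral M (\<lambda>\<omega>. (R \<omega>)\<^sup>2)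
      (exp (2 * c * h + a\<^sup>2 * h) - exp (2 * c * h) - 2 * a\<^sup>2 * h * exp (c * h) + a\<^sup>2 * h)"
proof -
  let ?D = "\<lambda>\<omega>. W t \<omega> - W s \<omega>"
  define B C where "B = exp (b * h)" and "C = exp (c * h)"
  note E1 = increment_exp[OF st, of a, folded h_def]
  note E2 = increment_exp[OF st, of "2 * a", folded h_def]
  note E3 = increment_times_exp[OF st, of a, folded h_def]
  note E4 = increment_mean[OF st]
  note E5 = increment_square[OF st, folded h_def]
  have const: "has_bochner_integral M (\<lambda>\<omega>. r) r" for r :: real
    by (simp add: has_bochner_integral_iff prob_space)
  have C: "B * exp (a\<^sup>2 * h / 2) = C" "B\<^sup>2 * exp ((2 * a)\<^sup>2 * h / 2) = exp (2 * c * h + a\<^sup>2 * h)" "C\<^sup>2 = exp (2 * c * h)"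
    unfolding B_def C_def c_def exp_double[symmetric] exp_add[symmetric] exp_of_nat_mult[symmetric]
    by (simp_all add: power2_eq_square algebra_simps exp_add[symmetric])
  have R: "R \<omega> = B * exp (a * ?D \<omega>) - C - a * ?D \<omega>" for \<omega>
    by (simp add: R_def B_def C_def exp_add)
  have "has_bochner_integral M (\<lambda>\<omega>. B * exp (a * ?D \<omega>) - C - a * ?D \<omega>) (B * exp (a\<^sup>2 * h / 2) - C - a * 0)"
    by (intro has_bochner_integral_diff has_bochner_integral_mult_right E1 const E4)
  then show "has_bochner_integral M R 0" unfolding R[abs_def] C by simp
  have sq: "(R \<omega>)\<^sup>2 = (B\<^sup>2 * exp (2 * a * ?D \<omega>) + C\<^sup>2 + a\<^sup>2 * (?D \<omega>)\<^sup>2) - (2 * B * C) * exp (a * ?D \<omega>)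
      - (2 * a * B) * (?D \<omega> * exp (a * ?D \<omega>)) + (2 * a * C) * ?D \<omega>" for \<omega>
  proof -
    have "exp (2 * a * ?D \<omega>) = (exp (a * ?D \<omega>))\<^sup>2" by (simp add: exp_double[symmetric] mult.assoc)
    then show ?thesis unfolding R by (simp add: power2_eq_square algebra_simps)
  qed
  have val: "exp (2 * c * h + a\<^sup>2 * h) - exp (2 * c * h) - 2 * a\<^sup>2 * h * exp (c * h) + a\<^sup>2 * h =
    (B\<^sup>2 * exp ((2 * a)\<^sup>2 * h / 2) + C\<^sup>2 + a\<^sup>2 * h) - (2 * B * C) * exp (a\<^sup>2 * h / 2)
      - (2 * a * B) * (a * h * exp (a\<^sup>2 * h / 2)) + (2 * a * C) * 0"
  proof -
    have m1: "(2 * B * C) * exp (a\<^sup>2 * h / 2) = 2 * C\<^sup>2"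
      unfolding C(1)[symmetric] by (simp add: power2_eq_square)
    have m2: "(2 * a * B) * (a * h * exp (a\<^sup>2 * h / 2)) = 2 * a\<^sup>2 * h * C"
      unfolding C(1)[symmetric] by (simp add: power2_eq_square)
    show ?thesis unfolding m1 m2 C(2,3) by (simp add: C_def)
  qed
  show "has_bochner_integral M (\<lambda>\<omega>. (R \<omega>)\<^sup>2)
      (exp (2 * c * h + a\<^sup>2 * h) - exp (2 * c * h) - 2 * a\<^sup>2 * h * exp (c * h) + a\<^sup>2 * h)"
    unfolding sq val
    by (intro has_bochner_integral_diff has_bochner_integral_add has_bochner_integral_mult_right E1 E2 E3 E4 E5 const)
qed

lemma exp_process_mean:
  assumes "0 \<le> s"
  shows "has_bochner_integral M (\<lambda>\<omega>. exp (a * W s \<omega> + b * s)) (exp ((b + a\<^sup>2 / 2) * s))"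
proof (cases "s = 0")
  case True
  have "has_bochner_integral M (\<lambda>\<omega>. exp (a * W s \<omega> + b * s)) 1 \<longleftrightarrow> has_bochner_integral M (\<lambda>\<omega>. 1::real) 1"
    by (rule has_bochner_integral_cong) (use True W_0 in auto)
  then show ?thesis using True by (simp add: has_bochner_integral_iff prob_space)
next
  case False
  then have s: "0 < s" using assms by simp
  have "has_bochner_integral M (\<lambda>\<omega>. exp (b * s) * exp (a * (W s \<omega> - W 0 \<omega>))) (exp (b * s) * exp (a\<^sup>2 * (s - 0) / 2))"
    by (intro has_bochner_integral_mult_right increment_exp) (use s in auto)
  moreover have "exp (b * s) * exp (a\<^sup>2 * (s - 0) / 2) = exp ((b + a\<^sup>2 / 2) * s)"
    by (simp add: exp_add[symmetric] algebra_simps)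
  moreover have "has_bochner_integral M (\<lambda>\<omega>. exp (b * s) * exp (a * (W s \<omega> - W 0 \<omega>))) x \<longleftrightarrow>
      has_bochner_integral M (\<lambda>\<omega>. exp (a * W s \<omega> + b * s)) x" for x
    by (rule has_bochner_integral_cong) (use W_0 in \<open>auto simp: exp_add\<close>)
  ultimately show ?thesis by simp
qed

lemma exp_process_adapted: "adapted_continuous M F (\<lambda>s \<omega>. exp (a * W s \<omega> + b * s))"
  unfolding adapted_continuous_def
proof (intro conjI allI impI ballI)
  fix t :: real assume "0 \<le> t"
  then have [measurable]: "W t \<in> borel_measurable (F t)" by (simp add: W_measurable_F)
  show "(\<lambda>\<omega>. exp (a * W t \<omega> + b * t)) \<in> borel_measurable (F t)" by measurable
next
  fix \<omega> assume "\<omega> \<in> space M"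
  then show "continuous_on {0..} (\<lambda>t. exp (a * W t \<omega> + b * t))" by (intro continuous_intros W_continuous)
qed

definition path_integral :: "(real \<Rightarrow> 'a \<Rightarrow> real) \<Rightarrow> real \<Rightarrow> 'a \<Rightarrow> real" where
  "path_integral X t \<omega> = (\<integral>s. indicator {0..t} s * X s \<omega> \<partial>lborel)"

lemma path_integral_riemann:
  assumes X: "adapted_continuous M F X" and t: "0 < t"
  defines "S \<equiv> \<lambda>n \<omega>. \<Sum>i<n. X (grid t n i) \<omega> * (t / real n)"
  shows "\<omega> \<in> space M \<Longrightarrow> integrable lborel (\<lambda>s. indicator {0..t} s * X s \<omega>)"
    and "\<omega> \<in> space M \<Longrightarrow> (\<lambda>n. S n \<omega>) \<longlonglongrightarrow> path_integral X t \<omega>"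
    and "S n \<in> borel_measurable M"
    and "path_integral X t \<in> borel_measurable M"
proof -
  have path: "integrable lborel (\<lambda>s. indicator {0..t} s * X s \<omega>) \<and> (\<lambda>n. S n \<omega>) \<longlonglongrightarrow> path_integral X t \<omega>"
    if w: "\<omega> \<in> space M" for \<omega>
  proof -
    obtain B where B: "0 < B" "\<And>s. 0 \<le> s \<Longrightarrow> s \<le> t \<Longrightarrow> \<bar>X s \<omega>\<bar> \<le> B"
      using adapted_continuous_bounded[OF X w] by blast
    have c: "continuous (at s within {0..s}) (\<lambda>s. X s \<omega>)" if "0 \<le> s" for s
    proof -
      have "continuous (at s within {0..}) (\<lambda>s. X s \<omega>)"
        using X w that unfolding adapted_continuous_def continuous_on_eq_continuous_within by auto
      then show ?thesis by (rule continuous_within_subset) auto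
    qed
    show ?thesis
      unfolding S_def path_integral_def
      by (intro conjI riemann_sum_left_continuous[OF t c B(2)])
  qed
  then show "\<omega> \<in> space M \<Longrightarrow> integrable lborel (\<lambda>s. indicator {0..t} s * X s \<omega>)"
    and "\<omega> \<in> space M \<Longrightarrow> (\<lambda>n. S n \<omega>) \<longlonglongrightarrow> path_integral X t \<omega>"
    by blast+
  show m: "S n \<in> borel_measurable M" for n
    unfolding S_def
    using t by (intro borel_measurable_sum borel_measurable_times adapted_continuous_measurable(2)[OF X]) auto
  show "path_integral X t \<in> borel_measurable M"
    by (rule borel_measurable_LIMSEQ_real[OF conjunct2[OF path] m])
qed

text \<open>It\^o's formula for \<open>exp (a W + b t)\<close>.  Each step contributes an error that is conditionally centred,
  and its variance, computed exactly from the Gaussian moments, is of second order in the step.\<close>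

lemma grid_sum_exp:
  fixes a b t :: real
  assumes t: "0 < t"
  defines "X \<equiv> \<lambda>s \<omega>. exp (a * W s \<omega> + b * s)" and "c \<equiv> b + a\<^sup>2 / 2"
  shows "conv_prob (grid_sum (\<lambda>s \<omega>. a * X s \<omega>) t) (\<lambda>\<omega>. X t \<omega> - 1 - c * path_integral X t \<omega>)"
proof -
  define D where "D n i \<omega> = W (grid t n (Suc i)) \<omega> - W (grid t n i) \<omega>" for n i \<omega>
  define R where "R n i \<omega> = exp (a * D n i \<omega> + b * (t / real n)) - exp (c * (t / real n)) - a * D n i \<omega>" for n i \<omega>
  define V where "V n \<omega> = (\<Sum>i<n. X (grid t n i) \<omega> * R n i \<omega>)" for n \<omega>
  define S where "S = (\<lambda>n \<omega>. \<Sum>i<n. X (grid t n i) \<omega> * (t / real n))"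
  define \<rho> where "\<rho> h = exp (2 * c * h + a\<^sup>2 * h) - exp (2 * c * h) - 2 * a\<^sup>2 * h * exp (c * h) + a\<^sup>2 * h" for h
  have adX: "adapted_continuous M F X" unfolding X_def by (rule exp_process_adapted)
  note XF = adapted_continuous_measurable(1)[OF adX _ order_refl]
  note XM = adapted_continuous_measurable(2)[OF adX]
  have X2: "has_bochner_integral M (\<lambda>\<omega>. (X s \<omega>)\<^sup>2) (exp ((2 * b + (2 * a)\<^sup>2 / 2) * s))" if "0 \<le> s" for s
  proof -
    have "(X s \<omega>)\<^sup>2 = exp ((2 * a) * W s \<omega> + (2 * b) * s)" for \<omega>
      unfolding X_def exp_double[symmetric] by (simp add: algebra_simps)
    then show ?thesis using exp_process_mean[OF that, of "2 * a" "2 * b"] by simp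
  qed
  define K where "K = exp (\<bar>2 * b + (2 * a)\<^sup>2 / 2\<bar> * t)"
  have X2_le: "(\<integral>\<omega>. (X s \<omega>)\<^sup>2 \<partial>M) \<le> K" if "0 \<le> s" "s \<le> t" for s
  proof -
    have "(2 * b + (2 * a)\<^sup>2 / 2) * s \<le> \<bar>2 * b + (2 * a)\<^sup>2 / 2\<bar> * t"
      using that by (intro mult_mono) auto
    then show ?thesis using has_bochner_integral_integral_eq[OF X2[OF that(1)]] by (simp add: K_def)
  qed
  have V2: "integrable M (\<lambda>\<omega>. (V (Suc n) \<omega>)\<^sup>2) \<and> (\<integral>\<omega>. (V (Suc n) \<omega>)\<^sup>2 \<partial>M) \<le> K * (t * (\<rho> (t / real (Suc n)) / (t / real (Suc n))))
    \<and> V (Suc n) \<in> borel_measurable M" for n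
  proof -
    define h where "h = t / real (Suc n)"
    have h: "0 < h" using t by (simp add: h_def)
    have step: "0 \<le> real i * h" "real i * h < real (Suc i) * h" "0 \<le> real (Suc i) * h" "real (Suc i) * h - real i * h = h" for i
      using h by (auto simp: algebra_simps)
    note mom = exp_residual_moments[OF step(1,2), where a=a and b=b, folded c_def, unfolded step(4)]
    have R_eq: "R (Suc n) i = (\<lambda>\<omega>. exp (a * (W (real (Suc i) * h) \<omega> - W (real i * h) \<omega>) + b * h) - exp (c * h)
        - a * (W (real (Suc i) * h) \<omega> - W (real i * h) \<omega>))" for i
      unfolding R_def D_def h_def ..
    have mom': "has_bochner_integral M (R (Suc n) i) 0" "has_bochner_integral M (\<lambda>\<omega>. (R (Suc n) i \<omega>)\<^sup>2) (\<rho> h)" for i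
      unfolding R_eq \<rho>_def by (rule mom)+
    have orth: "V (Suc n) \<in> borel_measurable (F (real (Suc n) * h)) \<and>
      has_bochner_integral M (\<lambda>\<omega>. (V (Suc n) \<omega>)\<^sup>2)
        (\<Sum>i<Suc n. (\<integral>\<omega>. (X (real i * h) \<omega>)\<^sup>2 \<partial>M) * (\<integral>\<omega>. (R (Suc n) i \<omega>)\<^sup>2 \<partial>M))"
      unfolding V_def[abs_def] h_def[symmetric]
    proof (rule orthogonal_sum)
      fix i assume "i < Suc n"
      show "real i * h \<le> real (Suc i) * h" using step(2) by (rule less_imp_le)
      show "X (real i * h) \<in> borel_measurable (F (real i * h))" by (rule XF[OF step(1)])
      have [measurable]: "W (real (Suc i) * h) \<in> borel_measurable (F (real (Suc i) * h))"
        "W (real i * h) \<in> borel_measurable (F (real (Suc i) * h))"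
        by (intro W_measurable_F step order_refl less_imp_le)+
      show "R (Suc n) i \<in> borel_measurable (F (real (Suc i) * h))" unfolding R_eq by measurable
      show "indep_var borel U borel (R (Suc n) i)" if "U \<in> borel_measurable (F (real i * h))" for U
        unfolding R_eq
        using indep_increment[OF step(1,2) that, of "\<lambda>x. exp (a * x + b * h) - exp (c * h) - a * x"] by simp
      show "integrable M (\<lambda>\<omega>. (X (real i * h) \<omega>)\<^sup>2)" using X2[OF step(1)] by (rule integrable.intros)
      show "integrable M (\<lambda>\<omega>. (R (Suc n) i \<omega>)\<^sup>2)" using mom'(2) by (rule integrable.intros)
      show "(\<integral>\<omega>. R (Suc n) i \<omega> \<partial>M) = 0" using mom'(1) by (rule has_bochner_integral_integral_eq)
    qed
    have \<rho>: "(\<integral>\<omega>. (R (Suc n) i \<omega>)\<^sup>2 \<partial>M) = \<rho> h" for i using mom'(2) by (rule has_bochner_integral_integral_eq)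
    have "0 \<le> (\<integral>\<omega>. (R (Suc n) 0 \<omega>)\<^sup>2 \<partial>M)" by (rule integral_nonneg_AE) simp
    then have \<rho>0: "0 \<le> \<rho> h" unfolding \<rho> .
    have "(\<Sum>i<Suc n. (\<integral>\<omega>. (X (real i * h) \<omega>)\<^sup>2 \<partial>M) * (\<integral>\<omega>. (R (Suc n) i \<omega>)\<^sup>2 \<partial>M)) \<le> (\<Sum>i<Suc n. K * \<rho> h)"
      unfolding \<rho>
    proof (intro sum_mono mult_right_mono X2_le \<rho>0 step(1))
      fix i assume "i \<in> {..<Suc n}"
      then show "real i * h \<le> t" unfolding h_def using grid_point(2)[of i "Suc n" t] t by simp
    qed
    also have "\<dots> = K * (real (Suc n) * \<rho> h)" by simp
    \<comment> \<open>The number of steps times the variance of one step, rewritten as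
      \<open>t\<close> times the ratio whose limit is 0.\<close>
    also have "real (Suc n) * \<rho> h = t * (\<rho> h / h)" using t by (simp add: h_def)
    finally show ?thesis
      using orth measurable_F_imp_M unfolding h_def[symmetric] by (auto simp: has_bochner_integral_iff)
  qed
  have c1: "conv_prob (\<lambda>n. V (Suc n)) (\<lambda>_. 0)"
  proof (rule conv_prob_L2)
    show "V (Suc n) \<in> borel_measurable M" for n using V2 by blast
    show "integrable M (\<lambda>\<omega>. (V (Suc n) \<omega> - 0)\<^sup>2)" for n using V2 by simp
    have "(\<lambda>n. K * (t * (\<rho> (t / real (Suc n)) / (t / real (Suc n))))) \<longlonglongrightarrow> K * (t * 0)"
      unfolding \<rho>_def
      by (intro tendsto_mult tendsto_const filterlim_compose[OF exp_residual_rate filterlim_step_at_0]) (use t in simp)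
    then have lim0: "(\<lambda>n. K * (t * (\<rho> (t / real (Suc n)) / (t / real (Suc n))))) \<longlonglongrightarrow> 0" by simp
    show "(\<lambda>n. \<integral>\<omega>. (V (Suc n) \<omega> - 0)\<^sup>2 \<partial>M) \<longlonglongrightarrow> 0"
    proof (rule tendsto_sandwich[OF _ _ tendsto_const lim0])
      show "\<forall>\<^sub>F n in sequentially. 0 \<le> (\<integral>\<omega>. (V (Suc n) \<omega> - 0)\<^sup>2 \<partial>M)"
        by (intro always_eventually allI integral_nonneg_AE) auto
      show "\<forall>\<^sub>F n in sequentially. (\<integral>\<omega>. (V (Suc n) \<omega> - 0)\<^sup>2 \<partial>M) \<le> K * (t * (\<rho> (t / real (Suc n)) / (t / real (Suc n))))"
        using V2 by (intro always_eventually allI) simp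
    qed
  qed simp
  define J where "J = path_integral X t"
  have S_lim: "(\<lambda>n. S n \<omega>) \<longlonglongrightarrow> J \<omega>" if "\<omega> \<in> space M" for \<omega>
    using path_integral_riemann(2)[OF adX t that] unfolding S_def J_def .
  have Sm: "S n \<in> borel_measurable M" for n using path_integral_riemann(3)[OF adX t] unfolding S_def .
  have Jm: "J \<in> borel_measurable M" using path_integral_riemann(4)[OF adX t] unfolding J_def .
  have c2: "conv_prob (\<lambda>n \<omega>. X t \<omega> - 1 - (exp (c * (t / real (Suc n))) - 1) / (t / real (Suc n)) * S (Suc n) \<omega>) (\<lambda>\<omega>. X t \<omega> - 1 - c * J \<omega>)"
  proof (rule conv_prob_AE_tendsto[OF _ _ AE_I2])
    have [measurable]: "X t \<in> borel_measurable M" using XM t by simp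
    note [measurable] = Sm Jm
    show "(\<lambda>\<omega>. X t \<omega> - 1 - (exp (c * (t / real (Suc n))) - 1) / (t / real (Suc n)) * S (Suc n) \<omega>) \<in> borel_measurable M" for n
      by measurable
    show "(\<lambda>\<omega>. X t \<omega> - 1 - c * J \<omega>) \<in> borel_measurable M" by measurable
    show "(\<lambda>n. X t \<omega> - 1 - (exp (c * (t / real (Suc n))) - 1) / (t / real (Suc n)) * S (Suc n) \<omega>) \<longlonglongrightarrow> X t \<omega> - 1 - c * J \<omega>"
      if "\<omega> \<in> space M" for \<omega>
      by (intro tendsto_diff tendsto_mult tendsto_const filterlim_compose[OF exp_difference_rate filterlim_step_at_0]
          LIMSEQ_Suc[OF S_lim[OF that]]) (use t in simp)
  qed
  \<comment> \<open>Telescope \<open>X t - 1\<close> over the grid. Each increment is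
    \<open>X\<close> at the left endpoint times the sum of the centred error \<open>R\<close>, the
    mean growth \<open>exp (c h) - 1\<close>, and the noise \<open>a D\<close>. The mean growth
    divided by \<open>h\<close> tends to \<open>c\<close>, which produces the time integral.\<close>
  have decomp: "1 * (X t \<omega> - 1 - (exp (c * (t / real (Suc n))) - 1) / (t / real (Suc n)) * S (Suc n) \<omega>) + (-1) * V (Suc n) \<omega> =
      grid_sum (\<lambda>s \<omega>. a * X s \<omega>) t (Suc n) \<omega>" if w: "\<omega> \<in> space M" for n \<omega>
  proof -
    define h where "h = t / real (Suc n)"
    have h: "0 < h" using t by (simp add: h_def)
    have nh: "real (Suc n) * h = t" using t by (simp add: h_def)
    have Xs: "X (real (Suc i) * h) \<omega> = X (real i * h) \<omega> * exp (a * D (Suc n) i \<omega> + b * h)" for i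
      unfolding X_def D_def h_def[symmetric] exp_add[symmetric] by (simp add: algebra_simps)
    have "X t \<omega> - 1 = X (real (Suc n) * h) \<omega> - X (real 0 * h) \<omega>" unfolding nh by (simp add: X_def W_0[OF w])
    also have "\<dots> = (\<Sum>i<Suc n. X (real (Suc i) * h) \<omega> - X (real i * h) \<omega>)"
      by (rule sum_lessThan_telescope[symmetric])
    also have "\<dots> = (\<Sum>i<Suc n. X (real i * h) \<omega> * R (Suc n) i \<omega> + (exp (c * h) - 1) / h * (X (real i * h) \<omega> * h)
        + a * X (real i * h) \<omega> * D (Suc n) i \<omega>)"
      unfolding Xs R_def h_def[symmetric] using h by (intro sum.cong refl) (simp add: field_simps)
    also have "\<dots> = V (Suc n) \<omega> + (exp (c * h) - 1) / h * S (Suc n) \<omega> + grid_sum (\<lambda>s \<omega>. a * X s \<omega>) t (Suc n) \<omega>"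
      unfolding sum.distrib sum_distrib_left[symmetric] V_def S_def grid_sum_def D_def h_def ..
    finally show ?thesis unfolding h_def[symmetric] by simp
  qed
  have Gm: "grid_sum (\<lambda>s \<omega>. a * X s \<omega>) t n \<in> borel_measurable M" for n
    using t XM by (intro grid_sum_measurable) auto
  have "conv_prob (\<lambda>n. grid_sum (\<lambda>s \<omega>. a * X s \<omega>) t (Suc n)) (\<lambda>\<omega>. X t \<omega> - 1 - c * J \<omega>)"
  proof (rule conv_prob_cong[OF conv_prob_lincomb[OF c2 c1, of 1 "-1"] Gm])
    show "(\<lambda>\<omega>. X t \<omega> - 1 - c * J \<omega>) \<in> borel_measurable M" using conv_prob_measurable(2)[OF c2] .
  qed (use decomp in auto)
  then show ?thesis using conv_prob_Suc[of "grid_sum (\<lambda>s \<omega>. a * X s \<omega>) t", OF Gm] by (simp add: J_def)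
qed

end

section \<open>Geometric Brownian motion\<close>

context brownian
begin

lemma adapted_continuous_lincomb:
  assumes X: "adapted_continuous M F X" and Y: "adapted_continuous M F Y"
  shows "adapted_continuous M F (\<lambda>t \<omega>. a * X t \<omega> + b * Y t \<omega>)"
  unfolding adapted_continuous_def
proof (intro conjI allI impI ballI)
  fix t :: real assume "0 \<le> t"
  then have [measurable]: "X t \<in> borel_measurable (F t)" "Y t \<in> borel_measurable (F t)"
    using X Y by (auto simp: adapted_continuous_def)
  show "(\<lambda>\<omega>. a * X t \<omega> + b * Y t \<omega>) \<in> borel_measurable (F t)" by measurable
next
  fix \<omega> assume "\<omega> \<in> space M"
  then show "continuous_on {0..} (\<lambda>t. a * X t \<omega> + b * Y t \<omega>)"
    using X Y unfolding adapted_continuous_def by (intro continuous_intros) auto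
qed

lemma grid_sum_lincomb:
  "grid_sum (\<lambda>s \<omega>. a * X s \<omega> + b * Y s \<omega>) t n \<omega> = a * grid_sum X t n \<omega> + b * grid_sum Y t n \<omega>"
  unfolding grid_sum_def sum_distrib_left sum.distrib[symmetric]
  by (intro sum.cong refl) (simp only: distrib_right mult.assoc)

text \<open>Positive rational times are countable, so one null set serves them all, and continuity
  extends equality to every time. Time 0 is reached as a limit from the right, which is why equality
  is assumed at positive times only.\<close>

lemma AE_all_times_eq:
  fixes X Y :: "real \<Rightarrow> 'a \<Rightarrow> real"
  assumes X: "\<And>\<omega>. \<omega> \<in> space M \<Longrightarrow> continuous_on {0..} (\<lambda>t. X t \<omega>)"
    and Y: "\<And>\<omega>. \<omega> \<in> space M \<Longrightarrow> continuous_on {0..} (\<lambda>t. Y t \<omega>)"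
    and eq: "\<And>t. 0 < t \<Longrightarrow> AE \<omega> in M. X t \<omega> = Y t \<omega>"
  shows "AE \<omega> in M. \<forall>t\<ge>0. X t \<omega> = Y t \<omega>"
proof -
  have "AE \<omega> in M. \<forall>i n. X (real (Suc i) / real (Suc n)) \<omega> = Y (real (Suc i) / real (Suc n)) \<omega>"
    unfolding AE_all_countable by (intro allI eq) simp
  then show ?thesis
    using AE_space
  proof eventually_elim
    case (elim \<omega>)
    show ?case
    proof (intro allI impI)
      fix t :: real assume t: "0 \<le> t"
      define k where "k n = nat \<lfloor>t / (1 / real (Suc n))\<rfloor>" for n
      \<comment> \<open>Adding one step to the point below \<open>t\<close> makes the numerator
        \<open>Suc (k n)\<close>, so that the approximating time is positive also for
        \<open>t = 0\<close>.\<close>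
      have "(\<lambda>n. grid 1 (Suc n) (k n) + 1 / real (Suc n)) \<longlonglongrightarrow> t + 0"
        using LIMSEQ_Suc[OF grid_floor(4)[OF zero_less_one t]] LIMSEQ_Suc[OF lim_const_over_n[of 1]]
        unfolding k_def by (intro tendsto_add) auto
      then have lim: "(\<lambda>n. real (Suc (k n)) / real (Suc n)) \<longlonglongrightarrow> t"
        by (simp add: add_divide_distrib add.commute)
      have "(\<lambda>n. X (real (Suc (k n)) / real (Suc n)) \<omega>) \<longlonglongrightarrow> X t \<omega>"
        by (rule continuous_on_tendsto_compose[OF X[OF elim(2)] lim]) (use t in auto)
      moreover have "(\<lambda>n. Y (real (Suc (k n)) / real (Suc n)) \<omega>) \<longlonglongrightarrow> Y t \<omega>"
        by (rule continuous_on_tendsto_compose[OF Y[OF elim(2)] lim]) (use t in auto)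
      ultimately show "X t \<omega> = Y t \<omega>" using elim(1) LIMSEQ_unique by simp
    qed
  qed
qed

text \<open>Gronwall's argument for \<open>dD = \<mu> D dt + \<sigma> D dW\<close>: killing \<open>D\<close> once \<open>|D|\<close> has exceeded \<open>K\<close> gives
  square integrability without any stopped integral, because left-point sums of \<open>D\<close> and of the killed
  process agree on paths that stay below \<open>K\<close>.\<close>

context
  fixes D :: "real \<Rightarrow> 'a \<Rightarrow> real" and \<mu> \<sigma> K :: real
  assumes D: "adapted_continuous M F D" and D0: "\<And>\<omega>. \<omega> \<in> space M \<Longrightarrow> D 0 \<omega> = 0"
    and sde: "\<And>t. 0 < t \<Longrightarrow> conv_prob (grid_sum (\<lambda>s \<omega>. \<sigma> * D s \<omega>) t)
      (\<lambda>\<omega>. D t \<omega> - \<mu> * path_integral D t \<omega>)"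
    and K: "0 \<le> K"
begin

definition killed :: "real \<Rightarrow> 'a \<Rightarrow> real" where
  "killed s \<omega> = (if \<forall>r. 0 \<le> r \<longrightarrow> r \<le> s \<longrightarrow> \<bar>D r \<omega>\<bar> \<le> K then D s \<omega> else 0)"

lemma killed_bound: "0 \<le> s \<Longrightarrow> \<bar>killed s \<omega>\<bar> \<le> K"
  using K by (simp add: killed_def)

lemma killed_square_bound: "0 \<le> s \<Longrightarrow> (killed s \<omega>)\<^sup>2 \<le> K\<^sup>2"
  using power_mono[OF killed_bound, of s \<omega> 2] by simp

text \<open>By continuity the bound on all of \<open>[0, s]\<close> is equivalent to the bound at
  the points of all uniform grids of \<open>[0, s]\<close>. This countable condition is visible to
  \<open>F s\<close>.\<close>

lemma killed_measurable: assumes s: "0 \<le> s" shows "killed s \<in> borel_measurable (F s)"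
proof -
  have iff: "(\<forall>r. 0 \<le> r \<longrightarrow> r \<le> s \<longrightarrow> \<bar>D r \<omega>\<bar> \<le> K) \<longleftrightarrow> (\<forall>n. \<forall>k\<in>{..n}. \<bar>D (grid s n k) \<omega>\<bar> \<le> K)"
    if w: "\<omega> \<in> space M" for \<omega>
  proof (intro iffI allI impI ballI)
    fix n k assume "\<forall>r. 0 \<le> r \<longrightarrow> r \<le> s \<longrightarrow> \<bar>D r \<omega>\<bar> \<le> K" "k \<in> {..n::nat}"
    then show "\<bar>D (grid s n k) \<omega>\<bar> \<le> K" using grid_point[of k n s] s by auto
  next
    fix r assume grid: "\<forall>n. \<forall>k\<in>{..n}. \<bar>D (grid s n k) \<omega>\<bar> \<le> K" and r: "0 \<le> r" "r \<le> s"
    show "\<bar>D r \<omega>\<bar> \<le> K"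
    proof (cases "r = s")
      case True
      have "\<bar>D (grid s (Suc 0) (Suc 0)) \<omega>\<bar> \<le> K" by (rule grid[rule_format]) simp
      then show ?thesis using True by simp
    next
      case False
      then have rs: "r < s" "0 < s" using r by auto
      define k where "k n = nat \<lfloor>r / (s / real n)\<rfloor>" for n
      have "(\<lambda>n. D (grid s n (k n)) \<omega>) \<longlonglongrightarrow> D r \<omega>"
        using D w r s grid_floor(4)[OF rs(2) r(1)] unfolding adapted_continuous_def k_def
        by (intro continuous_on_tendsto_compose[where f="\<lambda>s. D s \<omega>" and s="{0..}"]) auto
      then have "(\<lambda>n. \<bar>D (grid s n (k n)) \<omega>\<bar>) \<longlonglongrightarrow> \<bar>D r \<omega>\<bar>" by (intro tendsto_intros)
      moreover have "\<forall>\<^sub>F n in sequentially. \<bar>D (grid s n (k n)) \<omega>\<bar> \<le> K"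
        using eventually_gt_at_top[of 0]
      proof eventually_elim
        case (elim n)
        have "k n < n" unfolding k_def by (rule grid_floor(3)[OF rs(2) r(1) elim rs(1)])
        then show ?case using grid by simp
      qed
      ultimately show ?thesis using tendsto_upperbound by (metis trivial_limit_sequentially)
    qed
  qed
  have [measurable]: "D (grid s n k) \<in> borel_measurable (F s)" if "k \<in> {..n}" for k n
    using grid_point[of k n s] that s by (intro adapted_continuous_measurable(1)[OF D]) auto
  have [measurable]: "D s \<in> borel_measurable (F s)" using s by (intro adapted_continuous_measurable(1)[OF D]) auto
  have "(\<lambda>\<omega>. if \<forall>n. \<forall>k\<in>{..n}. \<bar>D (grid s n k) \<omega>\<bar> \<le> K then D s \<omega> else 0) \<in> borel_measurable (F s)"
    by measurable
  moreover have "killed s \<in> borel_measurable (F s) \<longleftrightarrow>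
    (\<lambda>\<omega>. if \<forall>n. \<forall>k\<in>{..n}. \<bar>D (grid s n k) \<omega>\<bar> \<le> K then D s \<omega> else 0) \<in> borel_measurable (F s)"
    by (rule measurable_cong) (simp add: killed_def iff)
  ultimately show ?thesis by blast
qed

lemma killed_integrable: assumes "0 \<le> s" shows "integrable M (\<lambda>\<omega>. (killed s \<omega>)\<^sup>2)"
  by (rule integrable_const_bound[where B="K\<^sup>2"])
     (use killed_square_bound[OF assms] measurable_F_imp_M[OF killed_measurable[OF assms]] in auto)

text \<open>\<open>V n\<close> is one discretized right-hand side of the equation, with the killed
  process as integrand. The constant comes from \<open>(x + y)^2 \<le> 2 x^2 + 2 y^2\<close>, with
  Cauchy-Schwarz for the drift, which costs a factor \<open>t\<close>, and the isometry for the
  noise.\<close>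

lemma killed_step_sum:
  assumes t: "0 < t"
  defines "V \<equiv> \<lambda>n \<omega>. \<mu> * (\<Sum>i<n. killed (grid t n i) \<omega> * (t / real n)) + grid_sum (\<lambda>s \<omega>. \<sigma> * killed s \<omega>) t n \<omega>"
  shows "V n \<in> borel_measurable M" "integrable M (\<lambda>\<omega>. (V n \<omega>)\<^sup>2)"
    "(\<integral>\<omega>. (V n \<omega>)\<^sup>2 \<partial>M) \<le> (2 * \<mu>\<^sup>2 * t + 2 * \<sigma>\<^sup>2) * (\<Sum>i<n. (\<integral>\<omega>. (killed (grid t n i) \<omega>)\<^sup>2 \<partial>M) * (t / real n))"
proof -
  let ?g = "\<lambda>s. \<integral>\<omega>. (killed s \<omega>)\<^sup>2 \<partial>M"
  define A where "A \<omega> = (\<Sum>i<n. killed (grid t n i) \<omega> * (t / real n))" for \<omega>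
  define B where "B \<omega> = grid_sum (\<lambda>s \<omega>. \<sigma> * killed s \<omega>) t n \<omega>" for \<omega>
  define Q where "Q \<omega> = t * (\<Sum>i<n. (killed (grid t n i) \<omega>)\<^sup>2 * (t / real n))" for \<omega>
  have V: "V n \<omega> = \<mu> * A \<omega> + B \<omega>" for \<omega> by (simp add: V_def A_def B_def)
  have pos: "0 \<le> grid t n i" for i using t by simp
  have km: "killed (grid t n i) \<in> borel_measurable M" for i
    by (rule measurable_F_imp_M[OF killed_measurable[OF pos]])
  have [measurable]: "A \<in> borel_measurable M" unfolding A_def using km by (intro borel_measurable_sum borel_measurable_times) auto
  have [measurable]: "B \<in> borel_measurable M" unfolding B_def
    using t by (intro grid_sum_measurable borel_measurable_times borel_measurable_const
        measurable_F_imp_M[OF killed_measurable]) auto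
  show Vm: "V n \<in> borel_measurable M" unfolding V[abs_def] by measurable
  have Qi: "integrable M Q" unfolding Q_def
    by (intro integrable_mult_right Bochner_Integration.integrable_sum integrable_mult_left killed_integrable pos)
  have Qint: "(\<integral>\<omega>. Q \<omega> \<partial>M) = t * (\<Sum>i<n. ?g (grid t n i) * (t / real n))"
  proof -
    have "(\<integral>\<omega>. (\<Sum>i<n. (killed (grid t n i) \<omega>)\<^sup>2 * (t / real n)) \<partial>M) =
      (\<Sum>i<n. \<integral>\<omega>. (killed (grid t n i) \<omega>)\<^sup>2 * (t / real n) \<partial>M)"
      by (rule Bochner_Integration.integral_sum) (intro integrable_mult_left killed_integrable pos)
    then show ?thesis
      unfolding Q_def integral_mult_right_zero by (simp only: integral_mult_left_zero)
  qed
  have AQ: "(A \<omega>)\<^sup>2 \<le> Q \<omega>" for \<omega>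
  proof -
    have "(A \<omega>)\<^sup>2 \<le> (\<Sum>i<n. (killed (grid t n i) \<omega> * (t / real n))\<^sup>2) * real n"
      unfolding A_def using sum_squared_le_sum_of_squares[of "\<lambda>i. killed (grid t n i) \<omega> * (t / real n)" "{..<n}"] by simp
    also have "\<dots> = Q \<omega>"
      unfolding Q_def sum_distrib_right sum_distrib_left
      by (intro sum.cong refl) (auto simp: power2_eq_square field_simps)
    finally show ?thesis .
  qed
  have B2: "has_bochner_integral M (\<lambda>\<omega>. (B \<omega>)\<^sup>2) (\<Sum>i<n. (\<integral>\<omega>. (\<sigma> * killed (grid t n i) \<omega>)\<^sup>2 \<partial>M) * (t / real n))"
    unfolding B_def
  proof (rule grid_sum_square[OF t])
    fix s :: real assume s: "0 \<le> s" "s \<le> t"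
    show "(\<lambda>\<omega>. \<sigma> * killed s \<omega>) \<in> borel_measurable (F s)" using killed_measurable[OF s(1)] by simp
    show "integrable M (\<lambda>\<omega>. (\<sigma> * killed s \<omega>)\<^sup>2)" using killed_integrable[OF s(1)] by (simp add: power_mult_distrib)
  qed
  have B2': "integrable M (\<lambda>\<omega>. (B \<omega>)\<^sup>2)"
    "(\<integral>\<omega>. (B \<omega>)\<^sup>2 \<partial>M) = \<sigma>\<^sup>2 * (\<Sum>i<n. ?g (grid t n i) * (t / real n))"
    using B2 by (auto simp: has_bochner_integral_iff power_mult_distrib sum_distrib_left mult.assoc)
  have bound: "(V n \<omega>)\<^sup>2 \<le> 2 * \<mu>\<^sup>2 * Q \<omega> + 2 * (B \<omega>)\<^sup>2" for \<omega>
  proof -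
    have "(\<mu> * A \<omega> + B \<omega>)\<^sup>2 \<le> 2 * (\<mu> * A \<omega>)\<^sup>2 + 2 * (B \<omega>)\<^sup>2"
      using zero_le_power2[of "\<mu> * A \<omega> - B \<omega>"] by (simp add: power2_eq_square algebra_simps)
    also have "(\<mu> * A \<omega>)\<^sup>2 \<le> \<mu>\<^sup>2 * Q \<omega>" unfolding power_mult_distrib by (intro mult_left_mono AQ) simp
    finally show ?thesis by (simp add: V)
  qed
  have int: "integrable M (\<lambda>\<omega>. 2 * \<mu>\<^sup>2 * Q \<omega> + 2 * (B \<omega>)\<^sup>2)"
    by (intro Bochner_Integration.integrable_add integrable_mult_right Qi B2')
  show Vi: "integrable M (\<lambda>\<omega>. (V n \<omega>)\<^sup>2)"
    by (rule Bochner_Integration.integrable_bound[OF int])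
       (use Vm bound in \<open>auto intro: order_trans[OF _ abs_ge_self]\<close>)
  have "(\<integral>\<omega>. (V n \<omega>)\<^sup>2 \<partial>M) \<le> (\<integral>\<omega>. 2 * \<mu>\<^sup>2 * Q \<omega> + 2 * (B \<omega>)\<^sup>2 \<partial>M)"
    by (intro integral_mono Vi int bound)
  also have "\<dots> = 2 * \<mu>\<^sup>2 * (\<integral>\<omega>. Q \<omega> \<partial>M) + 2 * (\<integral>\<omega>. (B \<omega>)\<^sup>2 \<partial>M)"
    using Qi B2' by simp
  finally show "(\<integral>\<omega>. (V n \<omega>)\<^sup>2 \<partial>M) \<le> (2 * \<mu>\<^sup>2 * t + 2 * \<sigma>\<^sup>2) * (\<Sum>i<n. ?g (grid t n i) * (t / real n))"
    unfolding Qint B2'(2) by (simp add: algebra_simps)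
qed

text \<open>Along a subsequence the sums of \<open>D\<close> converge almost surely. On paths that
  stay below \<open>K\<close> they equal the sums of the killed process; on the others the killed
  process is 0 at \<open>t\<close>, so Fatou gives the bound in all cases. A continuous majorant
  \<open>\<phi>\<close> is used because the mean square of the killed process is not known to be
  continuous, and Riemann sums have to converge.\<close>

lemma killed_square_mean_le:
  assumes t: "0 < t" and phi: "continuous_on UNIV \<phi>"
    and le: "\<And>s. 0 \<le> s \<Longrightarrow> s \<le> t \<Longrightarrow> (\<integral>\<omega>. (killed s \<omega>)\<^sup>2 \<partial>M) \<le> \<phi> s"
  shows "(\<integral>\<omega>. (killed t \<omega>)\<^sup>2 \<partial>M) \<le> (2 * \<mu>\<^sup>2 * t + 2 * \<sigma>\<^sup>2) * (\<integral>s. indicator {0..t} s * \<phi> s \<partial>lborel)"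
proof -
  let ?C = "2 * \<mu>\<^sup>2 * t + 2 * \<sigma>\<^sup>2"
  define V where "V n \<omega> = \<mu> * (\<Sum>i<n. killed (grid t n i) \<omega> * (t / real n)) + grid_sum (\<lambda>s \<omega>. \<sigma> * killed s \<omega>) t n \<omega>" for n \<omega>
  define U where "U n \<omega> = \<mu> * (\<Sum>i<n. D (grid t n i) \<omega> * (t / real n)) + 1 * grid_sum (\<lambda>s \<omega>. \<sigma> * D s \<omega>) t n \<omega>" for n \<omega>
  note V = killed_step_sum[OF t, folded V_def]
  have C0: "0 \<le> ?C" using t by simp
  define I where "I = (\<integral>s. indicator {0..t} s * \<phi> s \<partial>lborel)"
  have "compact (\<phi> ` {0..t})" by (rule compact_continuous_image[OF continuous_on_subset[OF phi]]) auto
  then have "bounded (\<phi> ` {0..t})" by (rule compact_imp_bounded)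
  then obtain B where "\<forall>x\<in>\<phi> ` {0..t}. norm x \<le> B" unfolding bounded_iff by blast
  then have B: "\<bar>\<phi> s\<bar> \<le> B" if "0 \<le> s" "s \<le> t" for s using that by auto
  have sum_lim: "(\<lambda>n. \<Sum>i<n. \<phi> (grid t n i) * (t / real n)) \<longlonglongrightarrow> I"
    unfolding I_def
    by (rule riemann_sum_left_continuous(2)[OF t _ B])
       (use phi in \<open>auto simp: continuous_on_eq_continuous_within intro: continuous_within_subset\<close>)
  have V_le: "(\<integral>\<omega>. (V n \<omega>)\<^sup>2 \<partial>M) \<le> ?C * (\<Sum>i<n. \<phi> (grid t n i) * (t / real n))" for n
  proof -
    have "(\<Sum>i<n. (\<integral>\<omega>. (killed (grid t n i) \<omega>)\<^sup>2 \<partial>M) * (t / real n)) \<le> (\<Sum>i<n. \<phi> (grid t n i) * (t / real n))"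
    proof (intro sum_mono mult_right_mono le)
      fix i assume "i \<in> {..<n}"
      then show "0 \<le> grid t n i" "grid t n i \<le> t" using grid_point[of i n t] t by auto
    qed (use t in simp)
    then show ?thesis using V(3)[of n] mult_left_mono[OF _ C0] by (meson order_trans)
  qed
  have cU: "conv_prob U (\<lambda>\<omega>. \<mu> * path_integral D t \<omega> + 1 * (D t \<omega> - \<mu> * path_integral D t \<omega>))"
    unfolding U_def[abs_def]
    by (rule conv_prob_lincomb[OF conv_prob_AE_tendsto[OF path_integral_riemann(3,4)[OF D t] AE_I2[OF path_integral_riemann(2)[OF D t]]] sde[OF t]])
  from conv_prob_AE_subseq[OF cU] obtain r :: "nat \<Rightarrow> nat" where r: "strict_mono r" "AE \<omega> in M. (\<lambda>n. U (r n) \<omega>) \<longlonglongrightarrow> D t \<omega>"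
    by auto
  have VU: "V n \<omega> = U n \<omega>" if good: "\<forall>s. 0 \<le> s \<longrightarrow> s \<le> t \<longrightarrow> \<bar>D s \<omega>\<bar> \<le> K" for n \<omega>
  proof -
    have "killed (grid t n i) \<omega> = D (grid t n i) \<omega>" if "i < n" for i
    proof -
      have "grid t n i \<le> t" using grid_point(2)[of i n t] that t by simp
      then show ?thesis using good unfolding killed_def by (meson order_trans)
    qed
    then show ?thesis unfolding V_def U_def grid_sum_def by simp
  qed
  have "(\<integral>\<^sup>+\<omega>. ennreal ((killed t \<omega>)\<^sup>2) \<partial>M) \<le> (\<integral>\<^sup>+\<omega>. liminf (\<lambda>n. ennreal ((V (r n) \<omega>)\<^sup>2)) \<partial>M)"
  proof (rule nn_integral_mono_AE)
    show "AE \<omega> in M. ennreal ((killed t \<omega>)\<^sup>2) \<le> liminf (\<lambda>n. ennreal ((V (r n) \<omega>)\<^sup>2))"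
      using r(2)
    proof eventually_elim
      case (elim \<omega>)
      show ?case
      proof (cases "\<forall>s. 0 \<le> s \<longrightarrow> s \<le> t \<longrightarrow> \<bar>D s \<omega>\<bar> \<le> K")
        case True
        have "(\<lambda>n. ennreal ((V (r n) \<omega>)\<^sup>2)) \<longlonglongrightarrow> ennreal ((D t \<omega>)\<^sup>2)"
          unfolding VU[OF True] by (intro tendsto_ennrealI tendsto_power elim)
        then have "liminf (\<lambda>n. ennreal ((V (r n) \<omega>)\<^sup>2)) = ennreal ((D t \<omega>)\<^sup>2)"
          by (rule lim_imp_Liminf[OF trivial_limit_sequentially])
        then show ?thesis using True by (simp add: killed_def)
      next
        case False
        show ?thesis unfolding killed_def if_not_P[OF False] by simp
      qed
    qed
  qed
  also have "\<dots> \<le> liminf (\<lambda>n. \<integral>\<^sup>+\<omega>. ennreal ((V (r n) \<omega>)\<^sup>2) \<partial>M)"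
    by (rule nn_integral_liminf) (use V(1) in measurable)
  also have "\<dots> \<le> liminf (\<lambda>n. ennreal (?C * (\<Sum>i<r n. \<phi> (grid t (r n) i) * (t / real (r n)))))"
  proof (intro Liminf_mono always_eventually allI)
    fix n
    have "(\<integral>\<^sup>+\<omega>. ennreal ((V (r n) \<omega>)\<^sup>2) \<partial>M) = ennreal (\<integral>\<omega>. (V (r n) \<omega>)\<^sup>2 \<partial>M)"
      by (rule nn_integral_eq_integral) (use V(2) in auto)
    then show "(\<integral>\<^sup>+\<omega>. ennreal ((V (r n) \<omega>)\<^sup>2) \<partial>M) \<le> ennreal (?C * (\<Sum>i<r n. \<phi> (grid t (r n) i) * (t / real (r n))))"
      using V_le ennreal_leI by metis
  qed
  also have "\<dots> = ennreal (?C * I)"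
  proof (rule lim_imp_Liminf[OF trivial_limit_sequentially])
    have "(\<lambda>n. \<Sum>i<r n. \<phi> (grid t (r n) i) * (t / real (r n))) \<longlonglongrightarrow> I"
      using LIMSEQ_subseq_LIMSEQ[OF sum_lim r(1)] by (simp add: comp_def)
    then show "(\<lambda>n. ennreal (?C * (\<Sum>i<r n. \<phi> (grid t (r n) i) * (t / real (r n))))) \<longlonglongrightarrow> ennreal (?C * I)"
      by (intro tendsto_ennrealI tendsto_mult tendsto_const)
  qed
  finally have fin: "(\<integral>\<^sup>+\<omega>. ennreal ((killed t \<omega>)\<^sup>2) \<partial>M) \<le> ennreal (?C * I)" .
  \<comment> \<open>\<open>ennreal\<close> sends negative numbers to 0, so the sign must be known
    before the inequality is read in the reals.\<close>
  have "0 \<le> ?C * I"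
  proof (rule LIMSEQ_le_const[OF tendsto_mult[OF tendsto_const[of ?C] sum_lim]])
    have "0 \<le> (\<integral>\<omega>. (V n \<omega>)\<^sup>2 \<partial>M)" for n by (rule integral_nonneg_AE) simp
    then show "\<exists>N. \<forall>n\<ge>N. 0 \<le> ?C * (\<Sum>i<n. \<phi> (grid t n i) * (t / real n))"
      using V_le order_trans by blast
  qed
  moreover have "(\<integral>\<^sup>+\<omega>. ennreal ((killed t \<omega>)\<^sup>2) \<partial>M) = ennreal (\<integral>\<omega>. (killed t \<omega>)\<^sup>2 \<partial>M)"
    by (rule nn_integral_eq_integral) (use killed_integrable t in auto)
  ultimately show ?thesis using fin by (simp add: I_def ennreal_le_iff)
qed

text \<open>Gronwall by iteration: the bound for \<open>m\<close> serves as the majorant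
  \<open>\<phi>\<close>, and integrating \<open>s ^ m\<close> supplies the next factor of the
  factorial. The constant is taken at \<open>T\<close> so that it stays the same for all
  \<open>s\<close> and \<open>m\<close>.\<close>

lemma killed_square_mean_iterate:
  assumes s: "0 \<le> s" "s \<le> T"
  shows "(\<integral>\<omega>. (killed s \<omega>)\<^sup>2 \<partial>M) \<le> K\<^sup>2 * (2 * \<mu>\<^sup>2 * T + 2 * \<sigma>\<^sup>2) ^ m / fact m * s ^ m"
  using s
proof (induction m arbitrary: s)
  case 0
  have "(\<integral>\<omega>. (killed s \<omega>)\<^sup>2 \<partial>M) \<le> (\<integral>\<omega>. K\<^sup>2 \<partial>M)"
    using 0 by (intro integral_mono killed_integrable killed_square_bound) auto
  then show ?case by (simp add: prob_space)
next
  case (Suc m)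
  let ?C = "2 * \<mu>\<^sup>2 * T + 2 * \<sigma>\<^sup>2"
  show ?case
  proof (cases "s = 0")
    case True
    have "(\<integral>\<omega>. (killed s \<omega>)\<^sup>2 \<partial>M) = (\<integral>\<omega>. 0 \<partial>M)"
      by (rule Bochner_Integration.integral_cong) (use True D0 in \<open>auto simp: killed_def\<close>)
    then show ?thesis using True by simp
  next
    case False
    then have s0: "0 < s" using Suc by simp
    define c where "c = K\<^sup>2 * ?C ^ m / fact m"
    have C0: "0 \<le> ?C" using Suc by simp
    then have c0: "0 \<le> c" by (simp add: c_def)
    have I: "(\<integral>x. indicator {0..s} x * (c * x ^ m) \<partial>lborel) = c * (s ^ Suc m / real (Suc m))"
    proof -
      have "(\<integral>x. indicator {0..s} x * (c * x ^ m) \<partial>lborel) = (\<integral>x. c * (x ^ m * indicator {0..s} x) \<partial>lborel)"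
        by (simp add: mult_ac)
      also have "\<dots> = c * ((s ^ Suc m - 0 ^ Suc m) / real (Suc m))"
        using integral_power[of 0 s m] s0 by simp
      finally show ?thesis by simp
    qed
    have "(\<integral>\<omega>. (killed s \<omega>)\<^sup>2 \<partial>M) \<le> (2 * \<mu>\<^sup>2 * s + 2 * \<sigma>\<^sup>2) * (\<integral>x. indicator {0..s} x * (c * x ^ m) \<partial>lborel)"
      using Suc by (intro killed_square_mean_le s0) (auto intro!: continuous_intros simp: c_def)
    also have "\<dots> \<le> ?C * (c * (s ^ Suc m / real (Suc m)))"
      unfolding I using Suc s0 c0 by (intro mult_right_mono add_right_mono mult_left_mono) auto
    also have "\<dots> = K\<^sup>2 * ?C ^ Suc m / fact (Suc m) * s ^ Suc m"
      by (simp add: c_def mult_ac)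
    finally show ?thesis .
  qed
qed

lemma killed_AE_zero: assumes t: "0 \<le> t" shows "AE \<omega> in M. killed t \<omega> = 0"
proof -
  let ?C = "2 * \<mu>\<^sup>2 * t + 2 * \<sigma>\<^sup>2"
  have "(\<lambda>m. inverse (fact m) * (?C * t) ^ m) \<longlonglongrightarrow> 0" by (rule summable_LIMSEQ_zero[OF summable_exp])
  then have "(\<lambda>m. K\<^sup>2 * (inverse (fact m) * (?C * t) ^ m)) \<longlonglongrightarrow> K\<^sup>2 * 0" by (intro tendsto_intros)
  moreover have "(\<integral>\<omega>. (killed t \<omega>)\<^sup>2 \<partial>M) \<le> K\<^sup>2 * (inverse (fact m) * (?C * t) ^ m)" for m
    using killed_square_mean_iterate[OF t order_refl, of m] unfolding power_mult_distrib by (simp add: field_simps)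
  ultimately have "(\<integral>\<omega>. (killed t \<omega>)\<^sup>2 \<partial>M) \<le> K\<^sup>2 * 0"
    using LIMSEQ_le_const by blast
  moreover have "0 \<le> (\<integral>\<omega>. (killed t \<omega>)\<^sup>2 \<partial>M)" by (rule integral_nonneg_AE) simp
  ultimately have "(\<integral>\<omega>. (killed t \<omega>)\<^sup>2 \<partial>M) = 0" by simp
  then have "AE \<omega> in M. (killed t \<omega>)\<^sup>2 = 0"
    using integral_nonneg_eq_0_iff_AE[OF killed_integrable[OF t]] by simp
  then show ?thesis by simp
qed

end

text \<open>Every path is bounded on \<open>[0, t]\<close> by some natural number, and killing at
  that level does not change it; countably many levels need only one null set.\<close>

lemma linear_sde_zero:
  assumes D: "adapted_continuous M F D" and D0: "\<And>\<omega>. \<omega> \<in> space M \<Longrightarrow> D 0 \<omega> = 0"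
    and sde: "\<And>t. 0 < t \<Longrightarrow> conv_prob (grid_sum (\<lambda>s \<omega>. \<sigma> * D s \<omega>) t)
      (\<lambda>\<omega>. D t \<omega> - \<mu> * path_integral D t \<omega>)"
    and t: "0 \<le> t"
  shows "AE \<omega> in M. D t \<omega> = 0"
proof -
  have "AE \<omega> in M. \<forall>n. killed D (real n) t \<omega> = 0"
    unfolding AE_all_countable using killed_AE_zero[OF D D0 sde _ t] by simp
  then show ?thesis
    using AE_space
  proof eventually_elim
    case (elim \<omega>)
    obtain B where B: "0 < B" "\<And>s. 0 \<le> s \<Longrightarrow> s \<le> t \<Longrightarrow> \<bar>D s \<omega>\<bar> \<le> B"
      using adapted_continuous_bounded[OF D elim(2)] by blast
    obtain n :: nat where "B \<le> real n" using real_arch_simple by blast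
    then have "\<bar>D r \<omega>\<bar> \<le> real n" if "0 \<le> r" "r \<le> t" for r using B(2)[OF that] by linarith
    then have "killed D (real n) t \<omega> = D t \<omega>"
      by (simp add: killed_def[OF D D0 sde of_nat_0_le_iff])
    then show ?case using elim(1) by simp
  qed
qed

text \<open>\<open>Q\<close> and \<open>Q0 * X\<close> solve the same linear equation with the same
  initial value, so their difference solves it from 0 and vanishes. Taking logarithms instead would
  require positivity of \<open>Q\<close> in advance, and this is part of what is to be
  shown.\<close>

lemma geometric_brownian_motion_explicit:
  assumes gbm: "geometric_brownian_motion M F W \<mu> \<sigma> Q0 Q"
  shows "AE \<omega> in M. \<forall>t\<ge>0. Q t \<omega> = Q0 * exp (\<sigma> * W t \<omega> + (\<mu> - \<sigma>\<^sup>2 / 2) * t)"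
proof -
  define X where "X t \<omega> = exp (\<sigma> * W t \<omega> + (\<mu> - \<sigma>\<^sup>2 / 2) * t)" for t \<omega>
  define D where "D t \<omega> = Q t \<omega> - Q0 * X t \<omega>" for t \<omega>
  have Q: "adapted_continuous M F Q" and Qint: "\<And>t. 0 \<le> t \<Longrightarrow> has_ito_integral M F W (\<lambda>t \<omega>. \<sigma> * Q t \<omega>) t
      (\<lambda>\<omega>. Q t \<omega> - Q 0 \<omega> - (LBINT s:{0..t}. \<mu> * Q s \<omega>))" and Q0: "\<And>\<omega>. \<omega> \<in> space M \<Longrightarrow> Q 0 \<omega> = Q0"
    using gbm unfolding geometric_brownian_motion_def ito_process_def by blast+
  have X: "adapted_continuous M F X" unfolding X_def by (rule exp_process_adapted)
  have D: "adapted_continuous M F D"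
    using adapted_continuous_lincomb[OF Q X, of 1 "- Q0"] unfolding D_def by simp
  have \<sigma>Q: "adapted_continuous M F (\<lambda>t \<omega>. \<sigma> * Q t \<omega>)"
    using adapted_continuous_lincomb[OF Q Q, of \<sigma> 0] by simp
  have "AE \<omega> in M. D t \<omega> = 0" if t: "0 < t" for t
  proof (rule linear_sde_zero[OF D])
    show "D 0 \<omega> = 0" if "\<omega> \<in> space M" for \<omega> using that by (simp add: D_def X_def Q0 W_0)
    show "0 \<le> t" using t by simp
    fix t :: real assume t: "0 < t"
    have c1: "conv_prob (grid_sum (\<lambda>s \<omega>. \<sigma> * Q s \<omega>) t) (\<lambda>\<omega>. Q t \<omega> - Q 0 \<omega> - (LBINT s:{0..t}. \<mu> * Q s \<omega>))"
      using has_ito_integral_imp_grid_sum[OF Qint \<sigma>Q t] t by simp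
    have c2: "conv_prob (grid_sum (\<lambda>s \<omega>. \<sigma> * X s \<omega>) t) (\<lambda>\<omega>. X t \<omega> - 1 - \<mu> * path_integral X t \<omega>)"
      using grid_sum_exp[OF t, of \<sigma> "\<mu> - \<sigma>\<^sup>2 / 2"] by (simp add: X_def[abs_def])
    show "conv_prob (grid_sum (\<lambda>s \<omega>. \<sigma> * D s \<omega>) t) (\<lambda>\<omega>. D t \<omega> - \<mu> * path_integral D t \<omega>)"
    proof (rule conv_prob_cong[OF conv_prob_lincomb[OF c1 c2, of 1 "- Q0"]])
      show "grid_sum (\<lambda>s \<omega>. \<sigma> * D s \<omega>) t n \<in> borel_measurable M" for n
        using t adapted_continuous_measurable(2)[OF D] by (intro grid_sum_measurable) auto
      show "(\<lambda>\<omega>. D t \<omega> - \<mu> * path_integral D t \<omega>) \<in> borel_measurable M"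
        using t by (intro borel_measurable_diff borel_measurable_times path_integral_riemann(4)[OF D]
            adapted_continuous_measurable(2)[OF D]) auto
      show "AE \<omega> in M. 1 * grid_sum (\<lambda>s \<omega>. \<sigma> * Q s \<omega>) t n \<omega> + - Q0 * grid_sum (\<lambda>s \<omega>. \<sigma> * X s \<omega>) t n \<omega> =
        grid_sum (\<lambda>s \<omega>. \<sigma> * D s \<omega>) t n \<omega>" for n
        unfolding grid_sum_lincomb[symmetric] D_def by (simp add: algebra_simps)
      show "AE \<omega> in M. 1 * (Q t \<omega> - Q 0 \<omega> - (LBINT s:{0..t}. \<mu> * Q s \<omega>)) +
          - Q0 * (X t \<omega> - 1 - \<mu> * path_integral X t \<omega>) =
        D t \<omega> - \<mu> * path_integral D t \<omega>"
      proof (rule AE_I2)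
        fix \<omega> assume w: "\<omega> \<in> space M"
        note i = path_integral_riemann(1)[OF Q t w] path_integral_riemann(1)[OF X t w]
        have "path_integral D t \<omega> =
          (\<integral>s. indicator {0..t} s * Q s \<omega> - Q0 * (indicator {0..t} s * X s \<omega>) \<partial>lborel)"
          unfolding path_integral_def by (rule Bochner_Integration.integral_cong) (auto simp: D_def algebra_simps)
        also have "\<dots> = path_integral Q t \<omega> - Q0 * path_integral X t \<omega>"
          using i by (simp add: path_integral_def)
        finally have ID: "path_integral D t \<omega> =
          path_integral Q t \<omega> - Q0 * path_integral X t \<omega>" .
        have IQ: "(LBINT s:{0..t}. \<mu> * Q s \<omega>) = \<mu> * path_integral Q t \<omega>"
          by (simp add: set_lebesgue_integral_def path_integral_def mult.left_commute)
        show "1 * (Q t \<omega> - Q 0 \<omega> - (LBINT s:{0..t}. \<mu> * Q s \<omega>)) +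
          - Q0 * (X t \<omega> - 1 - \<mu> * path_integral X t \<omega>) =
        D t \<omega> - \<mu> * path_integral D t \<omega>"
          unfolding ID IQ by (simp add: D_def Q0[OF w] algebra_simps)
      qed
    qed
  qed
  then have "AE \<omega> in M. \<forall>t\<ge>0. D t \<omega> = 0"
    using D unfolding adapted_continuous_def by (intro AE_all_times_eq) auto
  then show ?thesis by eventually_elim (simp add: D_def X_def)
qed

end

section \<open>Expectations at an independent exponential time\<close>

lemma has_bochner_integral_erlang_density:
  assumes l: "0 < l" shows "has_bochner_integral lborel (erlang_density k l) 1"
proof (rule has_bochner_integral_nn_integral)
  interpret prob_space "density lborel (erlang_density k l)" using l by (rule prob_space_erlang_density)
  show "(\<integral>\<^sup>+ x. ennreal (erlang_density k l x) \<partial>lborel) = ennreal 1"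
    using emeasure_space_1 by (simp add: emeasure_density)
qed (use l in auto)

text \<open>The weight \<open>exp (c * t)\<close> turns the exponential law of rate \<open>l\<close>
  into a multiple of the one of rate \<open>l - c\<close>, which is a density because
  \<open>c < l\<close>.\<close>

lemma exponential_density_times_exp:
  assumes l: "0 < l" "c < l"
  shows "has_bochner_integral lborel (\<lambda>t. exponential_density l t * exp (c * t)) (l / (l - c))"
proof -
  have eq: "exponential_density l t * exp (c * t) = l / (l - c) * exponential_density (l - c) t" for t
  proof -
    have "exp (- t * l) * exp (c * t) = exp (- t * (l - c))" by (simp add: exp_add[symmetric] algebra_simps)
    then show ?thesis using l by (simp add: exponential_density_def mult.assoc)
  qed
  have "has_bochner_integral lborel (\<lambda>t. l / (l - c) * exponential_density (l - c) t) (l / (l - c) * 1)"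
    using l by (intro has_bochner_integral_mult_right has_bochner_integral_erlang_density) auto
  then show ?thesis unfolding eq by simp
qed

lemma exponential_density_times_id:
  assumes l: "0 < l"
  shows "has_bochner_integral lborel (\<lambda>t. exponential_density l t * t) (1 / l)"
proof -
  have eq: "exponential_density l t * t = 1 / l * erlang_density 1 l t" for t
    using l by (simp add: exponential_density_def erlang_density_def field_simps power2_eq_square)
  have "has_bochner_integral lborel (\<lambda>t. 1 / l * erlang_density 1 l t) (1 / l * 1)"
    using l by (intro has_bochner_integral_mult_right has_bochner_integral_erlang_density)
  then show ?thesis unfolding eq by simp
qed

text \<open>At \<open>c = 0\<close>, which occurs for instance when \<open>k = 1\<close>, the
  quotient would be 0 by convention instead of \<open>t\<close>.\<close>

definition exp_primitive :: "real \<Rightarrow> real \<Rightarrow> real" where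
  "exp_primitive c t = (if c = 0 then t else (exp (c * t) - 1) / c)"

lemma has_bochner_integral_exp_Icc:
  assumes "0 \<le> t"
  shows "has_bochner_integral lborel (\<lambda>s. indicator {0..t} s * exp (c * s)) (exp_primitive c t)"
proof -
  have "has_bochner_integral lborel (\<lambda>s. exp (c * s) * indicator {0..t} s) (exp_primitive c t - exp_primitive c 0)"
    by (rule has_bochner_integral_FTC_Icc_real)
       (use assms in \<open>cases "c = 0"; auto simp: exp_primitive_def[abs_def] intro!: derivative_eq_intros\<close>)+
  moreover have "exp_primitive c 0 = 0" by (simp add: exp_primitive_def)
  ultimately show ?thesis by (simp add: mult.commute)
qed

lemma exponential_density_times_exp_primitive:
  assumes l: "0 < l" "c < l"
  shows "has_bochner_integral lborel (\<lambda>t. exponential_density l t * exp_primitive c t) (1 / (l - c))"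
proof (cases "c = 0")
  case True
  then show ?thesis using exponential_density_times_id[OF l(1)] by (simp add: exp_primitive_def)
next
  case False
  have "has_bochner_integral lborel (\<lambda>t. 1 / c * (exponential_density l t * exp (c * t) - exponential_density l t)) (1 / c * (l / (l - c) - 1))"
    using l by (intro has_bochner_integral_mult_right has_bochner_integral_diff exponential_density_times_exp
        has_bochner_integral_erlang_density)
  moreover have "1 / c * (exponential_density l t * exp (c * t) - exponential_density l t) = exponential_density l t * exp_primitive c t" for t
    using False by (simp add: exp_primitive_def field_simps)
  moreover have "1 / c * (l / (l - c) - 1) = 1 / (l - c)" using False l by (simp add: field_simps)
  ultimately show ?thesis by simp
qed

text \<open>Conditioning on \<open>\<tau>\<close> through Fubini. The sigma-algebra \<open>G\<close>
  is kept separate from \<open>M\<close> because \<open>\<tau>\<close> is independent of the path of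
  \<open>W\<close> only. The hypotheses on \<open>h\<close> bound first absolute moments, which is
  all that integrability on the product requires.\<close>

lemma (in prob_space) indep_time_expectation:
  fixes Z :: "real \<Rightarrow> 'a \<Rightarrow> real"
  assumes l: "0 < l" and d: "distributed M lborel \<tau> (exponential_density l)"
    and \<tau>0: "\<forall>\<omega>\<in>space M. 0 \<le> \<tau> \<omega>"
    and G: "space G = space M" "sets G \<subseteq> sets M"
    and ind: "indep_set (sets (vimage_algebra (space M) \<tau> borel)) (sets G)"
    and Zm: "\<And>t. 0 \<le> t \<Longrightarrow> Z t \<in> borel_measurable G"
    and Zc: "\<And>\<omega>. \<omega> \<in> space M \<Longrightarrow> continuous_on {0..} (\<lambda>t. Z t \<omega>)"
    and Zi: "\<And>t. 0 \<le> t \<Longrightarrow> has_bochner_integral M (Z t) (m t)"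
    and Zh: "\<And>t. 0 \<le> t \<Longrightarrow> (\<integral>\<omega>. \<bar>Z t \<omega>\<bar> \<partial>M) \<le> h t"
    and hi: "integrable lborel (\<lambda>t. exponential_density l t * h t)"
    and mi: "has_bochner_integral lborel (\<lambda>t. exponential_density l t * m t) r"
  shows "has_bochner_integral M (\<lambda>\<omega>. Z (\<tau> \<omega>) \<omega>) r"
proof -
  let ?e = "exponential_density l"
  define D where "D = density lborel ?e"
  \<comment> \<open>The restriction of \<open>M\<close> to \<open>G\<close>: the joint law of
    \<open>\<tau>\<close> and the identity into \<open>G\<close> is then the product of
    \<open>D\<close> and \<open>P\<close>, as independence shows on rectangles.\<close>
  define P where "P = distr M G (\<lambda>\<omega>. \<omega>)"
  have \<tau>m[measurable]: "\<tau> \<in> borel_measurable M" using distributed_measurable[OF d] by simp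
  have idm: "(\<lambda>\<omega>. \<omega>) \<in> measurable M G"
    using G by (intro measurableI) (auto simp: sets.Int_space_eq2 intro: sets.sets_into_space)
  have Dd: "distr M lborel \<tau> = D" using distributed_distr_eq_density[OF d] by (simp add: D_def)
  interpret PD: prob_space D unfolding D_def using l by (rule prob_space_exponential_density)
  interpret PP: prob_space P unfolding P_def using idm by (rule prob_space_distr)
  interpret pair_sigma_finite D P ..
  have taum: "(\<lambda>\<omega>. (\<tau> \<omega>, \<omega>)) \<in> measurable M (lborel \<Otimes>\<^sub>M G)"
    using idm \<tau>m by (intro measurable_Pair) auto
  have sDP: "sets (D \<Otimes>\<^sub>M P) = sets (lborel \<Otimes>\<^sub>M G)"
    by (intro sets_pair_measure_cong) (simp_all add: D_def P_def)
  have joint: "D \<Otimes>\<^sub>M P = distr M (lborel \<Otimes>\<^sub>M G) (\<lambda>\<omega>. (\<tau> \<omega>, \<omega>))"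
  proof (rule pair_measure_eqI)
    show "sets (D \<Otimes>\<^sub>M P) = sets (distr M (lborel \<Otimes>\<^sub>M G) (\<lambda>\<omega>. (\<tau> \<omega>, \<omega>)))" using sDP by simp
    fix A B assume "A \<in> sets D" "B \<in> sets P"
    then have A: "A \<in> sets lborel" and B: "B \<in> sets G" by (simp_all add: D_def P_def)
    have BM: "B \<inter> space M = B" using sets.sets_into_space[OF B] G by auto
    have "\<tau> -` A \<inter> space M \<in> sets (vimage_algebra (space M) \<tau> borel)"
      using A by (intro in_vimage_algebra) simp
    then have "prob ((\<tau> -` A \<inter> space M) \<inter> B) = prob (\<tau> -` A \<inter> space M) * prob B"
      using ind B unfolding indep_sets2_eq by blast
    moreover have "emeasure D A = prob (\<tau> -` A \<inter> space M)"
      unfolding Dd[symmetric] using A by (subst emeasure_distr) (auto simp: emeasure_eq_measure)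
    moreover have "emeasure P B = prob B"
      unfolding P_def using B idm BM by (subst emeasure_distr) (auto simp: emeasure_eq_measure)
    moreover have "emeasure (distr M (lborel \<Otimes>\<^sub>M G) (\<lambda>\<omega>. (\<tau> \<omega>, \<omega>))) (A \<times> B) = prob ((\<tau> -` A \<inter> space M) \<inter> B)"
    proof -
      have "(\<lambda>\<omega>. (\<tau> \<omega>, \<omega>)) -` (A \<times> B) \<inter> space M = (\<tau> -` A \<inter> space M) \<inter> B" using BM by auto
      then show ?thesis
        using taum A B by (subst emeasure_distr) (auto simp: emeasure_eq_measure intro!: pair_measureI)
    qed
    ultimately show "emeasure D A * emeasure P B = emeasure (distr M (lborel \<Otimes>\<^sub>M G) (\<lambda>\<omega>. (\<tau> \<omega>, \<omega>))) (A \<times> B)"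
      by (simp add: ennreal_mult')
  qed unfold_locales
  \<comment> \<open>The law of \<open>\<tau>\<close> lives on the whole line, but \<open>Z\<close>
    is controlled for times \<open>t \<ge> 0\<close> only; the clip is harmless as
    \<open>\<tau>\<close> is nonnegative.\<close>
  define f where "f z = Z (max 0 (fst z)) (snd z)" for z
  have "(\<lambda>(t, \<omega>). Z (max 0 t) \<omega>) \<in> borel_measurable (borel \<Otimes>\<^sub>M G)"
  proof (rule measurable_continuous_process)
    show "Z (max 0 t) \<in> borel_measurable G" for t by (rule Zm) simp
    show "continuous_on UNIV (\<lambda>t. Z (max 0 t) \<omega>)" if "\<omega> \<in> space G" for \<omega>
      using Zc that G by (intro continuous_on_compose2[OF Zc]) (auto intro!: continuous_intros)
  qed
  then have fG: "f \<in> borel_measurable (lborel \<Otimes>\<^sub>M G)"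
    unfolding f_def[abs_def] by (simp add: case_prod_beta' cong: measurable_cong_sets)
  have fDP: "f \<in> borel_measurable (D \<Otimes>\<^sub>M P)" using fG sDP measurable_cong_sets by blast
  have sec: "(\<lambda>\<omega>. f (t, \<omega>)) \<in> borel_measurable G" for t by (simp add: f_def Zm)
  have intP: "(\<integral>\<omega>. g \<omega> \<partial>P) = (\<integral>\<omega>. g \<omega> \<partial>M)" if "g \<in> borel_measurable G" for g :: "'a \<Rightarrow> real"
    unfolding P_def by (rule integral_distr[OF idm that])
  have fi: "integrable (D \<Otimes>\<^sub>M P) f"
  proof (rule Fubini_integrable[OF fDP])
    show "AE t in D. integrable P (\<lambda>\<omega>. f (t, \<omega>))"
      unfolding P_def using integrable_distr_eq[OF idm sec] Zi
      by (auto simp: f_def has_bochner_integral_iff)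
    have nm: "(\<lambda>t. \<integral>\<omega>. norm (f (t, \<omega>)) \<partial>P) \<in> borel_measurable lborel"
    proof (rule PP.borel_measurable_lebesgue_integral)
      have "(\<lambda>z. norm (f z)) \<in> borel_measurable (lborel \<Otimes>\<^sub>M G)" using fG by measurable
      moreover have LP: "sets (lborel \<Otimes>\<^sub>M P) = sets (lborel \<Otimes>\<^sub>M G)"
        by (intro sets_pair_measure_cong) (simp_all add: P_def)
      ultimately show "(\<lambda>(t, \<omega>). norm (f (t, \<omega>))) \<in> borel_measurable (lborel \<Otimes>\<^sub>M P)"
        unfolding measurable_cong_sets[OF LP refl] by (simp only: case_prod_beta' prod.collapse)
    qed
    show "integrable D (\<lambda>t. \<integral>\<omega>. norm (f (t, \<omega>)) \<partial>P)"
      unfolding D_def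
    proof (subst integrable_density[OF nm])
      show "integrable lborel (\<lambda>t. ?e t *\<^sub>R (\<integral>\<omega>. norm (f (t, \<omega>)) \<partial>P))"
      proof (rule Bochner_Integration.integrable_bound[OF hi])
        show "(\<lambda>t. ?e t *\<^sub>R (\<integral>\<omega>. norm (f (t, \<omega>)) \<partial>P)) \<in> borel_measurable lborel" using nm by measurable
        have "norm (?e t *\<^sub>R (\<integral>\<omega>. norm (f (t, \<omega>)) \<partial>P)) \<le> norm (?e t * h t)" for t
        proof (cases "t < 0")
          case True then show ?thesis by (simp add: exponential_density_def)
        next
          case False
          have "(\<integral>\<omega>. norm (f (t, \<omega>)) \<partial>P) = (\<integral>\<omega>. \<bar>Z t \<omega>\<bar> \<partial>M)"
            using sec[of t] False by (subst intP) (auto simp: f_def)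
          moreover have "0 \<le> (\<integral>\<omega>. \<bar>Z t \<omega>\<bar> \<partial>M)" by (rule integral_nonneg_AE) simp
          ultimately show ?thesis using Zh[of t] False l
            by (simp add: abs_mult mult_left_mono exponential_density_nonneg)
        qed
        then show "AE t in lborel. norm (?e t *\<^sub>R (\<integral>\<omega>. norm (f (t, \<omega>)) \<partial>P)) \<le> norm (?e t * h t)" by simp
      qed
    qed (use l in auto)
  qed
  have eqM: "f (\<tau> \<omega>, \<omega>) = Z (\<tau> \<omega>) \<omega>" if "\<omega> \<in> space M" for \<omega> using \<tau>0 that by (simp add: f_def)
  have "integrable M (\<lambda>\<omega>. f (\<tau> \<omega>, \<omega>))"
    using fi unfolding joint by (rule integrable_distr[OF taum])
  then have int: "integrable M (\<lambda>\<omega>. Z (\<tau> \<omega>) \<omega>)"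
    by (rule Bochner_Integration.integrable_cong[THEN iffD1, rotated -1]) (auto simp: eqM)
  have "(\<integral>\<omega>. Z (\<tau> \<omega>) \<omega> \<partial>M) = (\<integral>\<omega>. f (\<tau> \<omega>, \<omega>) \<partial>M)"
    by (rule Bochner_Integration.integral_cong) (auto simp: eqM)
  also have "\<dots> = (\<integral>z. f z \<partial>(D \<Otimes>\<^sub>M P))" unfolding joint by (rule integral_distr[OF taum fG, symmetric])
  also have "\<dots> = (\<integral>t. (\<integral>\<omega>. f (t, \<omega>) \<partial>P) \<partial>D)" by (rule integral_fst'[OF fi, symmetric])
  also have "\<dots> = (\<integral>t. ?e t *\<^sub>R (\<integral>\<omega>. f (t, \<omega>) \<partial>P) \<partial>lborel)"
    unfolding D_def
  proof (rule integral_density)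
    show "(\<lambda>t. \<integral>\<omega>. f (t, \<omega>) \<partial>P) \<in> borel_measurable lborel"
      using borel_measurable_integrable[OF integrable_fst'[OF fi]] by (simp add: D_def)
  qed (use l in auto)
  also have "\<dots> = (\<integral>t. ?e t * m t \<partial>lborel)"
  proof (rule Bochner_Integration.integral_cong[OF refl])
    fix t :: real
    show "?e t *\<^sub>R (\<integral>\<omega>. f (t, \<omega>) \<partial>P) = ?e t * m t"
    proof (cases "t < 0")
      case False
      have "(\<integral>\<omega>. f (t, \<omega>) \<partial>P) = (\<integral>\<omega>. Z t \<omega> \<partial>M)" using False by (subst intP[OF sec]) (simp add: f_def)
      also have "\<dots> = m t" using Zi[of t] False by (simp add: has_bochner_integral_iff)
      finally show ?thesis by simp
    qed (simp add: exponential_density_def)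
  qed
  finally show ?thesis using int mi by (simp add: has_bochner_integral_iff)
qed

section \<open>Time integrals and the martingale part\<close>

context brownian
begin

lemma path_integral_0: "path_integral X 0 \<omega> = 0"
proof -
  have "(\<integral>s. indicator {0..0} s * X s \<omega> \<partial>lborel) = (\<integral>s. 0 \<partial>(lborel :: real measure))"
  proof (rule integral_eq_zero_AE[THEN trans])
    show "AE s in lborel. indicator {0..0} s * X s \<omega> = 0"
      using AE_lborel_singleton[of "0::real"] by eventually_elim (auto simp: indicator_def)
  qed simp
  then show ?thesis by (simp add: path_integral_def)
qed

text \<open>The sigma-algebra \<open>A\<close> is arbitrary because the result is used twice: with
  \<open>F t\<close> for adaptedness, and with the sigma-algebra of the path of \<open>W\<close> for
  independence from \<open>\<tau>\<close>.\<close>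

lemma path_integral_measurable:
  assumes X: "adapted_continuous M F X" and t: "0 \<le> t" and A: "space A = space M"
    and XA: "\<And>s. 0 \<le> s \<Longrightarrow> s \<le> t \<Longrightarrow> X s \<in> borel_measurable A"
  shows "path_integral X t \<in> borel_measurable A"
proof (cases "t = 0")
  case True
  then show ?thesis by (simp add: path_integral_0[abs_def])
next
  case False
  then have t0: "0 < t" using t by simp
  show ?thesis
  proof (rule borel_measurable_LIMSEQ_real)
    show "(\<lambda>n. \<Sum>i<n. X (grid t n i) \<omega> * (t / real n)) \<longlonglongrightarrow> path_integral X t \<omega>" if "\<omega> \<in> space A" for \<omega>
      using path_integral_riemann(2)[OF X t0] that A by simp
    show "(\<lambda>\<omega>. \<Sum>i<n. X (grid t n i) \<omega> * (t / real n)) \<in> borel_measurable A" for n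
    proof (intro borel_measurable_sum borel_measurable_times borel_measurable_const XA)
      fix i assume "i \<in> {..<n}"
      then show "0 \<le> grid t n i" "grid t n i \<le> t" using grid_point[of i n t] t by auto
    qed
  qed
qed

lemma path_integrable:
  assumes X: "adapted_continuous M F X" and w: "\<omega> \<in> space M" and t: "0 \<le> t"
  shows "set_integrable lborel {0..t} (\<lambda>s. X s \<omega>)"
proof (cases "t = 0")
  case True
  have "(\<lambda>s. indicator {0..0} s *\<^sub>R X s \<omega>) = (\<lambda>s. indicator {0} s *\<^sub>R X 0 \<omega>)"
    by (auto simp: indicator_def)
  then show ?thesis unfolding set_integrable_def True
    by (simp only:) (intro integrable_scaleR_left integrable_real_indicator; simp)
next
  case False
  then show ?thesis using path_integral_riemann(1)[OF X _ w, of t] t by (simp add: set_integrable_def)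
qed

lemma path_integral_adapted:
  assumes X: "adapted_continuous M F X"
  shows "adapted_continuous M F (path_integral X)"
  unfolding adapted_continuous_def
proof (intro conjI allI impI ballI)
  show "path_integral X t \<in> borel_measurable (F t)" if "0 \<le> t" for t
    by (rule path_integral_measurable[OF X that]) (use adapted_continuous_measurable(1)[OF X] in auto)
next
  fix \<omega> assume w: "\<omega> \<in> space M"
  show "continuous_on {0..} (\<lambda>t. path_integral X t \<omega>)"
    unfolding continuous_on_eq_continuous_within
  proof
    fix t :: real assume "t \<in> {0..}"
    then have t: "0 \<le> t" by simp
    note int = path_integrable[OF X w]
    have eq: "path_integral X s \<omega> = integral {0..s} (\<lambda>s. X s \<omega>)" if "0 \<le> s" for s
      using set_borel_integral_eq_integral(2)[OF int[OF that]] by (simp add: path_integral_def set_lebesgue_integral_def)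
    \<comment> \<open>The interval is extended past \<open>t\<close> so that it contains a
      neighbourhood of \<open>t\<close> in \<open>{0..}\<close>; continuity there is a local
      matter.\<close>
    have "continuous_on {0..t+1} (\<lambda>s. integral {0..s} (\<lambda>s. X s \<omega>))"
      using set_borel_integral_eq_integral(1)[OF int[of "t+1"]] t by (intro indefinite_integral_continuous_1) simp
    then have "continuous_on {0..t+1} (\<lambda>s. path_integral X s \<omega>)"
      by (rule continuous_on_eq) (simp add: eq)
    then have "continuous (at t within {0..t+1}) (\<lambda>s. path_integral X s \<omega>)"
      using t by (simp add: continuous_on_eq_continuous_within)
    moreover have "at t within {0..t+1} = at t within {0..}"
      by (rule at_within_nhd[of t "{..<t+1}"]) auto
    ultimately show "continuous (at t within {0..}) (\<lambda>s. path_integral X s \<omega>)" by simp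
  qed
qed

lemma path_integral_exp_mean:
  assumes t: "0 \<le> t"
  shows "has_bochner_integral M (path_integral (\<lambda>s \<omega>. exp (a * W s \<omega> + b * s)) t) (exp_primitive (b + a\<^sup>2 / 2) t)"
proof -
  define X where "X s \<omega> = exp (a * W s \<omega> + b * s)" for s \<omega>
  let ?c = "b + a\<^sup>2 / 2"
  interpret pair_sigma_finite "lborel :: real measure" M ..
  define f where "f z = indicator {0..t} (fst z) * X (max 0 (fst z)) (snd z)" for z
  have X: "adapted_continuous M F X" unfolding X_def by (rule exp_process_adapted)
  have jm: "(\<lambda>z. X (max 0 (fst z)) (snd z)) \<in> borel_measurable (lborel \<Otimes>\<^sub>M M)"
    using adapted_continuous_joint[OF X] by (simp add: case_prod_beta' cong: measurable_cong_sets)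
  have fm: "f \<in> borel_measurable (lborel \<Otimes>\<^sub>M M)" unfolding f_def[abs_def] using jm by measurable
  have mean: "has_bochner_integral M (\<lambda>\<omega>. f (s, \<omega>)) (indicator {0..t} s * exp (?c * s))" for s
  proof (cases "0 \<le> s \<and> s \<le> t")
    case True
    then show ?thesis using exp_process_mean[of s a b] by (simp add: f_def X_def max_def)
  qed (auto simp: f_def has_bochner_integral_iff)
  \<comment> \<open>The integrand is nonnegative, so the computation of the mean also proves the
    integrability that Fubini asks for.\<close>
  have nn: "norm (f z) = f z" for z by (simp add: f_def X_def)
  have fi: "integrable (lborel \<Otimes>\<^sub>M M) f"
  proof (rule Fubini_integrable[OF fm])
    show "integrable lborel (\<lambda>s. \<integral>\<omega>. norm (f (s, \<omega>)) \<partial>M)"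
      unfolding nn has_bochner_integral_integral_eq[OF mean]
      using has_bochner_integral_exp_Icc[OF t] by (rule integrable.intros)
    show "AE s in lborel. integrable M (\<lambda>\<omega>. f (s, \<omega>))" using mean by (auto intro: integrable.intros)
  qed
  then have fi': "integrable (lborel \<Otimes>\<^sub>M M) (case_prod (\<lambda>s \<omega>. f (s, \<omega>)))" by simp
  have eq: "(\<integral>s. f (s, \<omega>) \<partial>lborel) = path_integral X t \<omega>" for \<omega>
    unfolding path_integral_def by (rule Bochner_Integration.integral_cong) (auto simp: f_def indicator_def)
  have "(\<integral>\<omega>. path_integral X t \<omega> \<partial>M) = (\<integral>s. (\<integral>\<omega>. f (s, \<omega>) \<partial>M) \<partial>lborel)"
    using integral_snd[OF fi'] integral_fst'[OF fi] unfolding eq by simp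
  also have "\<dots> = exp_primitive ?c t"
    unfolding has_bochner_integral_integral_eq[OF mean]
    using has_bochner_integral_exp_Icc[OF t] by (rule has_bochner_integral_integral_eq)
  finally have "(\<integral>\<omega>. path_integral X t \<omega> \<partial>M) = exp_primitive ?c t" .
  moreover have "integrable M (path_integral X t)"
    using integrable_snd[OF fi'] unfolding eq by simp
  ultimately show ?thesis unfolding has_bochner_integral_iff X_def[abs_def] by simp
qed

text \<open>The integral of \<open>X = exp (a W + b t)\<close> against \<open>W\<close>, read off from It\^o's formula when \<open>a \<noteq> 0\<close>;
  if \<open>a = b = 0\<close> it is \<open>W\<close> itself.\<close>

definition exp_ito :: "real \<Rightarrow> real \<Rightarrow> real \<Rightarrow> 'a \<Rightarrow> real" where
  "exp_ito a b t \<omega> = (if a = 0 then W t \<omega> else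
     (exp (a * W t \<omega> + b * t) - 1 - (b + a\<^sup>2 / 2) * path_integral (\<lambda>s \<omega>. exp (a * W s \<omega> + b * s)) t \<omega>) / a)"

lemma W_adapted: "adapted_continuous M F W"
  using bm by (simp add: standard_brownian_motion_def)

lemma W_moments:
  assumes "0 \<le> t" shows "has_bochner_integral M (W t) 0" "has_bochner_integral M (\<lambda>\<omega>. (W t \<omega>)\<^sup>2) t"
proof -
  have "has_bochner_integral M (\<lambda>\<omega>. W t \<omega> - W 0 \<omega>) 0 \<and> has_bochner_integral M (\<lambda>\<omega>. (W t \<omega> - W 0 \<omega>)\<^sup>2) t"
  proof (cases "t = 0")
    case False
    then show ?thesis using increment_mean[of 0 t] increment_square[of 0 t] assms by simp
  qed (simp add: has_bochner_integral_iff)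
  moreover have "has_bochner_integral M (\<lambda>\<omega>. W t \<omega> - W 0 \<omega>) 0 \<longleftrightarrow> has_bochner_integral M (W t) 0"
    "has_bochner_integral M (\<lambda>\<omega>. (W t \<omega> - W 0 \<omega>)\<^sup>2) t \<longleftrightarrow> has_bochner_integral M (\<lambda>\<omega>. (W t \<omega>)\<^sup>2) t"
    by (rule has_bochner_integral_cong; simp add: W_0)+
  ultimately show "has_bochner_integral M (W t) 0" "has_bochner_integral M (\<lambda>\<omega>. (W t \<omega>)\<^sup>2) t" by blast+
qed

lemma exp_ito_adapted: "adapted_continuous M F (exp_ito a b)"
proof (cases "a = 0")
  case True
  then show ?thesis using W_adapted by (simp add: exp_ito_def[abs_def])
next
  case False
  define X where "X = (\<lambda>s \<omega>. exp (a * W s \<omega> + b * s))"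
  define c where "c = b + a\<^sup>2 / 2"
  have X: "adapted_continuous M F X" unfolding X_def by (rule exp_process_adapted)
  have one: "adapted_continuous M F (\<lambda>_ _. 1)" by (simp add: adapted_continuous_def)
  have "adapted_continuous M F (\<lambda>t \<omega>. 1 * (1 / a * X t \<omega> + (- 1 / a) * 1) + (- c / a) * path_integral X t \<omega>)"
    by (intro adapted_continuous_lincomb X one path_integral_adapted)
  also have "(\<lambda>t \<omega>. 1 * (1 / a * X t \<omega> + (- 1 / a) * 1) + (- c / a) * path_integral X t \<omega>) = exp_ito a b"
    using False by (simp add: exp_ito_def[abs_def] X_def c_def[symmetric] fun_eq_iff diff_divide_distrib)
  finally show ?thesis .
qed

lemma exp_ito_0: "\<omega> \<in> space M \<Longrightarrow> exp_ito a b 0 \<omega> = 0"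
  by (simp add: exp_ito_def W_0 path_integral_0)

lemma exp_ito_grid_sum:
  assumes t: "0 \<le> t" and ab: "a = 0 \<Longrightarrow> b = 0"
  shows "conv_prob (grid_sum (\<lambda>s \<omega>. exp (a * W s \<omega> + b * s)) t) (exp_ito a b t)"
proof -
  let ?X = "\<lambda>s \<omega>. exp (a * W s \<omega> + b * s)"
  have Gm: "grid_sum ?X t n \<in> borel_measurable M" for n
    using t adapted_continuous_measurable(2)[OF exp_process_adapted] by (intro grid_sum_measurable) auto
  have Nm: "exp_ito a b t \<in> borel_measurable M"
    using adapted_continuous_measurable(2)[OF exp_ito_adapted t] .
  consider "t = 0" | "0 < t" "a = 0" | "0 < t" "a \<noteq> 0" using t by linarith
  then show ?thesis
  proof cases
    case 1
    show ?thesis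
      by (rule conv_prob_AE_tendsto[OF Gm Nm AE_I2]) (use 1 in \<open>simp add: grid_sum_def exp_ito_0\<close>)
  next
    case 2
    have "grid_sum ?X t (Suc n) \<omega> = W t \<omega>" if "\<omega> \<in> space M" for n \<omega>
    proof -
      have "grid_sum ?X t (Suc n) \<omega> = (\<Sum>i<Suc n. W (grid t (Suc n) (Suc i)) \<omega> - W (grid t (Suc n) i) \<omega>)"
        unfolding grid_sum_def using 2 ab by simp
      also have "\<dots> = W (grid t (Suc n) (Suc n)) \<omega> - W (grid t (Suc n) 0) \<omega>"
        by (rule sum_lessThan_telescope)
      finally show ?thesis using W_0[OF that] by simp
    qed
    then have "conv_prob (\<lambda>n. grid_sum ?X t (Suc n)) (exp_ito a b t)"
      by (intro conv_prob_AE_tendsto[OF Gm Nm AE_I2]) (simp add: exp_ito_def 2)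
    then show ?thesis using conv_prob_Suc[of "grid_sum ?X t", OF Gm] by simp
  next
    case 3
    note c = grid_sum_exp[OF 3(1), of a b]
    have "grid_sum ?X t n \<omega> = 1 / a * grid_sum (\<lambda>s \<omega>. a * ?X s \<omega>) t n \<omega> + 0 * grid_sum (\<lambda>s \<omega>. a * ?X s \<omega>) t n \<omega>" for n \<omega>
      unfolding grid_sum_lincomb[symmetric] using 3 by simp
    then show ?thesis
      by (intro conv_prob_cong[OF conv_prob_lincomb[OF c c, of "1 / a" 0] Gm Nm])
         (use 3 in \<open>auto simp: exp_ito_def\<close>)
  qed
qed

text \<open>The mean is read off from the explicit formula: that of the time integral is
  \<open>exp_primitive c t\<close>, and \<open>exp (c t) - 1 - c * exp_primitive c t\<close>
  vanishes identically.\<close>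

lemma exp_ito_mean:
  assumes t: "0 \<le> t" shows "has_bochner_integral M (exp_ito a b t) 0"
proof (cases "a = 0")
  case True
  then show ?thesis using W_moments(1)[OF t] by (simp add: exp_ito_def[abs_def])
next
  case False
  let ?c = "b + a\<^sup>2 / 2" and ?X = "\<lambda>s \<omega>. exp (a * W s \<omega> + b * s)"
  have one: "has_bochner_integral M (\<lambda>\<omega>. 1::real) 1" by (simp add: has_bochner_integral_iff prob_space)
  have "has_bochner_integral M (\<lambda>\<omega>. 1 / a * (?X t \<omega> - 1 - ?c * path_integral ?X t \<omega>))
      (1 / a * (exp (?c * t) - 1 - ?c * exp_primitive ?c t))"
    by (intro has_bochner_integral_mult_right has_bochner_integral_diff one path_integral_exp_mean exp_process_mean t)
  moreover have "exp (?c * t) - 1 - ?c * exp_primitive ?c t = 0" by (simp add: exp_primitive_def)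
  ultimately show ?thesis using False by (simp add: exp_ito_def[abs_def])
qed

text \<open>The triangle inequality in the formula for \<open>exp_ito\<close>, and
  \<open>\<bar>W t\<bar> \<le> 1 + (W t)^2\<close> if \<open>a = 0\<close>. With
  \<open>c = b + a^2 / 2\<close> this grows no faster than \<open>exp (c t)\<close> up to constants
  and terms linear in \<open>t\<close>, whereas the root mean square can grow at the rate
  \<open>c + a^2 / 2\<close>, which \<open>c < l\<close> need not control.\<close>

definition exp_ito_bound :: "real \<Rightarrow> real \<Rightarrow> real \<Rightarrow> real" where
  "exp_ito_bound a b t = (if a = 0 then 1 + t else
     1 / \<bar>a\<bar> * (exp ((b + a\<^sup>2 / 2) * t) + 1 + \<bar>b + a\<^sup>2 / 2\<bar> * exp_primitive (b + a\<^sup>2 / 2) t))"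

lemma exp_ito_abs_mean_le:
  assumes t: "0 \<le> t" shows "(\<integral>\<omega>. \<bar>exp_ito a b t \<omega>\<bar> \<partial>M) \<le> exp_ito_bound a b t"
proof -
  let ?c = "b + a\<^sup>2 / 2" and ?X = "\<lambda>s \<omega>. exp (a * W s \<omega> + b * s)"
  have one: "has_bochner_integral M (\<lambda>\<omega>. 1::real) 1" by (simp add: has_bochner_integral_iff prob_space)
  define B where "B \<omega> = (if a = 0 then 1 + (W t \<omega>)\<^sup>2 else 1 / \<bar>a\<bar> * (?X t \<omega> + 1 + \<bar>?c\<bar> * path_integral ?X t \<omega>))" for \<omega>
  have B: "has_bochner_integral M B (exp_ito_bound a b t)"
    unfolding B_def[abs_def] exp_ito_bound_def
    by (cases "a = 0") (auto intro!: has_bochner_integral_mult_right has_bochner_integral_add one W_moments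
        path_integral_exp_mean exp_process_mean t)
  have "\<bar>exp_ito a b t \<omega>\<bar> \<le> B \<omega>" for \<omega>
  proof (cases "a = 0")
    case True
    have "\<bar>x\<bar> \<le> 1 + x\<^sup>2" for x :: real
      using zero_le_power2[of "\<bar>x\<bar> - 1"] by (simp add: power2_diff)
    then show ?thesis using True by (simp add: exp_ito_def B_def)
  next
    case False
    have "0 \<le> path_integral ?X t \<omega>" unfolding path_integral_def by (rule integral_nonneg_AE) simp
    then have "\<bar>?X t \<omega> - 1 - ?c * path_integral ?X t \<omega>\<bar> \<le> ?X t \<omega> + 1 + \<bar>?c\<bar> * path_integral ?X t \<omega>"
      using abs_triangle_ineq4[of "?X t \<omega> - 1" "?c * path_integral ?X t \<omega>"] abs_triangle_ineq4[of "?X t \<omega>" 1]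
      by (simp add: abs_mult)
    then show ?thesis using False by (simp add: exp_ito_def B_def divide_right_mono)
  qed
  then have "(\<integral>\<omega>. \<bar>exp_ito a b t \<omega>\<bar> \<partial>M) \<le> (\<integral>\<omega>. B \<omega> \<partial>M)"
    using exp_ito_mean[OF t, of a b] B by (intro integral_mono integrable_abs) (auto intro: integrable.intros)
  then show ?thesis using has_bochner_integral_integral_eq[OF B] by simp
qed

lemma exp_ito_bound_integrable:
  assumes l: "0 < l" "b + a\<^sup>2 / 2 < l"
  shows "integrable lborel (\<lambda>t. exponential_density l t * exp_ito_bound a b t)"
proof -
  let ?e = "exponential_density l" and ?c = "b + a\<^sup>2 / 2"
  have i: "integrable lborel ?e" "integrable lborel (\<lambda>t. ?e t * t)" "integrable lborel (\<lambda>t. ?e t * exp (?c * t))"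
    "integrable lborel (\<lambda>t. ?e t * exp_primitive ?c t)"
    using has_bochner_integral_erlang_density[OF l(1)] exponential_density_times_id[OF l(1)]
      exponential_density_times_exp[OF l] exponential_density_times_exp_primitive[OF l]
    by (auto intro: integrable.intros)
  show ?thesis
  proof (cases "a = 0")
    case True
    then show ?thesis using Bochner_Integration.integrable_add[OF i(1,2)] by (simp add: exp_ito_bound_def distrib_left)
  next
    case False
    have "integrable lborel (\<lambda>t. 1 / \<bar>a\<bar> * (?e t * exp (?c * t) + ?e t + \<bar>?c\<bar> * (?e t * exp_primitive ?c t)))"
      by (intro integrable_mult_right Bochner_Integration.integrable_add i)
    also have "(\<lambda>t. 1 / \<bar>a\<bar> * (?e t * exp (?c * t) + ?e t + \<bar>?c\<bar> * (?e t * exp_primitive ?c t))) =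
      (\<lambda>t. ?e t * exp_ito_bound a b t)"
      using False by (simp add: exp_ito_bound_def fun_eq_iff algebra_simps)
    finally show ?thesis .
  qed
qed

end

section \<open>The two-chain model\<close>

lemma progressively_measurable_compose:
  assumes Q: "progressively_measurable F Q" and g: "g \<in> borel_measurable borel"
  shows "progressively_measurable F (\<lambda>s \<omega>. g (Q s \<omega>))"
  unfolding progressively_measurable_def
proof (intro allI impI)
  fix t :: real assume "0 \<le> t"
  then have "(\<lambda>z. Q (fst z) (snd z)) \<in> borel_measurable (restrict_space borel {0..t} \<Otimes>\<^sub>M F t)"
    using Q by (simp add: progressively_measurable_def case_prod_beta')
  from measurable_compose[OF this g]
  show "(\<lambda>(s, \<omega>). g (Q s \<omega>)) \<in> borel_measurable (restrict_space borel {0..t} \<Otimes>\<^sub>M F t)"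
    by (simp add: case_prod_beta')
qed

text \<open>Put \<open>s = sqrt p\<close> and \<open>x = exp (\<mu> \<Delta> / 2)\<close>. The extra
  profit of acting at once is a difference of squares,
  \<open>lam * s (1 - x) (s (1 + x) - 2)\<close>. Since
  \<open>1 - x \<le> - \<mu> \<Delta> / 2\<close> and \<open>x < 1\<close>, it is at most
  \<open>lam \<Delta> s (s - 1) (- \<mu>)\<close> when the last factor is positive, and this equals
  \<open>lam \<Delta> p\<close> times the depreciation term
  \<open>(1 - 1 / s) (- \<mu>)\<close>.\<close>

lemma inventory_gain_le:
  fixes lam \<Delta> p \<mu> :: real
  assumes lam: "lam > 0" and \<Delta>: "\<Delta> > 0" and p: "p > 1" and small: "1 / lam > \<Delta> * p" and \<mu>: "\<mu> < 0"
  shows "lam * (sqrt p - 1)\<^sup>2 + (1 - sqrt (1 / p)) * \<mu> \<le> lam * (sqrt p * exp (\<mu> * \<Delta> / 2) - 1)\<^sup>2"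
proof -
  define s where "s = sqrt p"
  define x where "x = exp (\<mu> * \<Delta> / 2)"
  define v where "v = - \<mu>"
  have s: "1 < s" "s * s = p" "sqrt (1 / p) = 1 / s" using p by (auto simp: s_def real_sqrt_divide)
  have v: "0 < v" using \<mu> by (simp add: v_def)
  have "\<mu> * \<Delta> / 2 < 0" using \<mu> \<Delta> by (simp add: mult_neg_pos)
  then have x: "0 < x" "x < 1" by (auto simp: x_def)
  have "1 + \<mu> * \<Delta> / 2 \<le> x" unfolding x_def by (rule exp_ge_add_one_self)
  then have x_ge: "1 - x \<le> v * \<Delta> / 2" by (simp add: v_def)
  have small': "lam * \<Delta> * (s * s) \<le> 1" using small lam s by (simp add: field_simps)
  \<comment> \<open>The sign of the last factor decides: if it is not positive the left side is at
    most 0; otherwise all factors are nonnegative and can be bounded one by one.\<close>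
  have "lam * (s * (1 - x) * (s * (1 + x) - 2)) \<le> (1 - 1 / s) * v"
  proof (cases "s * (1 + x) \<le> 2")
    case True
    then have "lam * (s * (1 - x) * (s * (1 + x) - 2)) \<le> 0"
      using lam s x by (intro mult_nonneg_nonpos mult_nonneg_nonneg) auto
    moreover have "0 \<le> (1 - 1 / s) * v" using s v by (intro mult_nonneg_nonneg) auto
    ultimately show ?thesis by simp
  next
    case False
    have "s * (1 + x) \<le> s * 2" using s x by (intro mult_left_mono) auto
    then have "s * (1 + x) - 2 \<le> 2 * (s - 1)" by simp
    then have "lam * (s * (1 - x) * (s * (1 + x) - 2)) \<le> lam * (s * (v * \<Delta> / 2) * (2 * (s - 1)))"
      using lam s x x_ge False v \<Delta> by (intro mult_left_mono mult_mono mult_nonneg_nonneg) auto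
    also have "\<dots> = (lam * \<Delta> * (s * s)) * ((1 - 1 / s) * v)" using s(1) by (simp add: field_simps)
    also have "\<dots> \<le> 1 * ((1 - 1 / s) * v)"
      using s v by (intro mult_right_mono small' mult_nonneg_nonneg) auto
    finally show ?thesis by simp
  qed
  moreover have "s * (1 - x) * (s * (1 + x) - 2) = (s - 1)\<^sup>2 - (s * x - 1)\<^sup>2"
    by (simp add: power2_eq_square algebra_simps)
  ultimately have "lam * ((s - 1)\<^sup>2 - (s * x - 1)\<^sup>2) \<le> (1 - 1 / s) * v" by simp
  then show ?thesis
    unfolding s_def[symmetric] x_def[symmetric] s(3) by (simp add: v_def right_diff_distrib)
qed

section \<open>Existence and uniqueness of the integral process\<close>

context brownian
begin

lemma at_random_time_measurable:
  assumes Z: "adapted_continuous M F Z" and \<tau>: "\<tau> \<in> borel_measurable M" "\<And>\<omega>. \<omega> \<in> space M \<Longrightarrow> 0 \<le> \<tau> \<omega>"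
  shows "(\<lambda>\<omega>. Z (\<tau> \<omega>) \<omega>) \<in> borel_measurable M"
proof -
  have "(\<lambda>\<omega>. (\<tau> \<omega>, \<omega>)) \<in> measurable M (borel \<Otimes>\<^sub>M M)" using \<tau>(1) by measurable
  from measurable_compose[OF this adapted_continuous_joint[OF Z]]
  have "(\<lambda>\<omega>. Z (max 0 (\<tau> \<omega>)) \<omega>) \<in> borel_measurable M" by simp
  also have "?this \<longleftrightarrow> ?thesis" by (rule measurable_cong) (simp add: \<tau>(2))
  finally show ?thesis .
qed

text \<open>Supplies the version that makes the choice in \<open>ito_integral\<close> meaningful.
  The given coefficients agree with continuous ones only almost surely, so their progressive
  measurability is assumed, and it yields measurability of the drift integral by clipping.\<close>

lemma ito_processI:
  assumes a: "progressively_measurable F a" and b: "progressively_measurable F b"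
    and A: "adapted_continuous M F A" and B: "adapted_continuous M F B" and N: "adapted_continuous M F N"
    and eq: "AE \<omega> in M. \<forall>s\<ge>0. a s \<omega> = A s \<omega> \<and> b s \<omega> = B s \<omega>"
    and lim: "\<And>t. 0 \<le> t \<Longrightarrow> conv_prob (grid_sum B t) (N t)"
    and N0: "\<And>\<omega>. \<omega> \<in> space M \<Longrightarrow> N 0 \<omega> = 0"
  shows "ito_process M F W a b (\<lambda>t \<omega>. path_integral A t \<omega> + N t \<omega>)"
proof -
  have Y: "adapted_continuous M F (\<lambda>t \<omega>. path_integral A t \<omega> + N t \<omega>)"
    using adapted_continuous_lincomb[OF path_integral_adapted[OF A] N, of 1 1] by simp
  have int: "AE \<omega> in M. set_integrable lborel {0..t} (\<lambda>s. a s \<omega>) \<and> (LBINT s:{0..t}. a s \<omega>) = path_integral A t \<omega>"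
    if t: "0 \<le> t" for t
    using eq AE_space
  proof eventually_elim
    case (elim \<omega>)
    then have "(\<lambda>s. indicator {0..t} s *\<^sub>R a s \<omega>) = (\<lambda>s. indicator {0..t} s *\<^sub>R A s \<omega>)"
      by (auto simp: indicator_def)
    then show ?case
      using path_integrable[OF A elim(2) t]
      by (simp add: set_integrable_def set_lebesgue_integral_def path_integral_def)
  qed
  have ito: "has_ito_integral M F W b t
      (\<lambda>\<omega>. path_integral A t \<omega> + N t \<omega> - (path_integral A 0 \<omega> + N 0 \<omega>) - (LBINT s:{0..t}. a s \<omega>))" if t: "0 \<le> t" for t
  proof (rule has_ito_integral_cong_AE[OF grid_sum_imp_has_ito_integral[OF B t lim[OF t]] t b])
    have "(\<lambda>(\<omega>, s). a (max 0 (min t s)) \<omega>) \<in> borel_measurable (M \<Otimes>\<^sub>M borel)"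
      by (rule progressively_measurable_clip[OF a t sets_F_subset space_F])
    then have [measurable]: "(\<lambda>z. a (max 0 (min t (snd z))) (fst z)) \<in> borel_measurable (M \<Otimes>\<^sub>M lborel)"
      by (simp add: case_prod_beta' cong: measurable_cong_sets)
    have clip: "(\<lambda>\<omega>. \<integral>s. indicator {0..t} s *\<^sub>R a (max 0 (min t s)) \<omega> \<partial>lborel) \<in> borel_measurable M"
      by (rule lborel.borel_measurable_lebesgue_integral) (simp add: case_prod_beta')
    have clip_eq: "(\<lambda>\<omega>. \<integral>s. indicator {0..t} s *\<^sub>R a (max 0 (min t s)) \<omega> \<partial>lborel) = (\<lambda>\<omega>. LBINT s:{0..t}. a s \<omega>)"
      unfolding set_lebesgue_integral_def
      by (intro ext Bochner_Integration.integral_cong) (auto simp: indicator_def)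
    have "(\<lambda>\<omega>. LBINT s:{0..t}. a s \<omega>) \<in> borel_measurable M" using clip unfolding clip_eq .
    moreover have "(\<lambda>\<omega>. path_integral A s \<omega> + N s \<omega>) \<in> borel_measurable M" if "0 \<le> s" for s
      using adapted_continuous_measurable(2)[OF Y that] .
    ultimately show "(\<lambda>\<omega>. path_integral A t \<omega> + N t \<omega> - (path_integral A 0 \<omega> + N 0 \<omega>) - (LBINT s:{0..t}. a s \<omega>)) \<in> borel_measurable M"
      using t by (intro borel_measurable_diff) auto
    show "AE \<omega> in M. (\<forall>s. 0 \<le> s \<longrightarrow> s \<le> t \<longrightarrow> B s \<omega> = b s \<omega>) \<and> N t \<omega> =
      path_integral A t \<omega> + N t \<omega> - (path_integral A 0 \<omega> + N 0 \<omega>) - (LBINT s:{0..t}. a s \<omega>)"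
      using eq int[OF t] AE_space by eventually_elim (simp add: N0 path_integral_0)
  qed
  have si: "AE \<omega> in M. set_integrable lborel {0..t} (\<lambda>s. a s \<omega>)" if "0 \<le> t" for t
    using int[OF that] by eventually_elim simp
  show ?thesis unfolding ito_process_def using Y a si ito by blast
qed

text \<open>At each time both stochastic integrals are limits of the same left-point sums of
  \<open>B\<close>, and the drift integrals are identical; continuity then merges the null
  sets.\<close>

lemma ito_process_unique:
  assumes Y: "ito_process M F W a b Y" and Z: "ito_process M F W a b Z"
    and 0: "\<And>\<omega>. \<omega> \<in> space M \<Longrightarrow> Y 0 \<omega> = 0 \<and> Z 0 \<omega> = 0"
    and B: "adapted_continuous M F B" and eq: "AE \<omega> in M. \<forall>s\<ge>0. b s \<omega> = B s \<omega>"
  shows "AE \<omega> in M. \<forall>t\<ge>0. Y t \<omega> = Z t \<omega>"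
proof (rule AE_all_times_eq)
  show "continuous_on {0..} (\<lambda>t. Y t \<omega>)" "continuous_on {0..} (\<lambda>t. Z t \<omega>)" if "\<omega> \<in> space M" for \<omega>
    using Y Z that by (auto simp: ito_process_def adapted_continuous_def)
  fix t :: real assume t: "0 < t"
  have conv: "conv_prob (grid_sum B t) (\<lambda>\<omega>. X t \<omega> - X 0 \<omega> - (LBINT s:{0..t}. a s \<omega>))"
    if X: "ito_process M F W a b X" for X
  proof -
    have I: "has_ito_integral M F W b t (\<lambda>\<omega>. X t \<omega> - X 0 \<omega> - (LBINT s:{0..t}. a s \<omega>))"
      using X t by (simp add: ito_process_def)
    then have "(\<lambda>\<omega>. X t \<omega> - X 0 \<omega> - (LBINT s:{0..t}. a s \<omega>)) \<in> borel_measurable M"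
      by (simp add: has_ito_integral_def)
    then have "has_ito_integral M F W B t (\<lambda>\<omega>. X t \<omega> - X 0 \<omega> - (LBINT s:{0..t}. a s \<omega>))"
      using eq t by (intro has_ito_integral_cong_AE[OF I _ adapted_continuous_progressive[OF B]])
        (auto elim!: eventually_mono)
    then show ?thesis by (rule has_ito_integral_imp_grid_sum[OF _ B t])
  qed
  show "AE \<omega> in M. Y t \<omega> = Z t \<omega>"
    using conv_prob_unique[OF conv[OF Y] conv[OF Z]] AE_space by eventually_elim (simp add: 0)
qed

text \<open>\<open>Y\<close> witnesses that the choice is made from a nonempty set, so the chosen
  process has the defining properties, and uniqueness makes it indistinguishable from
  \<open>Y\<close>.\<close>

lemma ito_integral_AE_eq:
  assumes Y: "ito_process M F W (\<lambda>s \<omega>. H s \<omega> * a s \<omega>) (\<lambda>s \<omega>. H s \<omega> * b s \<omega>) Y"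
    and Y0: "\<And>\<omega>. \<omega> \<in> space M \<Longrightarrow> Y 0 \<omega> = 0"
    and B: "adapted_continuous M F B" and eq: "AE \<omega> in M. \<forall>s\<ge>0. H s \<omega> * b s \<omega> = B s \<omega>"
  shows "adapted_continuous M F (ito_integral M F W a b H)"
    and "AE \<omega> in M. \<forall>t\<ge>0. ito_integral M F W a b H t \<omega> = Y t \<omega>"
proof -
  let ?I = "ito_integral M F W a b H"
  have "\<exists>Y. ito_process M F W (\<lambda>s \<omega>. H s \<omega> * a s \<omega>) (\<lambda>s \<omega>. H s \<omega> * b s \<omega>) Y \<and> (\<forall>\<omega>\<in>space M. Y 0 \<omega> = 0)"
    using Y Y0 by blast
  then have I: "ito_process M F W (\<lambda>s \<omega>. H s \<omega> * a s \<omega>) (\<lambda>s \<omega>. H s \<omega> * b s \<omega>) ?I \<and> (\<forall>\<omega>\<in>space M. ?I 0 \<omega> = 0)"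
    unfolding ito_integral_def by (rule someI_ex)
  then show "adapted_continuous M F ?I" by (simp add: ito_process_def)
  show "AE \<omega> in M. \<forall>t\<ge>0. ?I t \<omega> = Y t \<omega>"
    by (rule ito_process_unique[OF conjunct1[OF I] Y _ B eq]) (use I Y0 in auto)
qed

section \<open>Closed forms of reserves, cost and payoffs\<close>

lemma reserve_A_explicit:
  assumes Q0: "0 < Q0" and q: "Q t \<omega> = Q0 * exp (\<sigma> * W t \<omega> + (\<mu> - \<sigma>\<^sup>2 / 2) * t)"
  shows "reserve_A Q Q0 RB0 k t \<omega> = Q0 * RB0 * exp ((1 - k) * \<sigma> * W t \<omega> + (1 - k) * (\<mu> - \<sigma>\<^sup>2 / 2) * t)"
proof -
  define e where "e = \<mu> - \<sigma>\<^sup>2 / 2"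
  define L where "L = \<sigma> * W t \<omega> + e * t"
  have "Q0 / Q t \<omega> = exp (- L)" using Q0 by (simp add: q L_def e_def exp_minus field_simps)
  then have "(Q0 / Q t \<omega>) powr k = exp (- (k * L))" by (simp add: powr_def)
  then have "reserve_A Q Q0 RB0 k t \<omega> = Q0 * RB0 * (exp L * exp (- (k * L)))"
    using q by (simp add: reserve_A_def reserve_B_def e_def[symmetric] L_def[symmetric])
  also have "exp L * exp (- (k * L)) = exp ((1 - k) * \<sigma> * W t \<omega> + (1 - k) * (\<mu> - \<sigma>\<^sup>2 / 2) * t)"
    unfolding exp_add[symmetric] L_def e_def[symmetric] by (simp add: algebra_simps)
  finally show ?thesis .
qed

text \<open>The inventory times \<open>Q\<close> is \<open>1 - sqrt (1 / p)\<close> times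
  \<open>R^A\<close>, so the gain has drift and noise coefficients proportional to the same
  exponential \<open>X\<close>. Everything reduces to the means at \<open>\<tau>\<close> of
  \<open>X\<close>, of its time integral, and of its integral against \<open>W\<close>.\<close>

lemma two_chain_expectations:
  fixes Q0 RB0 k p lam \<sigma> \<mu> :: real
  assumes model: "two_chain_model M F W Q \<tau> \<mu> \<sigma> lam Q0"
    and lam: "0 < lam" and Q0: "0 < Q0" and \<sigma>: "\<sigma> \<noteq> 0"
  defines "c \<equiv> (1 - k) * (\<mu> - k * \<sigma>\<^sup>2 / 2)"
  assumes c: "c < lam"
  shows "has_bochner_integral M (\<lambda>\<omega>. reserve_A Q Q0 RB0 k (\<tau> \<omega>) \<omega>) (Q0 * RB0 * (lam / (lam - c)))"
    and "inventory_cost M F W Q \<tau> \<mu> \<sigma> (inventory Q p Q0 RB0 k) = - ((1 - sqrt (1 / p)) * (Q0 * RB0) * \<mu> * (1 / (lam - c)))"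
proof -
  define a b where "a = (1 - k) * \<sigma>" and "b = (1 - k) * (\<mu> - \<sigma>\<^sup>2 / 2)"
  define X where "X = (\<lambda>s \<omega>. exp (a * W s \<omega> + b * s))"
  define r where "r = (1 - sqrt (1 / p)) * (Q0 * RB0)"
  \<comment> \<open>Since \<open>\<sigma>\<close> is nonzero, \<open>a = 0\<close> forces
    \<open>k = 1\<close>; then \<open>X\<close> is constantly 1, the degenerate case that
    \<open>exp_ito\<close> covers by \<open>W\<close>.\<close>
  have ab: "a = 0 \<Longrightarrow> b = 0" using \<sigma> by (simp add: a_def b_def)
  have c_eq: "b + a\<^sup>2 / 2 = c" by (simp add: a_def b_def c_def power2_eq_square field_simps)
  have gbm: "geometric_brownian_motion M F W \<mu> \<sigma> Q0 Q" and \<tau>0: "\<And>\<omega>. \<omega> \<in> space M \<Longrightarrow> 0 \<le> \<tau> \<omega>"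
    and d: "distributed M lborel \<tau> (exponential_density lam)"
    using model by (auto simp: two_chain_model_def)
  define G where "G = vimage_algebra (space M) (\<lambda>\<omega>. \<lambda>t\<in>{0..}. W t \<omega>) (\<Pi>\<^sub>M t\<in>{0..}. borel)"
  have ind: "indep_set (sets (vimage_algebra (space M) \<tau> borel)) (sets G)"
    using model unfolding two_chain_model_def G_def by blast
  have G: "space G = space M" "sets G \<subseteq> sets M"
    using ind unfolding indep_sets2_eq by (auto simp: G_def)
  have WG: "W t \<in> borel_measurable G" if "0 \<le> t" for t
  proof -
    have "(\<lambda>\<omega>. \<lambda>t\<in>{0..}. W t \<omega>) \<in> measurable G (\<Pi>\<^sub>M t\<in>{0..}. borel)"
      unfolding G_def by (rule measurable_vimage_algebra1) (auto simp: space_PiM)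
    from measurable_compose[OF this measurable_component_singleton[of t]] that show ?thesis by simp
  qed
  have \<tau>m: "\<tau> \<in> borel_measurable M" using distributed_measurable[OF d] by simp
  have Qad: "adapted_continuous M F Q" using gbm by (simp add: geometric_brownian_motion_def ito_process_def)
  have X: "adapted_continuous M F X" unfolding X_def by (rule exp_process_adapted)
  have XG: "X t \<in> borel_measurable G" if "0 \<le> t" for t
    unfolding X_def using WG[OF that] by measurable
  have JG: "path_integral X t \<in> borel_measurable G" if "0 \<le> t" for t
    by (rule path_integral_measurable[OF X that G(1) XG])
  have NG: "exp_ito a b t \<in> borel_measurable G" if "0 \<le> t" for t
    unfolding exp_ito_def[abs_def] X_def[symmetric]
    using WG[OF that] XG[OF that] JG[OF that] by (cases "a = 0") (simp_all add: X_def)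
  note cont = adapted_continuous_def[THEN iffD1, THEN conjunct2, rule_format]
  have "\<forall>\<omega>\<in>space M. 0 \<le> \<tau> \<omega>" using \<tau>0 by simp
  note time = indep_time_expectation[OF lam d this G ind]
  have EX: "has_bochner_integral M (\<lambda>\<omega>. X (\<tau> \<omega>) \<omega>) (lam / (lam - c))"
  proof (rule time)
    show "X t \<in> borel_measurable G" if "0 \<le> t" for t by (rule XG[OF that])
    show "continuous_on {0..} (\<lambda>t. X t \<omega>)" if "\<omega> \<in> space M" for \<omega> by (rule cont[OF X that])
    show m: "has_bochner_integral M (X t) (exp (c * t))" if "0 \<le> t" for t
      unfolding X_def c_eq[symmetric] by (rule exp_process_mean[OF that])
    show "(\<integral>\<omega>. \<bar>X t \<omega>\<bar> \<partial>M) \<le> exp (c * t)" if "0 \<le> t" for t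
      using has_bochner_integral_integral_eq[OF m[OF that]] by (simp add: X_def)
    show "has_bochner_integral lborel (\<lambda>t. exponential_density lam t * exp (c * t)) (lam / (lam - c))"
      using lam c by (rule exponential_density_times_exp)
    then show "integrable lborel (\<lambda>t. exponential_density lam t * exp (c * t))" by (rule integrable.intros)
  qed
  have EJ: "has_bochner_integral M (\<lambda>\<omega>. path_integral X (\<tau> \<omega>) \<omega>) (1 / (lam - c))"
  proof (rule time)
    show "path_integral X t \<in> borel_measurable G" if "0 \<le> t" for t by (rule JG[OF that])
    show "continuous_on {0..} (\<lambda>t. path_integral X t \<omega>)" if "\<omega> \<in> space M" for \<omega>
      by (rule cont[OF path_integral_adapted[OF X] that])
    show m: "has_bochner_integral M (path_integral X t) (exp_primitive c t)" if "0 \<le> t" for t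
      unfolding X_def c_eq[symmetric] by (rule path_integral_exp_mean[OF that])
    have "0 \<le> path_integral X t \<omega>" for t \<omega>
      unfolding path_integral_def by (rule integral_nonneg_AE) (simp add: X_def)
    then show "(\<integral>\<omega>. \<bar>path_integral X t \<omega>\<bar> \<partial>M) \<le> exp_primitive c t" if "0 \<le> t" for t
      using has_bochner_integral_integral_eq[OF m[OF that]] by simp
    show "has_bochner_integral lborel (\<lambda>t. exponential_density lam t * exp_primitive c t) (1 / (lam - c))"
      using lam c by (rule exponential_density_times_exp_primitive)
    then show "integrable lborel (\<lambda>t. exponential_density lam t * exp_primitive c t)" by (rule integrable.intros)
  qed
  have EN: "has_bochner_integral M (\<lambda>\<omega>. exp_ito a b (\<tau> \<omega>) \<omega>) 0"
  proof (rule time)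
    show "exp_ito a b t \<in> borel_measurable G" if "0 \<le> t" for t by (rule NG[OF that])
    show "continuous_on {0..} (\<lambda>t. exp_ito a b t \<omega>)" if "\<omega> \<in> space M" for \<omega>
      by (rule cont[OF exp_ito_adapted that])
    show "has_bochner_integral M (exp_ito a b t) 0" "(\<integral>\<omega>. \<bar>exp_ito a b t \<omega>\<bar> \<partial>M) \<le> exp_ito_bound a b t" if "0 \<le> t" for t
      by (rule exp_ito_mean[OF that], rule exp_ito_abs_mean_le[OF that])
    show "integrable lborel (\<lambda>t. exponential_density lam t * exp_ito_bound a b t)"
      by (rule exp_ito_bound_integrable) (use lam c c_eq in auto)
  qed (simp add: has_bochner_integral_iff)
  have RA: "AE \<omega> in M. \<forall>t\<ge>0. reserve_A Q Q0 RB0 k t \<omega> = Q0 * RB0 * X t \<omega>"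
    using geometric_brownian_motion_explicit[OF gbm]
    by eventually_elim (simp add: reserve_A_explicit[OF Q0] X_def a_def b_def)
  have Q\<tau>: "(\<lambda>\<omega>. Q (\<tau> \<omega>) \<omega>) \<in> borel_measurable M" by (rule at_random_time_measurable[OF Qad \<tau>m \<tau>0])
  have RAm: "(\<lambda>\<omega>. reserve_A Q Q0 RB0 k (\<tau> \<omega>) \<omega>) \<in> borel_measurable M"
    unfolding reserve_A_def reserve_B_def using Q\<tau> by measurable
  have RAX: "has_bochner_integral M (\<lambda>\<omega>. Q0 * RB0 * X (\<tau> \<omega>) \<omega>) (Q0 * RB0 * (lam / (lam - c)))"
    by (rule has_bochner_integral_mult_right[OF EX])
  have RA\<tau>: "AE \<omega> in M. Q0 * RB0 * X (\<tau> \<omega>) \<omega> = reserve_A Q Q0 RB0 k (\<tau> \<omega>) \<omega>"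
    using RA AE_space by eventually_elim (simp add: \<tau>0)
  show "has_bochner_integral M (\<lambda>\<omega>. reserve_A Q Q0 RB0 k (\<tau> \<omega>) \<omega>) (Q0 * RB0 * (lam / (lam - c)))"
    using RAX has_bochner_integral_cong_AE[OF borel_measurable_has_bochner_integral[OF RAX] RAm RA\<tau>] by simp

  let ?H = "inventory Q p Q0 RB0 k"
  let ?Z = "ito_integral M F W (\<lambda>t \<omega>. \<mu> * Q t \<omega>) (\<lambda>t \<omega>. \<sigma> * Q t \<omega>) ?H"
  \<comment> \<open>\<open>A\<close> and \<open>B\<close> are continuous versions of the drift and
    noise coefficients of the gain, and \<open>N\<close> is the integral of \<open>B\<close> against
    \<open>W\<close>.\<close>
  define A where "A = (\<lambda>s \<omega>. r * \<mu> * X s \<omega>)"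
  define B where "B = (\<lambda>s \<omega>. r * \<sigma> * X s \<omega>)"
  define N where "N = (\<lambda>s \<omega>. r * \<sigma> * exp_ito a b s \<omega>)"
  have scale: "adapted_continuous M F (\<lambda>s \<omega>. x * Y s \<omega>)" if "adapted_continuous M F Y" for Y x
    using adapted_continuous_lincomb[OF that that, of x 0] by simp
  have prog: "progressively_measurable F (\<lambda>s \<omega>. ?H s \<omega> * (x * Q s \<omega>))" for x
    unfolding inventory_def reserve_B_def
    by (rule progressively_measurable_compose[OF adapted_continuous_progressive[OF Qad],
          of "\<lambda>q. (1 - sqrt (1 / p)) * ((Q0 / q) powr k * RB0) * (x * q)"]) measurable
  have HQ: "AE \<omega> in M. \<forall>s\<ge>0. ?H s \<omega> * (\<mu> * Q s \<omega>) = A s \<omega> \<and> ?H s \<omega> * (\<sigma> * Q s \<omega>) = B s \<omega>"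
    using RA
  proof eventually_elim
    case (elim \<omega>)
    have "?H s \<omega> * (x * Q s \<omega>) = r * x * X s \<omega>" if "0 \<le> s" for s x
    proof -
      have "?H s \<omega> * (x * Q s \<omega>) = (1 - sqrt (1 / p)) * x * reserve_A Q Q0 RB0 k s \<omega>"
        by (simp add: inventory_def reserve_A_def)
      then show ?thesis using elim that by (simp add: r_def)
    qed
    then show ?case by (simp add: A_def B_def)
  qed
  have "ito_process M F W (\<lambda>s \<omega>. ?H s \<omega> * (\<mu> * Q s \<omega>)) (\<lambda>s \<omega>. ?H s \<omega> * (\<sigma> * Q s \<omega>)) (\<lambda>t \<omega>. path_integral A t \<omega> + N t \<omega>)"
  proof (rule ito_processI[OF prog prog _ _ _ HQ])
    show "adapted_continuous M F A" "adapted_continuous M F B" "adapted_continuous M F N"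
      unfolding A_def B_def N_def by (intro scale X exp_ito_adapted)+
    show "N 0 \<omega> = 0" if "\<omega> \<in> space M" for \<omega> using that by (simp add: N_def exp_ito_0)
    fix t :: real assume t: "0 \<le> t"
    have g: "conv_prob (grid_sum X t) (exp_ito a b t)" unfolding X_def by (rule exp_ito_grid_sum[OF t ab])
    have "conv_prob (\<lambda>n \<omega>. r * \<sigma> * grid_sum X t n \<omega> + 0 * grid_sum X t n \<omega>) (\<lambda>\<omega>. r * \<sigma> * exp_ito a b t \<omega> + 0 * exp_ito a b t \<omega>)"
      by (rule conv_prob_lincomb[OF g g])
    also have "(\<lambda>n \<omega>. r * \<sigma> * grid_sum X t n \<omega> + 0 * grid_sum X t n \<omega>) = grid_sum B t"
      unfolding grid_sum_lincomb[symmetric] by (simp add: B_def fun_eq_iff)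
    finally show "conv_prob (grid_sum B t) (N t)" by (simp add: N_def)
  qed
  note Z = ito_integral_AE_eq[OF this, of B]
  have N0: "path_integral A 0 \<omega> + N 0 \<omega> = 0" if "\<omega> \<in> space M" for \<omega>
    using that by (simp add: path_integral_0 N_def exp_ito_0)
  have Bad: "adapted_continuous M F B" unfolding B_def by (rule scale[OF X])
  have HB: "AE \<omega> in M. \<forall>s\<ge>0. ?H s \<omega> * (\<sigma> * Q s \<omega>) = B s \<omega>" using HQ by eventually_elim simp
  have Zad: "adapted_continuous M F ?Z" and ZY: "AE \<omega> in M. \<forall>t\<ge>0. ?Z t \<omega> = path_integral A t \<omega> + N t \<omega>"
    using Z[OF N0 Bad HB] by blast+
  have Y: "has_bochner_integral M (\<lambda>\<omega>. r * \<mu> * path_integral X (\<tau> \<omega>) \<omega> + r * \<sigma> * exp_ito a b (\<tau> \<omega>) \<omega>)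
      (r * \<mu> * (1 / (lam - c)) + r * \<sigma> * 0)"
    by (intro has_bochner_integral_add has_bochner_integral_mult_right EJ EN)
  have "(\<integral>\<omega>. ?Z (\<tau> \<omega>) \<omega> \<partial>M) = (\<integral>\<omega>. r * \<mu> * path_integral X (\<tau> \<omega>) \<omega> + r * \<sigma> * exp_ito a b (\<tau> \<omega>) \<omega> \<partial>M)"
  proof (rule integral_cong_AE)
    show "(\<lambda>\<omega>. ?Z (\<tau> \<omega>) \<omega>) \<in> borel_measurable M" by (rule at_random_time_measurable[OF Zad \<tau>m \<tau>0])
    show "(\<lambda>\<omega>. r * \<mu> * path_integral X (\<tau> \<omega>) \<omega> + r * \<sigma> * exp_ito a b (\<tau> \<omega>) \<omega>) \<in> borel_measurable M"
      by (rule borel_measurable_has_bochner_integral[OF Y])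
    have pA: "path_integral A t \<omega> = r * \<mu> * path_integral X t \<omega>" for t \<omega>
    proof -
      have "path_integral A t \<omega> = (\<integral>s. r * \<mu> * (indicator {0..t} s * X s \<omega>) \<partial>lborel)"
        unfolding path_integral_def A_def by (rule Bochner_Integration.integral_cong) (auto simp: mult_ac)
      then show ?thesis by (simp add: path_integral_def)
    qed
    show "AE \<omega> in M. ?Z (\<tau> \<omega>) \<omega> = r * \<mu> * path_integral X (\<tau> \<omega>) \<omega> + r * \<sigma> * exp_ito a b (\<tau> \<omega>) \<omega>"
      using ZY AE_space by eventually_elim (simp add: \<tau>0 N_def pA)
  qed
  also have "\<dots> = r * \<mu> * (1 / (lam - c))" using has_bochner_integral_integral_eq[OF Y] by simp
  finally show "inventory_cost M F W Q \<tau> \<mu> \<sigma> ?H = - ((1 - sqrt (1 / p)) * (Q0 * RB0) * \<mu> * (1 / (lam - c)))"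
    by (simp add: inventory_cost_def r_def)
qed

end

theorem corollary3p3:
  fixes \<sigma> lam \<Delta> p Q0 RB0 k :: real
  assumes "\<sigma> > 0" and "lam > 0" and "\<Delta> > 0" and "p > 1" and "Q0 > 0" and "RB0 > 0"
    and "1 / lam > \<Delta> * p"
  shows "\<exists>\<mu>h::real. - lam \<le> \<mu>h \<and> \<mu>h \<le> 0 \<and>
    (\<forall>\<mu>::real. \<mu> < 0 \<and> lam + (1 - k) * (1 / 2 * k * \<sigma>\<^sup>2 - \<mu>) > 0 \<longrightarrow>
      (\<forall>(M :: 'a measure) F W Q \<tau>. two_chain_model M F W Q \<tau> \<mu> \<sigma> lam Q0 \<longrightarrow>
        (\<mu> > \<mu>h \<longrightarrow> holds_inventory M F W Q \<tau> \<mu> \<sigma> \<Delta> p Q0 RB0 k) \<and>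
        (\<mu> < \<mu>h \<longrightarrow> bridges M F W Q \<tau> \<mu> \<sigma> \<Delta> p Q0 RB0 k)))"
proof -
  have "bridges M F W Q \<tau> \<mu> \<sigma> \<Delta> p Q0 RB0 k"
    if \<mu>: "\<mu> < 0" and pos: "lam + (1 - k) * (1 / 2 * k * \<sigma>\<^sup>2 - \<mu>) > 0"
      and model: "two_chain_model M F W Q \<tau> \<mu> \<sigma> lam Q0"
    for \<mu> and M :: "'a measure" and F W Q \<tau>
  proof -
    have bm: "standard_brownian_motion M F W" using model by (simp add: two_chain_model_def)
    then interpret prob_space M by (simp add: standard_brownian_motion_def)
    interpret brownian M F W by unfold_locales (rule bm)
    define c where "c = (1 - k) * (\<mu> - k * \<sigma>\<^sup>2 / 2)"
    have "(1 - k) * (1 / 2 * k * \<sigma>\<^sup>2 - \<mu>) = - c" by (simp add: c_def algebra_simps)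
    then have c: "c < lam" using pos by simp
    note E = two_chain_expectations[OF model assms(2,5) _ c[unfolded c_def], folded c_def]
    have \<sigma>: "\<sigma> \<noteq> 0" using assms(1) by simp
    \<comment> \<open>The mean of \<open>R^A\<close> at \<open>\<tau>\<close> divided by
      \<open>lam\<close>. It is a nonnegative common factor of both payoffs, so \<open>k\<close> and
      \<open>\<sigma>\<close> drop out of the comparison.\<close>
    define R where "R = Q0 * RB0 / (lam - c)"
    have R: "0 \<le> R" using assms c by (simp add: R_def)
    have EA: "(\<integral>\<omega>. x * reserve_A Q Q0 RB0 k (\<tau> \<omega>) \<omega> \<partial>M) = R * (lam * x)" for x
      using has_bochner_integral_integral_eq[OF E(1)[OF \<sigma>]] by (simp add: R_def)
    have cost: "inventory_cost M F W Q \<tau> \<mu> \<sigma> (inventory Q p Q0 RB0 k) = - (R * ((1 - sqrt (1 / p)) * \<mu>))"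
      unfolding E(2)[OF \<sigma>] by (simp add: R_def)
    have "payoff_inventory M F W Q \<tau> \<mu> \<sigma> p Q0 RB0 k = R * (lam * (sqrt p - 1)\<^sup>2 + (1 - sqrt (1 / p)) * \<mu>)"
      unfolding payoff_inventory_def EA cost by (simp add: distrib_left)
    also have "\<dots> \<le> R * (lam * (sqrt p * exp (\<mu> * \<Delta> / 2) - 1)\<^sup>2)"
      by (intro mult_left_mono R inventory_gain_le assms \<mu>)
    also have "\<dots> = payoff_bridging M Q \<tau> \<mu> \<Delta> p Q0 RB0 k" by (simp only: payoff_bridging_def EA)
    finally show ?thesis by (simp add: bridges_def holds_inventory_def)
  qed
  \<comment> \<open>With the threshold 0, holding inventory is claimed for no
    \<open>\<mu> < 0\<close>, and bridging for all of them.\<close>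
  then show ?thesis using assms(2) by (intro exI[of _ 0]) auto
qed

end
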